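(* Consider the Markovian proximal Bellman-ADMM iteration described in the context, under the coverage/observation assumption and the algorithmic-margin assumption stated there, and define $\Phi_k=\mathcal L_\beta(\pi^k,V^k,\lambda^k)+\tau\|\Delta V_k\|^2$ (with $\Delta V_0=0$). Then there are constants $c_\pi,c_V,c_V',C_E>0$, not depending on $k$ or on the batch schedule, such that for every $k\ge1$ $$\mathbb E[\Phi_k]-\mathbb E[\Phi_{k+1}]\ge c_\pi\mathbb E\|\Delta\pi_{k+1}\|^2+c_V\mathbb E\|\Delta V_{k+1}\|^2+c_V'\mathbb E\|\Delta V_k\|^2-C_E\Big(\frac1{m_k}+\frac1{m_{k-1}}\Big).$$ Moreover there are $\underline\Phi\in\mathbb R$ and $C_L>0$ such that $\mathbb E[\Phi_k]\ge\underline\Phi-C_L/m_{k-1}$ for every $k\ge1$.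
   Context: Norms are Euclidean for vectors and spectral for matrices. MDP: $(\mathcal S,\mathcal A,P,r,\rho,\gamma)$ is a finite discounted MDP with $0<\gamma<1$. Policies are $\pi\in\Pi=\prod_{s\in\mathcal S}\Delta(\mathcal A)\subset\mathbb R^{|\mathcal S||\mathcal A|}$. Set $P_\pi(s,s')=\sum_a\pi(a|s)P(s'|s,a)$, $r_\pi(s)=\sum_a\pi(a|s)r(s,a)$, $M_\pi=I-\gamma P_\pi$, $R(\pi,V)=M_\pi V-r_\pi$ for $V\in\mathbb R^{|\mathcal S|}$. The problem is $\min_{\pi\in\Pi,V}\phi(\pi)+c^{\mathsf T}V$ subject to $R(\pi,V)=0$, where $c\in\mathbb R^{|\mathcal S|}$ and $\phi$ (possibly nonsmooth, nonconvex) is proper, lower semicontinuous and bounded below on $\Pi$ with $\operatorname{dom}\phi\cap\Pi\neq\varnothing$; $\psi=\phi+\delta_\Pi$ with $\delta_\Pi$ the indicator of $\Pi$. The augmented Lagrangian is $\mathcal L_\beta(\pi,V,\lambda)=\phi(\pi)+c^{\mathsf T}V+\langle\lambda,R(\pi,V)\rangle+\frac\beta2\|R(\pi,V)\|^2$. Sampling: at outer iteration $k$ an exploratory behavior policy $\bar\pi^k$ is frozen and a batch of $m_k\geq 1$ steps of the reset chain with kernel $K_k(s,s')=(1-\gamma)\rho(s')+\gamma P_{\bar\pi^k}(s,s')$ is simulated: at step $t$, in state $S_{k,t}$, an action $A_{k,t}\sim\bar\pi^k(\cdot|S_{k,t})$ and a reset indicator (reset with probability $1-\gamma$) are drawn;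 on a reset the next state is drawn from $\rho$, otherwise an environment transition from $P(\cdot|S_{k,t},A_{k,t})$ is observed with reward observation $Y_{k,t}$. From the non-reset transitions of batch $k$ only, form the empirical conditional transition rows $\widehat P_k(\cdot|s,a)$ and average observed rewards $\widehat r_k(s,a)$ for each $(s,a)$; an unvisited transition row is replaced by a fixed probability vector and an unvisited reward entry by a fixed bounded value. Set $\widehat P_{\pi,k}(s,\cdot)=\sum_a\pi(a|s)\widehat P_k(\cdot|s,a)$, $\widehat r_{\pi,k}(s)=\sum_a\pi(a|s)\widehat r_k(s,a)$, $\widehat M_{\pi,k}=I-\gamma\widehat P_{\pi,k}$, $\widehat R_k(\pi,V)=\widehat M_{\pi,k}V-\widehat r_{\pi,k}$, and let $\widehat{\mathcal L}_{\beta,k}$ be $\mathcal L_\beta$ with $R$ replaced by $\widehat R_k$. The constant $\bar\kappa<\infty$ satisfies $\|M_\pi^{-1}\|\le\bar\kappa$ and $\|\widehat M_{\pi,k}^{-1}\|\le\bar\kappa$ for all $\pi,k$ and all realizations (it exists since all rows are stochastic). Algorithm: from $(\pi^0,V^0,\lambda^0)$, with $\beta,\eta_\pi,\eta_V>0$, for $k=0,1,\dots$: $\pi^{k+1}\in\arg\min_{\pi\in\Pi}\{\widehat{\mathcal L}_{\beta,k}(\pi,V^k,\lambda^k)+\frac1{2\eta_\pi}\|\pi-\pi^k\|^2\}$; $V^{k+1}=\arg\min_V\{\widehat{\mathcal L}_{\beta,k}(\pi^{k+1},V,\lambda^k)+\frac1{2\eta_V}\|V-V^k\|^2\}$; $\lambda^{k+1}=\lambda^k+\beta\widehat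 R_k(\pi^{k+1},V^{k+1})$. Write $\Delta\pi_{k+1}=\pi^{k+1}-\pi^k$, and similarly $\Delta V_{k+1},\Delta\lambda_{k+1}$. All of $(\pi^k,V^k,\lambda^k,\bar\pi^k)$ is determined before batch $k$ is drawn (measurable with respect to the sigma-field $\mathcal F_k$ of the history before batch $k$). Coverage/observation assumption: there are $\rho_{\min},\alpha>0$, $R_{\max}<\infty$ with $\rho(s)\ge\rho_{\min}$, $\bar\pi^k(a|s)\ge\alpha$, $|r(s,a)|\le R_{\max}$ for all $k,s,a$. Moreover $Y_{k,t}=r(S_{k,t},A_{k,t})+\zeta_{k,t}$ with $\mathbb E[\zeta_{k,t}|\mathcal G_{k,t}]=0$ and $\mathbb E[|\zeta_{k,t}|^4|\mathcal G_{k,t}]\le M_4<\infty$, where $\mathcal G_{k,t}$ contains all past observations and the current state, action and reset indicator, before the current reward and next state are drawn. Fresh reset coins, reset states and action randomization are independent of the preceding history; on non-reset steps the conditional next-state law is $P(\cdot|S_{k,t},A_{k,t})$; the current reward and next state may be dependent. Algorithmic-margin assumption: the policy subproblem admits a global minimizer and is solved exactly; the value subproblem is solved exactly; $\pi^0$ is deterministic and lies in $\operatorname{dom}\psi$; $\|M_{\pi'}-M_\pi\|\le L_M\|\pi'-\pi\|$ for some $L_M<\infty$; $b(\pi)=\phi(\pi)+c^{\mathsf T}M_\pi^{-1}r_\pi$ is bounded below on $\Pi$; $\beta>\max\{60\bar\kappa^2/\eta_V,\;30\eta_\pi\bar\kappa^4L_M^2\|c\|^2\}$ and $\tau=1/(8\eta_V)$;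 $\mathbb E\|V^0\|^4+\mathbb E\|\lambda^0\|^4<\infty$. *)

theory Defs
  imports "HOL-Probability.Probability"
begin

definition prob_vec :: "('i::finite \<Rightarrow> real) \<Rightarrow> bool" where
  "prob_vec p \<longleftrightarrow> (\<forall>i. 0 \<le> p i) \<and> (\<Sum>i\<in>UNIV. p i) = 1"

text \<open>
  A policy is a vector \<open>\<pi> :: real^'a^'s\<close> with \<open>\<pi> $ s $ a\<close> the probability of
  action \<open>a\<close> in state \<open>s\<close>. The norm of this nested vector type is the Euclidean norm of its
  entries. On square matrices \<open>norm\<close> would be the Frobenius norm, hence \<open>spec_norm\<close>.
\<close>

definition policies :: "(real^'a::finite^'s::finite) set" where
  "policies = {\<pi>. \<forall>s. prob_vec (\<lambda>a. \<pi> $ s $ a)}"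

definition spec_norm :: "real^'s::finite^'s \<Rightarrow> real" where
  "spec_norm B = onorm ((*v) B)"

definition proper_on :: "'x set \<Rightarrow> ('x \<Rightarrow> ereal) \<Rightarrow> bool" where
  "proper_on X f \<longleftrightarrow> (\<forall>x\<in>X. f x \<noteq> -\<infinity>) \<and> (\<exists>x\<in>X. f x \<noteq> \<infinity>)"

definition lsc_on :: "'x::topological_space set \<Rightarrow> ('x \<Rightarrow> ereal) \<Rightarrow> bool" where
  "lsc_on X f \<longleftrightarrow> (\<forall>x\<in>X. f x \<le> Liminf (at x within X) f)"

definition bdd_below_on :: "'x set \<Rightarrow> ('x \<Rightarrow> ereal) \<Rightarrow> bool" where
  "bdd_below_on X f \<longleftrightarrow> (\<exists>b::real. \<forall>x\<in>X. ereal b \<le> f x)"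

text \<open>
  The model quantities are functions of a transition kernel \<open>p s a s'\<close> and a reward table
  \<open>q s a\<close>: they are used both with the true pair and with the empirical pair of a batch.
\<close>

definition trans_mat :: "('s::finite \<Rightarrow> 'a::finite \<Rightarrow> 's \<Rightarrow> real) \<Rightarrow> real^'a^'s \<Rightarrow> real^'s^'s" where
  "trans_mat p \<pi> = (\<chi> s s'. \<Sum>a\<in>UNIV. \<pi> $ s $ a * p s a s')"

definition rew_vec :: "('s::finite \<Rightarrow> 'a::finite \<Rightarrow> real) \<Rightarrow> real^'a^'s \<Rightarrow> real^'s" where
  "rew_vec q \<pi> = (\<chi> s. \<Sum>a\<in>UNIV. \<pi> $ s $ a * q s a)"

definition bell_mat ::
  "real \<Rightarrow> ('s::finite \<Rightarrow> 'a::finite \<Rightarrow> 's \<Rightarrow> real) \<Rightarrow> real^'a^'s \<Rightarrow> real^'s^'s" where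
  "bell_mat \<gamma> p \<pi> = mat 1 - \<gamma> *\<^sub>R trans_mat p \<pi>"

definition bell_res ::
  "real \<Rightarrow> ('s::finite \<Rightarrow> 'a::finite \<Rightarrow> 's \<Rightarrow> real) \<Rightarrow> ('s \<Rightarrow> 'a \<Rightarrow> real) \<Rightarrow>
   real^'a^'s \<Rightarrow> real^'s \<Rightarrow> real^'s" where
  "bell_res \<gamma> p q \<pi> V = bell_mat \<gamma> p \<pi> *v V - rew_vec q \<pi>"

definition aug_lag ::
  "(real^'a::finite^'s::finite \<Rightarrow> ereal) \<Rightarrow> real^'s \<Rightarrow> real \<Rightarrow> real \<Rightarrow>
   ('s \<Rightarrow> 'a \<Rightarrow> 's \<Rightarrow> real) \<Rightarrow> ('s \<Rightarrow> 'a \<Rightarrow> real) \<Rightarrow>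
   real^'a^'s \<Rightarrow> real^'s \<Rightarrow> real^'s \<Rightarrow> ereal" where
  "aug_lag \<phi> c \<beta> \<gamma> p q \<pi> V l =
     \<phi> \<pi> + ereal (c \<bullet> V + l \<bullet> bell_res \<gamma> p q \<pi> V + \<beta> / 2 * (norm (bell_res \<gamma> p q \<pi> V))\<^sup>2)"

text \<open>
  Empirical model of one batch of \<open>n\<close> steps with states \<open>S 0, \<dots>, S n\<close>, actions \<open>A t\<close>, reset
  indicators \<open>U t\<close> (true means reset) and reward observations \<open>Y t\<close>; only non-reset steps
  count, and \<open>p0\<close>, \<open>q0\<close> fill the unvisited entries.
\<close>

definition visits ::
  "nat \<Rightarrow> (nat \<Rightarrow> 'w \<Rightarrow> 's) \<Rightarrow> (nat \<Rightarrow> 'w \<Rightarrow> 'a) \<Rightarrow> (nat \<Rightarrow> 'w \<Rightarrow> bool) \<Rightarrow>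
   'w \<Rightarrow> 's \<Rightarrow> 'a \<Rightarrow> nat set" where
  "visits n S A U \<omega> s a = {t. t < n \<and> S t \<omega> = s \<and> A t \<omega> = a \<and> \<not> U t \<omega>}"

definition emp_trans ::
  "('s \<Rightarrow> 'a \<Rightarrow> 's \<Rightarrow> real) \<Rightarrow> nat \<Rightarrow>
   (nat \<Rightarrow> 'w \<Rightarrow> 's) \<Rightarrow> (nat \<Rightarrow> 'w \<Rightarrow> 'a) \<Rightarrow> (nat \<Rightarrow> 'w \<Rightarrow> bool) \<Rightarrow>
   'w \<Rightarrow> 's \<Rightarrow> 'a \<Rightarrow> 's \<Rightarrow> real" where
  "emp_trans p0 n S A U \<omega> s a s' =
     (if visits n S A U \<omega> s a = {} then p0 s a s'
      else real (card {t \<in> visits n S A U \<omega> s a. S (Suc t) \<omega> = s'})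
           / real (card (visits n S A U \<omega> s a)))"

definition emp_rew ::
  "('s \<Rightarrow> 'a \<Rightarrow> real) \<Rightarrow> nat \<Rightarrow>
   (nat \<Rightarrow> 'w \<Rightarrow> 's) \<Rightarrow> (nat \<Rightarrow> 'w \<Rightarrow> 'a) \<Rightarrow> (nat \<Rightarrow> 'w \<Rightarrow> bool) \<Rightarrow> (nat \<Rightarrow> 'w \<Rightarrow> real) \<Rightarrow>
   'w \<Rightarrow> 's \<Rightarrow> 'a \<Rightarrow> real" where
  "emp_rew q0 n S A U Y \<omega> s a =
     (if visits n S A U \<omega> s a = {} then q0 s a
      else (\<Sum>t\<in>visits n S A U \<omega> s a. Y t \<omega>) / real (card (visits n S A U \<omega> s a)))"

definition incr :: "(nat \<Rightarrow> 'w \<Rightarrow> 'v::real_vector) \<Rightarrow> nat \<Rightarrow> 'w \<Rightarrow> 'v" where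
  "incr X k \<omega> = (case k of 0 \<Rightarrow> 0 | Suc j \<Rightarrow> X (Suc j) \<omega> - X j \<omega>)"

definition merit ::
  "(real^'a::finite^'s::finite \<Rightarrow> ereal) \<Rightarrow> real^'s \<Rightarrow> real \<Rightarrow> real \<Rightarrow>
   ('s \<Rightarrow> 'a \<Rightarrow> 's \<Rightarrow> real) \<Rightarrow> ('s \<Rightarrow> 'a \<Rightarrow> real) \<Rightarrow> real \<Rightarrow>
   (nat \<Rightarrow> 'w \<Rightarrow> real^'a^'s) \<Rightarrow> (nat \<Rightarrow> 'w \<Rightarrow> real^'s) \<Rightarrow> (nat \<Rightarrow> 'w \<Rightarrow> real^'s) \<Rightarrow>
   nat \<Rightarrow> 'w \<Rightarrow> ereal" where
  "merit \<phi> c \<beta> \<gamma> P r \<tau> pol V lam k \<omega> =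
     aug_lag \<phi> c \<beta> \<gamma> P r (pol k \<omega>) (V k \<omega>) (lam k \<omega>) + ereal (\<tau> * (norm (incr V k \<omega>))\<^sup>2)"

locale bellman_problem =
  fixes \<gamma> :: real
    and P :: "'s::finite \<Rightarrow> 'a::finite \<Rightarrow> 's \<Rightarrow> real"
    and r :: "'s \<Rightarrow> 'a \<Rightarrow> real"
    and \<rho> :: "'s \<Rightarrow> real"
    and \<phi> :: "real^'a^'s \<Rightarrow> ereal"
    and c :: "real^'s"
  assumes discount: "0 < \<gamma>" "\<gamma> < 1"
    and P_stochastic: "\<And>s a. prob_vec (P s a)"
    and \<rho>_prob: "prob_vec \<rho>"
    and \<phi>_proper: "proper_on policies \<phi>"
    and \<phi>_lsc: "lsc_on policies \<phi>"
    and \<phi>_bdd_below: "bdd_below_on policies \<phi>"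

text \<open>
  The hypotheses on data that do not depend on the batch schedule. The initial pair
  \<open>(V 0, lam 0)\<close> is random and enters through its joint law \<open>\<mu>0\<close>.
\<close>

locale bellman_admm_setup = bellman_problem \<gamma> P r \<rho> \<phi> c
  for \<gamma> :: real
    and P :: "'s::finite \<Rightarrow> 'a::finite \<Rightarrow> 's \<Rightarrow> real"
    and r :: "'s \<Rightarrow> 'a \<Rightarrow> real"
    and \<rho> :: "'s \<Rightarrow> real"
    and \<phi> :: "real^'a^'s \<Rightarrow> ereal"
    and c :: "real^'s" +
  fixes \<rho>_min \<alpha> R_max :: real
    and p0 :: "'s \<Rightarrow> 'a \<Rightarrow> 's \<Rightarrow> real"
    and \<kappa> L_M \<beta> \<eta>_pol \<eta>_val :: real
    and pol0 :: "real^'a^'s"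
    and \<mu>0 :: "((real^'s) \<times> (real^'s)) measure"
  assumes \<rho>_min_pos: "0 < \<rho>_min"
    and \<rho>_lower: "\<And>s. \<rho>_min \<le> \<rho> s"
    and \<alpha>_pos: "0 < \<alpha>"
    and r_bound: "\<And>s a. \<bar>r s a\<bar> \<le> R_max"
    and p0_stochastic: "\<And>s a. prob_vec (p0 s a)"
    and step_sizes: "0 < \<eta>_pol" "0 < \<eta>_val"
    and inverse_bound:
      "\<And>\<pi>. \<pi> \<in> policies \<Longrightarrow> spec_norm (matrix_inv (bell_mat \<gamma> P \<pi>)) \<le> \<kappa>"
    and bell_mat_lipschitz:
      "\<And>\<pi> \<pi>'. \<pi> \<in> policies \<Longrightarrow> \<pi>' \<in> policies \<Longrightarrow>
        spec_norm (bell_mat \<gamma> P \<pi>' - bell_mat \<gamma> P \<pi>) \<le> L_M * norm (\<pi>' - \<pi>)"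
    and reduced_bdd_below:
      "bdd_below_on policies
        (\<lambda>\<pi>. \<phi> \<pi> + ereal (c \<bullet> (matrix_inv (bell_mat \<gamma> P \<pi>) *v rew_vec r \<pi>)))"
    and \<beta>_pos: "0 < \<beta>"
    and \<beta>_large:
      "max (60 * \<kappa>\<^sup>2 / \<eta>_val) (30 * \<eta>_pol * \<kappa>^4 * L_M\<^sup>2 * (norm c)\<^sup>2) < \<beta>"
    and pol0_dom: "pol0 \<in> policies" "\<phi> pol0 \<noteq> \<infinity>"
    and \<mu>0_prob: "prob_space \<mu>0" "sets \<mu>0 = sets borel"
    and \<mu>0_moment:
      "integrable \<mu>0 (\<lambda>x. (norm (fst x))^4)" "integrable \<mu>0 (\<lambda>x. (norm (snd x))^4)"

text \<open>
  A run with batch schedule \<open>m\<close>. The sub-sigma-algebras interleave as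
  \<open>F k \<le> H k 0 \<le> G k 0 \<le> H k 1 \<le> \<dots> \<le> G k (m k - 1) \<le> H k (m k) \<le> F (k + 1)\<close>:
  \<open>F k\<close> is the history before batch \<open>k\<close>; \<open>H k t\<close> is the history up to and including the
  current state, before the action and the reset coin of step \<open>t\<close> are drawn; \<open>G k t\<close>
  additionally contains that action and coin, but not the reward observation and the next
  state. The law of the starting state \<open>S k 0\<close> of a batch is not restricted.
\<close>

locale bellman_admm_run =
  bellman_admm_setup \<gamma> P r \<rho> \<phi> c \<rho>_min \<alpha> R_max p0 \<kappa> L_M \<beta> \<eta>_pol \<eta>_val pol0 \<mu>0 +
  prob_space M
  for \<gamma> :: real
    and P :: "'s::finite \<Rightarrow> 'a::finite \<Rightarrow> 's \<Rightarrow> real"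
    and r :: "'s \<Rightarrow> 'a \<Rightarrow> real"
    and \<rho> :: "'s \<Rightarrow> real"
    and \<phi> :: "real^'a^'s \<Rightarrow> ereal"
    and c :: "real^'s"
    and \<rho>_min \<alpha> R_max :: real
    and p0 :: "'s \<Rightarrow> 'a \<Rightarrow> 's \<Rightarrow> real"
    and \<kappa> L_M \<beta> \<eta>_pol \<eta>_val :: real
    and pol0 :: "real^'a^'s"
    and \<mu>0 :: "((real^'s) \<times> (real^'s)) measure"
    and M :: "'w measure" +
  fixes M4 :: real
    and q0 :: "'s \<Rightarrow> 'a \<Rightarrow> real"
    and m :: "nat \<Rightarrow> nat"
    and F :: "nat \<Rightarrow> 'w measure"
    and H G :: "nat \<Rightarrow> nat \<Rightarrow> 'w measure"
    and S :: "nat \<Rightarrow> nat \<Rightarrow> 'w \<Rightarrow> 's"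
    and A :: "nat \<Rightarrow> nat \<Rightarrow> 'w \<Rightarrow> 'a"
    and U :: "nat \<Rightarrow> nat \<Rightarrow> 'w \<Rightarrow> bool"
    and Y :: "nat \<Rightarrow> nat \<Rightarrow> 'w \<Rightarrow> real"
    and bpol pol :: "nat \<Rightarrow> 'w \<Rightarrow> real^'a^'s"
    and V lam :: "nat \<Rightarrow> 'w \<Rightarrow> real^'s"
  assumes batch_nonempty: "\<And>k. 1 \<le> m k"
    \<comment> \<open>filtration\<close>
    and F_sub: "\<And>k. subalgebra M (F k)"
    and F_H: "\<And>k. subalgebra (H k 0) (F k)"
    and H_G: "\<And>k t. t < m k \<Longrightarrow> subalgebra (G k t) (H k t)"
    and G_H: "\<And>k t. t < m k \<Longrightarrow> subalgebra (H k (Suc t)) (G k t)"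
    and H_F: "\<And>k. subalgebra (F (Suc k)) (H k (m k))"
    \<comment> \<open>adaptedness\<close>
    and pol_meas: "\<And>k. pol k \<in> borel_measurable (F k)"
    and V_meas: "\<And>k. V k \<in> borel_measurable (F k)"
    and lam_meas: "\<And>k. lam k \<in> borel_measurable (F k)"
    and bpol_meas: "\<And>k. bpol k \<in> borel_measurable (F k)"
    and S_meas: "\<And>k t. t \<le> m k \<Longrightarrow> S k t \<in> measurable (H k t) (count_space UNIV)"
    and A_meas: "\<And>k t. t < m k \<Longrightarrow> A k t \<in> measurable (G k t) (count_space UNIV)"
    and U_meas: "\<And>k t. t < m k \<Longrightarrow> U k t \<in> measurable (G k t) (count_space UNIV)"
    and Y_meas: "\<And>k t. t < m k \<Longrightarrow> Y k t \<in> borel_measurable (H k (Suc t))"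
    \<comment> \<open>sampling of the reset chain\<close>
    and bpol_policy: "\<And>k \<omega>. \<omega> \<in> space M \<Longrightarrow> bpol k \<omega> \<in> policies"
    and bpol_lower: "\<And>k \<omega> s a. \<omega> \<in> space M \<Longrightarrow> \<alpha> \<le> bpol k \<omega> $ s $ a"
    and action_coin_law:
      "\<And>k t a u. t < m k \<Longrightarrow> AE \<omega> in M.
        real_cond_exp M (H k t) (indicat_real {\<omega> \<in> space M. A k t \<omega> = a \<and> U k t \<omega> = u}) \<omega>
        = bpol k \<omega> $ S k t \<omega> $ a * (if u then 1 - \<gamma> else \<gamma>)"
    and next_state_law:
      "\<And>k t s'. t < m k \<Longrightarrow> AE \<omega> in M.
        real_cond_exp M (G k t) (indicat_real {\<omega> \<in> space M. S k (Suc t) \<omega> = s'}) \<omega>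
        = (if U k t \<omega> then \<rho> s' else P (S k t \<omega>) (A k t \<omega>) s')"
    and noise_mean:
      "\<And>k t. t < m k \<Longrightarrow> AE \<omega> in M.
        real_cond_exp M (G k t) (\<lambda>\<omega>. Y k t \<omega> - r (S k t \<omega>) (A k t \<omega>)) \<omega> = 0"
    and noise_fourth_moment:
      "\<And>k t. t < m k \<Longrightarrow> AE \<omega> in M.
        nn_cond_exp M (G k t) (\<lambda>\<omega>. ennreal (\<bar>Y k t \<omega> - r (S k t \<omega>) (A k t \<omega>)\<bar>^4)) \<omega>
        \<le> ennreal M4"
    and emp_inverse_bound:
      "\<And>k \<omega> \<pi>. \<omega> \<in> space M \<Longrightarrow> \<pi> \<in> policies \<Longrightarrow>
        spec_norm (matrix_inv (bell_mat \<gamma> (emp_trans p0 (m k) (S k) (A k) (U k) \<omega>) \<pi>)) \<le> \<kappa>"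
    \<comment> \<open>iteration\<close>
    and pol_init: "\<And>\<omega>. \<omega> \<in> space M \<Longrightarrow> pol 0 \<omega> = pol0"
    and V_lam_init: "distr M borel (\<lambda>\<omega>. (V 0 \<omega>, lam 0 \<omega>)) = \<mu>0"
    and pol_step:
      "\<And>k \<omega>. \<omega> \<in> space M \<Longrightarrow>
        is_arg_min
          (\<lambda>\<pi>. aug_lag \<phi> c \<beta> \<gamma> (emp_trans p0 (m k) (S k) (A k) (U k) \<omega>)
                 (emp_rew q0 (m k) (S k) (A k) (U k) (Y k) \<omega>) \<pi> (V k \<omega>) (lam k \<omega>)
               + ereal (1 / (2 * \<eta>_pol) * (norm (\<pi> - pol k \<omega>))\<^sup>2))
          (\<lambda>\<pi>. \<pi> \<in> policies) (pol (Suc k) \<omega>)"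
    and V_step:
      "\<And>k \<omega>. \<omega> \<in> space M \<Longrightarrow>
        is_arg_min
          (\<lambda>v. aug_lag \<phi> c \<beta> \<gamma> (emp_trans p0 (m k) (S k) (A k) (U k) \<omega>)
                 (emp_rew q0 (m k) (S k) (A k) (U k) (Y k) \<omega>) (pol (Suc k) \<omega>) v (lam k \<omega>)
               + ereal (1 / (2 * \<eta>_val) * (norm (v - V k \<omega>))\<^sup>2))
          (\<lambda>v. True) (V (Suc k) \<omega>)"
    and lam_step:
      "\<And>k \<omega>. \<omega> \<in> space M \<Longrightarrow>
        lam (Suc k) \<omega> = lam k \<omega> + \<beta> *\<^sub>R
          bell_res \<gamma> (emp_trans p0 (m k) (S k) (A k) (U k) \<omega>)
            (emp_rew q0 (m k) (S k) (A k) (U k) (Y k) \<omega>) (pol (Suc k) \<omega>) (V (Suc k) \<omega>)"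

end

theory Submission
  imports Defs
begin

text \<open>
  Write \<open>E = R - R'\<close> for the difference of the true and the empirical residual of batch \<open>k\<close>.
  For the empirical augmented Lagrangian the three updates give the usual deterministic descent,
  the dual increment being controlled by \<open>transpose M' l = - c - \<Delta>V / \<eta>\<close>. Passing to
  the true Lagrangian costs the change of \<open>l \<bullet> E + \<beta> R' \<bullet> E + \<beta>/2 |E|\<^sup>2\<close> along the
  step. Since \<open>\<beta> R'\<close> is the dual increment at the new point, and at the old point differs from
  it by a quantity controlled by the primal increments, every term that is linear in \<open>E\<close> carries
  an increment as a factor: no bound on the bias of the ratio estimators is needed, and by Young's
  inequality the cost is a small multiple of the squared increments plus the squared model error times
  \<open>1 + |V|\<^sup>4\<close>. The fourth moments of \<open>V\<close> stay bounded because \<open>\<beta>\<close> is so large that the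
  value recursion is a contraction. The weight is known before the batch is drawn, and the squared
  model error has conditional mean of order \<open>1 / m\<close>: a reset makes each pair visited within any two
  steps with probability bounded below, so that the number of visits is at least a multiple of
  \<open>m\<close> outside an event of exponentially small probability.
\<close>

section \<open>Matrix and model bounds\<close>

text \<open>The old multiplier is stationary for the kernel of the previous batch, not of the
  current one. Comparing the two stationarity equations passes through the true matrices, so the
  dual increment carries the kernel errors of both batches: hence \<open>1 / m (k - 1)\<close> and
  \<open>k \<ge> 1\<close>. Fourth powers of the values are forced by one product: the change of the
  residual under a policy move contains the move times |V|, and it meets an E that is itself of the
  size of the kernel error times |V|. In the statistical part, an empirical entry is a ratio whose
  denominator is correlated with its numerator, and the noise has only four moments. Where the count
  is at least \<open>m * p / 16\<close>, that number replaces it, and the numerator alone is a sum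
  of orthogonal increments. Elsewhere the squared noise is split at scale m: a large deterministic
  part meets the exponentially small event, and a remainder of fourth order is divided by m^2. The
  factors 60 and 30 in the margin on \<beta> become the shares 1/20 and 3/10 of the proximal terms
  that the dual increment may consume.\<close>

lemma norm_matrix_vector_le: "norm (B *v x) \<le> spec_norm B * norm x"
  unfolding spec_norm_def by (rule onorm[OF matrix_vector_mul_bounded_linear])

lemma inner_transpose_mult: "(transpose B *v x) \<bullet> y = x \<bullet> (B *v y)" for B :: "real^'n^'m"
  by (simp add: transpose_matrix_vector dot_lmul_matrix)

text \<open>The squared norm is the inner product of \<open>y\<close> with
  \<open>B *v (transpose B *v y)\<close>; Cauchy-Schwarz and cancellation of one factor finish. An
  arbitrary bound \<open>b\<close> in place of \<open>spec_norm\<close> lets sums of model errors be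
  transposed directly.\<close>

lemma norm_transpose_mult_le:
  fixes B :: "real^'n^'m"
  assumes "\<And>x. norm (B *v x) \<le> b * norm x"
  shows "norm (transpose B *v y) \<le> b * norm y"
proof (cases "transpose B *v y = 0")
  case True
  \<comment> \<open>In this case only \<open>0 \<le> b\<close> is left, and a unit vector yields
    it.\<close>
  have "0 \<le> b * norm (axis undefined 1 :: real^'n)" using assms[of "axis undefined 1"] norm_ge_zero order_trans by blast
  then have "0 \<le> b" by (simp add: norm_axis_1)
  with True show ?thesis by simp
next
  case False
  let ?z = "transpose B *v y"
  have "norm ?z * norm ?z = y \<bullet> (B *v ?z)"
    by (simp flip: inner_transpose_mult power2_eq_square add: power2_norm_eq_inner)
  also have "\<dots> \<le> norm y * norm (B *v ?z)" by (rule norm_cauchy_schwarz)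
  also have "\<dots> \<le> norm y * (b * norm ?z)" by (intro mult_left_mono assms) simp
  finally have "norm ?z * norm ?z \<le> (b * norm y) * norm ?z" by (simp add: algebra_simps)
  then show ?thesis using False by simp
qed

lemma matrix_inv_inverse:
  fixes B :: "real^'n^'n"
  assumes "invertible B"
  shows "matrix_inv B ** B = mat 1" "B ** matrix_inv B = mat 1"
  using someI_ex[OF assms[unfolded invertible_def]] unfolding matrix_inv_def by auto

text \<open>Turns the bound on the inverse into lower bounds for the matrix and its transpose. Most
  later arguments use only these two inequalities and never manipulate an inverse.\<close>

lemma
  fixes B :: "real^'n^'n"
  assumes B: "invertible B" and \<kappa>: "spec_norm (matrix_inv B) \<le> \<kappa>"
  shows norm_le_matrix_mult: "norm x \<le> \<kappa> * norm (B *v x)"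
    and norm_le_transpose_mult: "norm x \<le> \<kappa> * norm (transpose B *v x)"
proof -
  note inv = matrix_inv_inverse[OF B]
  have le: "norm (matrix_inv B *v y) \<le> \<kappa> * norm y" for y
    using norm_matrix_vector_le[of "matrix_inv B" y] mult_right_mono[OF \<kappa> norm_ge_zero[of y]] by linarith
  have "matrix_inv B *v (B *v x) = x" by (simp add: matrix_vector_mul_assoc inv)
  then show "norm x \<le> \<kappa> * norm (B *v x)" using le[of "B *v x"] by simp
  have "transpose (matrix_inv B) *v (transpose B *v x) = x"
    by (simp only: matrix_vector_mul_assoc inv transpose_mat matrix_vector_mul_lid matrix_transpose_mul[symmetric])
  then show "norm x \<le> \<kappa> * norm (transpose B *v x)"
    using norm_transpose_mult_le[OF le, of "transpose B *v x"] by simp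
qed

lemma transpose_mult_solvable:
  fixes B :: "real^'n^'n"
  assumes "invertible B"
  obtains u where "transpose B *v u = y"
proof
  show "transpose B *v (transpose (matrix_inv B) *v y) = y"
    by (simp only: matrix_vector_mul_assoc transpose_mat matrix_inv_inverse[OF assms] matrix_vector_mul_lid matrix_transpose_mul[symmetric])
qed

text \<open>The entrywise l1 norm dominates the operator norms that occur and is a finite sum of
  scalar errors, so its moments can be estimated one entry at a time.\<close>

definition kernel_size :: "('s::finite \<Rightarrow> 'a::finite \<Rightarrow> 's \<Rightarrow> real) \<Rightarrow> real" where
  "kernel_size d = (\<Sum>s\<in>UNIV. \<Sum>a\<in>UNIV. \<Sum>s'\<in>UNIV. \<bar>d s a s'\<bar>)"

definition table_size :: "('s::finite \<Rightarrow> 'a::finite \<Rightarrow> real) \<Rightarrow> real" where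
  "table_size d = (\<Sum>s\<in>UNIV. \<Sum>a\<in>UNIV. \<bar>d s a\<bar>)"

abbreviation (input) kernel_diff :: "('s \<Rightarrow> 'a \<Rightarrow> 's \<Rightarrow> real) \<Rightarrow> ('s \<Rightarrow> 'a \<Rightarrow> 's \<Rightarrow> real) \<Rightarrow> 's \<Rightarrow> 'a \<Rightarrow> 's \<Rightarrow> real" where
  "kernel_diff p p' \<equiv> \<lambda>s a s'. p s a s' - p' s a s'"

abbreviation (input) table_diff :: "('s \<Rightarrow> 'a \<Rightarrow> real) \<Rightarrow> ('s \<Rightarrow> 'a \<Rightarrow> real) \<Rightarrow> 's \<Rightarrow> 'a \<Rightarrow> real" where
  "table_diff q q' \<equiv> \<lambda>s a. q s a - q' s a"

lemma kernel_size_nonneg: "0 \<le> kernel_size d"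
  by (auto simp: kernel_size_def intro!: sum_nonneg)

lemma table_size_nonneg: "0 \<le> table_size d"
  by (auto simp: table_size_def intro!: sum_nonneg)

text \<open>Asks only for a bound on the entries of \<open>x\<close>: it serves policies, with
  \<open>b = 1\<close>, and differences of policies, with \<open>b\<close> the norm of the
  difference.\<close>

lemma norm_trans_mat_mult:
  fixes d :: "'s::finite \<Rightarrow> 'a::finite \<Rightarrow> 's \<Rightarrow> real"
  assumes "\<And>s a. \<bar>x $ s $ a\<bar> \<le> b"
  shows "norm (trans_mat d x *v v) \<le> b * kernel_size d * norm v"
proof -
  have "norm (trans_mat d x *v v) \<le> (\<Sum>s\<in>UNIV. \<bar>(trans_mat d x *v v) $ s\<bar>)"
    by (rule norm_le_l1_cart)
  also have "\<dots> \<le> (\<Sum>s\<in>UNIV. \<Sum>a\<in>UNIV. \<Sum>s'\<in>UNIV. b * \<bar>d s a s'\<bar> * norm v)"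
  proof (rule sum_mono)
    fix s
    have "(trans_mat d x *v v) $ s = (\<Sum>s'\<in>UNIV. \<Sum>a\<in>UNIV. x $ s $ a * d s a s' * v $ s')"
      by (simp add: trans_mat_def matrix_vector_mult_def sum_distrib_right)
    also have "\<dots> = (\<Sum>a\<in>UNIV. \<Sum>s'\<in>UNIV. x $ s $ a * d s a s' * v $ s')"
      by (rule sum.swap)
    also have "\<bar>\<dots>\<bar> \<le> (\<Sum>a\<in>UNIV. \<Sum>s'\<in>UNIV. \<bar>x $ s $ a * d s a s' * v $ s'\<bar>)"
      by (intro order_trans[OF sum_abs] sum_mono order_refl)
    also have "\<dots> \<le> (\<Sum>a\<in>UNIV. \<Sum>s'\<in>UNIV. b * \<bar>d s a s'\<bar> * norm v)"
      unfolding abs_mult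
      by (intro sum_mono mult_mono assms component_le_norm_cart order_refl) (use assms order_trans[OF abs_ge_zero assms] in auto)
    finally show "\<bar>(trans_mat d x *v v) $ s\<bar> \<le> (\<Sum>a\<in>UNIV. \<Sum>s'\<in>UNIV. b * \<bar>d s a s'\<bar> * norm v)" .
  qed
  also have "\<dots> = b * kernel_size d * norm v"
    by (simp add: kernel_size_def sum_distrib_left sum_distrib_right)
  finally show ?thesis .
qed

lemma norm_rew_vec:
  fixes q :: "'s::finite \<Rightarrow> 'a::finite \<Rightarrow> real"
  assumes "\<And>s a. \<bar>x $ s $ a\<bar> \<le> b"
  shows "norm (rew_vec q x) \<le> b * table_size q"
proof -
  have "norm (rew_vec q x) \<le> (\<Sum>s\<in>UNIV. \<bar>rew_vec q x $ s\<bar>)"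
    by (rule norm_le_l1_cart)
  also have "\<dots> \<le> (\<Sum>s\<in>UNIV. \<Sum>a\<in>UNIV. b * \<bar>q s a\<bar>)"
    unfolding rew_vec_def vec_lambda_beta
    by (intro sum_mono order_trans[OF sum_abs]) (auto simp: abs_mult intro!: mult_right_mono assms)
  also have "\<dots> = b * table_size q"
    by (simp add: table_size_def sum_distrib_left)
  finally show ?thesis .
qed

lemma policy_entry_abs: "\<pi> \<in> policies \<Longrightarrow> \<bar>\<pi> $ s $ a\<bar> \<le> 1"
proof -
  assume "\<pi> \<in> policies"
  then have p: "0 \<le> \<pi> $ s $ a" "\<And>b. 0 \<le> \<pi> $ s $ b" "(\<Sum>b\<in>UNIV. \<pi> $ s $ b) = 1"
    by (auto simp: policies_def prob_vec_def)
  have "\<pi> $ s $ a \<le> (\<Sum>b\<in>UNIV. \<pi> $ s $ b)" by (rule member_le_sum) (auto simp: p)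
  with p show ?thesis by simp
qed

lemma entry_abs_le_norm: "\<bar>x $ s $ a\<bar> \<le> norm x" for x :: "real^'a::finite^'s::finite"
  using component_le_norm_cart[of "x $ s" a] Finite_Cartesian_Product.norm_nth_le[of x s] by linarith

lemma trans_mat_diff: "trans_mat p (x - y) = trans_mat p x - trans_mat p y"
  by (simp add: trans_mat_def vec_eq_iff left_diff_distrib sum_subtractf)

lemma trans_mat_kernel_diff: "trans_mat (kernel_diff p p') x = trans_mat p x - trans_mat p' x"
  by (simp add: trans_mat_def vec_eq_iff right_diff_distrib sum_subtractf)

lemma rew_vec_diff: "rew_vec q (x - y) = rew_vec q x - rew_vec q y"
  by (simp add: rew_vec_def vec_eq_iff left_diff_distrib sum_subtractf)

lemma rew_vec_table_diff: "rew_vec (table_diff q q') x = rew_vec q x - rew_vec q' x"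
  by (simp add: rew_vec_def vec_eq_iff right_diff_distrib sum_subtractf)

lemma bell_mat_mult: "bell_mat \<gamma> p \<pi> *v v = v - \<gamma> *\<^sub>R (trans_mat p \<pi> *v v)"
  by (simp add: bell_mat_def matrix_vector_mult_diff_rdistrib scaleR_matrix_vector_assoc)

text \<open>Maximum principle: at a state where |x| is maximal, a kernel vector is \<gamma> times an
  average of its own entries, so (1 - \<gamma>) max |x| is at most 0. A bound on
  \<open>matrix_inv\<close> could not replace this, since \<open>matrix_inv\<close> is a choice that
  carries information only for invertible matrices.\<close>

lemma bell_mat_invertible:
  fixes p :: "'s::finite \<Rightarrow> 'a::finite \<Rightarrow> 's \<Rightarrow> real"
  assumes \<gamma>: "0 < \<gamma>" "\<gamma> < 1" and p: "\<And>s a. prob_vec (p s a)" and \<pi>: "\<pi> \<in> policies"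
  shows "invertible (bell_mat \<gamma> p \<pi>)"
proof -
  have "x = 0" if x: "bell_mat \<gamma> p \<pi> *v x = 0" for x
  proof -
    let ?m = "Max (range (\<lambda>s. \<bar>x $ s\<bar>))"
    have m: "\<bar>x $ s\<bar> \<le> ?m" for s by (intro Max_ge) auto
    have "?m \<in> range (\<lambda>s. \<bar>x $ s\<bar>)" by (intro Max_in) auto
    then obtain s where s: "?m = \<bar>x $ s\<bar>" by blast
    have pr: "0 \<le> \<pi> $ s $ a" "(\<Sum>a\<in>UNIV. \<pi> $ s $ a) = 1" "0 \<le> p s a s'" "(\<Sum>s'\<in>UNIV. p s a s') = 1" for a s'
      using \<pi> p by (auto simp: policies_def prob_vec_def)
    have "x $ s = \<gamma> * (\<Sum>s'\<in>UNIV. (\<Sum>a\<in>UNIV. \<pi> $ s $ a * p s a s') * x $ s')"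
    proof -
      have "(x - \<gamma> *\<^sub>R (trans_mat p \<pi> *v x)) $ s = 0"
        using x by (simp only: bell_mat_mult zero_index)
      then show ?thesis by (simp add: trans_mat_def matrix_vector_mult_def)
    qed
    then have "?m = \<gamma> * \<bar>\<Sum>s'\<in>UNIV. (\<Sum>a\<in>UNIV. \<pi> $ s $ a * p s a s') * x $ s'\<bar>"
      using \<gamma> by (simp add: s abs_mult)
    also have "\<dots> \<le> \<gamma> * (\<Sum>s'\<in>UNIV. (\<Sum>a\<in>UNIV. \<pi> $ s $ a * p s a s') * ?m)"
      using \<gamma> pr m
      by (intro mult_left_mono order_trans[OF sum_abs] sum_mono)
         (auto simp: abs_mult sum_nonneg abs_of_nonneg intro!: mult_left_mono)
    also have "(\<Sum>s'\<in>UNIV. (\<Sum>a\<in>UNIV. \<pi> $ s $ a * p s a s') * ?m) = (\<Sum>s'\<in>UNIV. \<Sum>a\<in>UNIV. \<pi> $ s $ a * p s a s') * ?m"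
      by (simp add: sum_distrib_right)
    also have "(\<Sum>s'\<in>UNIV. \<Sum>a\<in>UNIV. \<pi> $ s $ a * p s a s') = (\<Sum>a\<in>UNIV. \<pi> $ s $ a * (\<Sum>s'\<in>UNIV. p s a s'))"
      by (subst sum.swap) (simp add: sum_distrib_left)
    also have "\<dots> = 1" by (simp add: pr)
    finally have "(1 - \<gamma>) * ?m \<le> 0" by (simp add: algebra_simps)
    then have "?m \<le> 0" using \<gamma> by (simp add: mult_le_0_iff)
    then have "\<bar>x $ s\<bar> \<le> 0" for s using m[of s] by linarith
    then show "x = 0" by (simp add: vec_eq_iff)
  qed
  then have "\<exists>B. B ** bell_mat \<gamma> p \<pi> = mat 1" by (simp add: matrix_left_invertible_ker)
  then show ?thesis by (simp add: invertible_left_inverse)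
qed

lemma kernel_size_stochastic:
  fixes p :: "'s::finite \<Rightarrow> 'a::finite \<Rightarrow> 's \<Rightarrow> real"
  assumes "\<And>s a. prob_vec (p s a)"
  shows "kernel_size p = real (CARD('s) * CARD('a))"
proof -
  have "(\<Sum>s'\<in>UNIV. \<bar>p s a s'\<bar>) = 1" for s a
    using assms[of s a] by (simp add: prob_vec_def)
  then show ?thesis by (simp add: kernel_size_def)
qed

lemma kernel_size_diff_le: "kernel_size (kernel_diff p p') \<le> kernel_size p + kernel_size p'"
  unfolding kernel_size_def by (simp flip: sum.distrib) (intro sum_mono abs_triangle_ineq4)

lemma table_size_le: "table_size q \<le> table_size q' + table_size (table_diff q q')"
proof -
  have "\<bar>q s a\<bar> \<le> \<bar>q' s a\<bar> + \<bar>q s a - q' s a\<bar>" for s a by simp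
  then show ?thesis unfolding table_size_def by (simp only: sum.distrib[symmetric]) (intro sum_mono)
qed

section \<open>Young's inequality and power means\<close>

lemma young: "u * w \<le> h * u\<^sup>2 + w\<^sup>2 / (4 * h)" if "0 < h" for u w h :: real
proof -
  have "0 \<le> (2 * h * u - w)\<^sup>2 / (4 * h)" using that by simp
  also have "\<dots> = h * u\<^sup>2 + w\<^sup>2 / (4 * h) - u * w"
    using that by (simp add: power2_eq_square field_simps)
  finally show ?thesis by simp
qed

text \<open>The shape in which cross terms occur: \<open>u\<close> is an increment, to be paid by a
  small multiple of its square, and \<open>w\<close> an error whose square is controlled by the
  weighted model error \<open>K\<close>.\<close>

lemma young_absorb:
  fixes h u w m K s :: real
  assumes "0 < h" "w\<^sup>2 \<le> m * K"
  shows "s * (u * w) \<le> h * u\<^sup>2 + s\<^sup>2 * m / (4 * h) * K"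
proof -
  have "s * (u * w) \<le> h * u\<^sup>2 + (s * w)\<^sup>2 / (4 * h)"
    using young[OF assms(1), of u "s * w"] by (simp add: algebra_simps)
  also have "(s * w)\<^sup>2 / (4 * h) \<le> (s\<^sup>2 * (m * K)) / (4 * h)"
    using assms by (intro divide_right_mono) (auto simp: power_mult_distrib intro: mult_left_mono)
  finally show ?thesis by (simp add: algebra_simps)
qed

lemma square_sum2: "(a + b)\<^sup>2 \<le> 2 * (a\<^sup>2 + b\<^sup>2)" for a b :: real
  using zero_le_power2[of "a - b"] by (simp add: power2_eq_square algebra_simps)

lemma square_sum3: "(a + b + c)\<^sup>2 \<le> 3 * (a\<^sup>2 + b\<^sup>2 + c\<^sup>2)" for a b c :: real
  using zero_le_power2[of "a - b"] zero_le_power2[of "a - c"] zero_le_power2[of "b - c"]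
  by (simp add: power2_eq_square algebra_simps)

lemma fourth_sum2: "(a + b) ^ 4 \<le> 8 * (a ^ 4 + b ^ 4)" for a b :: real
proof -
  have "((a + b)\<^sup>2)\<^sup>2 \<le> (2 * (a\<^sup>2 + b\<^sup>2))\<^sup>2" by (intro power_mono square_sum2) simp
  also have "\<dots> = 4 * (a\<^sup>2 + b\<^sup>2)\<^sup>2" by (simp only: power_mult_distrib) simp
  also have "\<dots> \<le> 4 * (2 * ((a\<^sup>2)\<^sup>2 + (b\<^sup>2)\<^sup>2))" by (intro mult_left_mono square_sum2) simp
  finally show ?thesis by simp
qed

lemma fourth_sum3: "(a + b + c) ^ 4 \<le> 27 * (a ^ 4 + b ^ 4 + c ^ 4)" for a b c :: real
proof -
  have "((a + b + c)\<^sup>2)\<^sup>2 \<le> (3 * (a\<^sup>2 + b\<^sup>2 + c\<^sup>2))\<^sup>2" by (intro power_mono square_sum3) simp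
  also have "\<dots> = 9 * (a\<^sup>2 + b\<^sup>2 + c\<^sup>2)\<^sup>2" by (simp only: power_mult_distrib) simp
  also have "\<dots> \<le> 9 * (3 * ((a\<^sup>2)\<^sup>2 + (b\<^sup>2)\<^sup>2 + (c\<^sup>2)\<^sup>2))" by (intro mult_left_mono square_sum3) simp
  finally show ?thesis by simp
qed

lemma square_le_one_plus_fourth: "x\<^sup>2 \<le> 1 + x ^ 4" for x :: real
proof -
  have "0 \<le> (x\<^sup>2 - 1)\<^sup>2" by simp
  then have "2 * x\<^sup>2 \<le> 1 + x ^ 4" by (simp add: power2_diff)
  moreover have "0 \<le> x\<^sup>2" by simp
  ultimately show ?thesis by linarith
qed

section \<open>The deterministic step\<close>

text \<open>The finite part of the augmented Lagrangian. Keeping \<phi> apart confines the extended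
  reals to the cost of a policy.\<close>

definition lagr ::
  "real^'s::finite \<Rightarrow> real \<Rightarrow> real \<Rightarrow> ('s \<Rightarrow> 'a::finite \<Rightarrow> 's \<Rightarrow> real) \<Rightarrow> ('s \<Rightarrow> 'a \<Rightarrow> real) \<Rightarrow>
   real^'a^'s \<Rightarrow> real^'s \<Rightarrow> real^'s \<Rightarrow> real" where
  "lagr c \<beta> \<gamma> p q \<pi> v l =
     c \<bullet> v + l \<bullet> bell_res \<gamma> p q \<pi> v + \<beta> / 2 * (norm (bell_res \<gamma> p q \<pi> v))\<^sup>2"

lemma aug_lag_eq: "aug_lag \<phi> c \<beta> \<gamma> p q \<pi> v l = \<phi> \<pi> + ereal (lagr c \<beta> \<gamma> p q \<pi> v l)"
  by (simp add: aug_lag_def lagr_def)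

lemma bell_res_alt: "bell_res \<gamma> p q \<pi> v = v - \<gamma> *\<^sub>R (trans_mat p \<pi> *v v) - rew_vec q \<pi>"
  by (simp add: bell_res_def bell_mat_mult)

lemma bell_res_diff_models:
  "bell_res \<gamma> p q \<pi> v - bell_res \<gamma> p' q' \<pi> v =
    \<gamma> *\<^sub>R (trans_mat (kernel_diff p' p) \<pi> *v v) + rew_vec (table_diff q' q) \<pi>"
  by (simp add: bell_res_alt trans_mat_kernel_diff rew_vec_table_diff matrix_vector_mult_diff_rdistrib
      scaleR_diff_right)

text \<open>The square is expanded around the residual of the second model, because \<beta> times
  the empirical residual at the new point is the dual increment.\<close>

lemma lagr_diff_models:
  fixes v :: "real^'s::finite"
  assumes "E = bell_res \<gamma> p q \<pi> v - bell_res \<gamma> p' q' \<pi> v"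
  shows "lagr c \<beta> \<gamma> p q \<pi> v l - lagr c \<beta> \<gamma> p' q' \<pi> v l =
    l \<bullet> E + \<beta> * (bell_res \<gamma> p' q' \<pi> v \<bullet> E) + \<beta> / 2 * (norm E)\<^sup>2"
proof -
  have "bell_res \<gamma> p q \<pi> v = bell_res \<gamma> p' q' \<pi> v + E" using assms by simp
  then show ?thesis
    by (simp add: lagr_def power2_norm_eq_inner inner_add_left inner_add_right inner_commute algebra_simps)
qed

text \<open>A first-order condition without derivatives. The leading coefficient is enlarged to |b|
  + 1, which is positive whatever the sign of \<open>b\<close>, and \<open>t\<close> is the
  minimiser of the enlarged parabola.\<close>

lemma quadratic_nonneg_slope_zero:
  fixes a b :: real
  assumes "\<And>t. 0 \<le> a * t + b * t\<^sup>2"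
  shows "a = 0"
proof (rule ccontr)
  assume "a \<noteq> 0"
  define D where "D = \<bar>b\<bar> + 1"
  have D: "0 < D" "b \<le> D" by (auto simp: D_def)
  define t where "t = - a / (2 * D)"
  have "a * t + b * t\<^sup>2 \<le> a * t + D * t\<^sup>2"
    using D by (intro add_left_mono mult_right_mono) auto
  also have "\<dots> = - (a\<^sup>2 / (4 * D))"
    using D(1) by (simp add: t_def power2_eq_square field_simps)
  also have "\<dots> < 0" using \<open>a \<noteq> 0\<close> D(1) by simp
  finally show False using assms[of t] by simp
qed

lemma norm_trans_mat_policy:
  "\<pi> \<in> policies \<Longrightarrow> norm (trans_mat d \<pi> *v v) \<le> kernel_size d * norm v"
  using norm_trans_mat_mult[OF policy_entry_abs, of \<pi> d v] by simp

lemma norm_rew_vec_policy: "\<pi> \<in> policies \<Longrightarrow> norm (rew_vec q \<pi>) \<le> table_size q"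
  using norm_rew_vec[OF policy_entry_abs, of \<pi> q] by simp

lemma norm_policy_diff_le:
  fixes \<pi> \<pi>' :: "real^'a::finite^'s::finite"
  assumes "\<pi> \<in> policies" "\<pi>' \<in> policies"
  shows "norm (\<pi>' - \<pi>) \<le> 2 * real (CARD('s) * CARD('a))"
proof -
  have "norm (\<pi>' - \<pi>) \<le> (\<Sum>s\<in>UNIV. norm ((\<pi>' - \<pi>) $ s))"
    by (simp add: norm_vec_def L2_set_le_sum)
  also have "\<dots> \<le> (\<Sum>s\<in>(UNIV::'s set). \<Sum>a\<in>(UNIV::'a set). 2)"
  proof (intro sum_mono order_trans[OF norm_le_l1_cart])
    fix s a
    show "\<bar>(\<pi>' - \<pi>) $ s $ a\<bar> \<le> 2"
      using policy_entry_abs[OF assms(1), of s a] policy_entry_abs[OF assms(2), of s a] by simp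
  qed
  finally show ?thesis by simp
qed

section \<open>Multipliers, values and the Lagrangian in one deterministic step\<close>

context bellman_admm_setup
begin

abbreviation res where "res \<equiv> bell_res \<gamma>"
abbreviation lag where "lag \<equiv> lagr c \<beta> \<gamma>"

definition valid :: "('s \<Rightarrow> 'a \<Rightarrow> 's \<Rightarrow> real) \<Rightarrow> bool" where
  "valid p \<longleftrightarrow> (\<forall>s a. prob_vec (p s a)) \<and> (\<forall>\<pi>\<in>policies. spec_norm (matrix_inv (bell_mat \<gamma> p \<pi>)) \<le> \<kappa>)"

text \<open>Stationarity of the value step, written in terms of the updated multiplier \<open>l\<close>.\<close>

definition dual_at ::
  "('s \<Rightarrow> 'a \<Rightarrow> 's \<Rightarrow> real) \<Rightarrow> real^'a^'s \<Rightarrow> real^'s \<Rightarrow> real^'s \<Rightarrow> real^'s \<Rightarrow> bool" where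
  "dual_at p \<pi> v0 v l \<longleftrightarrow> transpose (bell_mat \<gamma> p \<pi>) *v l = - c - (1 / \<eta>_val) *\<^sub>R (v - v0)"

lemma valid_P: "valid P"
  using P_stochastic inverse_bound by (auto simp: valid_def)

lemma valid_invertible: "valid p \<Longrightarrow> \<pi> \<in> policies \<Longrightarrow> invertible (bell_mat \<gamma> p \<pi>)"
  using bell_mat_invertible[OF discount] by (auto simp: valid_def)

lemma
  assumes "valid p" "\<pi> \<in> policies"
  shows norm_le_bell_mat: "norm x \<le> \<kappa> * norm (bell_mat \<gamma> p \<pi> *v x)"
    and norm_le_bell_mat_transpose: "norm x \<le> \<kappa> * norm (transpose (bell_mat \<gamma> p \<pi>) *v x)"
  using norm_le_matrix_mult[OF valid_invertible[OF assms]] norm_le_transpose_mult[OF valid_invertible[OF assms]]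
    assms by (auto simp: valid_def)

lemma \<kappa>_nonneg: "0 \<le> \<kappa>"
proof -
  have "0 \<le> spec_norm (matrix_inv (bell_mat \<gamma> P pol0))"
    unfolding spec_norm_def by (rule onorm_pos_le[OF matrix_vector_mul_bounded_linear])
  then show ?thesis using inverse_bound[OF pol0_dom(1)] by linarith
qed

text \<open>Only the product has a sign: with a single action there is one policy, and the Lipschitz
  condition then allows a negative \<open>L_M\<close>.\<close>

lemma L_M_term_nonneg:
  fixes \<pi> \<pi>' :: "real^'a^'s"
  assumes "\<pi> \<in> policies" "\<pi>' \<in> policies"
  shows "0 \<le> L_M * norm (\<pi>' - \<pi>)"
proof -
  have "0 \<le> spec_norm (bell_mat \<gamma> P \<pi>' - bell_mat \<gamma> P \<pi>)"
    unfolding spec_norm_def by (rule onorm_pos_le[OF matrix_vector_mul_bounded_linear])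
  then show ?thesis using bell_mat_lipschitz[OF assms] by linarith
qed

lemma \<beta>_bounds: "60 * \<kappa>\<^sup>2 \<le> \<beta> * \<eta>_val" "30 * \<eta>_pol * \<kappa> ^ 4 * L_M\<^sup>2 * (norm c)\<^sup>2 \<le> \<beta>"
  using \<beta>_large step_sizes by (auto simp: field_simps)

lemma dual_norm:
  assumes "valid p" "\<pi> \<in> policies" "dual_at p \<pi> v0 v l"
  shows "norm l \<le> \<kappa> * norm c + \<kappa> / \<eta>_val * norm (v - v0)"
proof -
  have "norm l \<le> \<kappa> * norm (- c - (1 / \<eta>_val) *\<^sub>R (v - v0))"
    using norm_le_bell_mat_transpose[OF assms(1,2), of l] assms(3) by (simp add: dual_at_def)
  also have "\<dots> \<le> \<kappa> * (norm c + 1 / \<eta>_val * norm (v - v0))"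
    using norm_triangle_ineq4[of "- c" "(1 / \<eta>_val) *\<^sub>R (v - v0)"] step_sizes
    by (intro mult_left_mono \<kappa>_nonneg) auto
  finally show ?thesis by (simp add: algebra_simps)
qed

text \<open>The Lipschitz condition concerns the true kernel, so the path goes from \<open>p\<close>
  to \<open>P\<close> at the old policy, along the policies with \<open>P\<close>, and from
  \<open>P\<close> to \<open>p'\<close> at the new policy.\<close>

lemma bell_mat_diff_bound:
  assumes "\<pi> \<in> policies" "\<pi>' \<in> policies"
  shows "norm ((bell_mat \<gamma> p' \<pi>' - bell_mat \<gamma> p \<pi>) *v x)
    \<le> (kernel_size (kernel_diff p' P) + L_M * norm (\<pi>' - \<pi>) + kernel_size (kernel_diff p P)) * norm x"
proof -
  have d: "norm ((bell_mat \<gamma> q \<pi> - bell_mat \<gamma> P \<pi>) *v x) \<le> kernel_size (kernel_diff q P) * norm x"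
    if "\<pi> \<in> policies" for q \<pi>
  proof -
    have "(bell_mat \<gamma> q \<pi> - bell_mat \<gamma> P \<pi>) *v x = - (\<gamma> *\<^sub>R (trans_mat (kernel_diff q P) \<pi> *v x))"
      by (simp add: matrix_vector_mult_diff_rdistrib bell_mat_mult trans_mat_kernel_diff scaleR_diff_right)
    also have "norm \<dots> = \<gamma> * norm (trans_mat (kernel_diff q P) \<pi> *v x)"
      using discount by simp
    also have "\<dots> \<le> 1 * (kernel_size (kernel_diff q P) * norm x)"
      using discount by (intro mult_mono norm_trans_mat_policy that) auto
    finally show ?thesis by simp
  qed
  have l: "norm ((bell_mat \<gamma> P \<pi>' - bell_mat \<gamma> P \<pi>) *v x) \<le> L_M * norm (\<pi>' - \<pi>) * norm x"
    using norm_matrix_vector_le bell_mat_lipschitz[OF assms] by (meson mult_right_mono norm_ge_zero order_trans)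
  have "(bell_mat \<gamma> p' \<pi>' - bell_mat \<gamma> p \<pi>) *v x = (bell_mat \<gamma> p' \<pi>' - bell_mat \<gamma> P \<pi>') *v x
     + (bell_mat \<gamma> P \<pi>' - bell_mat \<gamma> P \<pi>) *v x - (bell_mat \<gamma> p \<pi> - bell_mat \<gamma> P \<pi>) *v x"
    by (simp add: matrix_vector_mult_diff_rdistrib)
  also have "norm \<dots> \<le> norm ((bell_mat \<gamma> p' \<pi>' - bell_mat \<gamma> P \<pi>') *v x)
     + norm ((bell_mat \<gamma> P \<pi>' - bell_mat \<gamma> P \<pi>) *v x) + norm ((bell_mat \<gamma> p \<pi> - bell_mat \<gamma> P \<pi>) *v x)"
    by (intro order_trans[OF norm_triangle_ineq4] add_right_mono norm_triangle_ineq)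
  finally show ?thesis using d[OF assms(1), of p] d[OF assms(2), of p'] l by (simp add: algebra_simps)
qed

text \<open>Resolvent identity: the new transpose maps \<open>u' - u\<close> to minus the transposed
  matrix difference applied to \<open>u\<close>. Inverting it costs one factor \<kappa>, and the
  norm of \<open>u\<close> the other.\<close>

lemma transpose_solution_diff:
  assumes "valid p" "valid p'" "\<pi> \<in> policies" "\<pi>' \<in> policies"
    and "transpose (bell_mat \<gamma> p \<pi>) *v u = c" "transpose (bell_mat \<gamma> p' \<pi>') *v u' = c"
  shows "norm (u' - u) \<le> \<kappa>\<^sup>2 * norm c *
    (kernel_size (kernel_diff p' P) + L_M * norm (\<pi>' - \<pi>) + kernel_size (kernel_diff p P))" (is "_ \<le> _ * ?d")
proof -
  let ?A = "bell_mat \<gamma> p \<pi>" and ?B = "bell_mat \<gamma> p' \<pi>'"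
  have d: "0 \<le> ?d" by (intro add_nonneg_nonneg kernel_size_nonneg L_M_term_nonneg[OF assms(3,4)])
  have u: "norm u \<le> \<kappa> * norm c" using norm_le_bell_mat_transpose[OF assms(1,3), of u] assms(5) by simp
  have "transpose (?B - ?A) = transpose ?B - transpose ?A" by (simp add: transpose_def vec_eq_iff)
  then have "transpose ?B *v (u' - u) = - (transpose (?B - ?A) *v u)"
    using assms(5,6)
    by (simp only: matrix_vector_mult_diff_distrib matrix_vector_mult_diff_rdistrib minus_diff_eq)
  then have "norm (transpose ?B *v (u' - u)) = norm (transpose (?B - ?A) *v u)" by (simp only: norm_minus_cancel)
  also have "\<dots> \<le> ?d * norm u" by (rule norm_transpose_mult_le[OF bell_mat_diff_bound[OF assms(3,4)]])
  also have "\<dots> \<le> ?d * (\<kappa> * norm c)" by (rule mult_left_mono[OF u d])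
  finally have "norm (transpose ?B *v (u' - u)) \<le> ?d * (\<kappa> * norm c)" .
  then have "norm (u' - u) \<le> \<kappa> * (?d * (\<kappa> * norm c))"
    using norm_le_bell_mat_transpose[OF assms(2,4), of "u' - u"] mult_left_mono[OF _ \<kappa>_nonneg] order_trans by blast
  then show ?thesis by (simp add: power2_eq_square algebra_simps)
qed

text \<open>The vector \<open>- u\<close> would be the multiplier if the value had stopped moving.
  Subtracting the equation of \<open>u\<close> from stationarity leaves only the proximal
  term.\<close>

lemma dual_remainder:
  assumes "valid p" "\<pi> \<in> policies" "dual_at p \<pi> v0 v l" "transpose (bell_mat \<gamma> p \<pi>) *v u = c"
  shows "norm (l + u) \<le> \<kappa> / \<eta>_val * norm (v - v0)"
proof -
  have "transpose (bell_mat \<gamma> p \<pi>) *v (l + u) = - ((1 / \<eta>_val) *\<^sub>R (v - v0))"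
    using assms(3,4) unfolding dual_at_def matrix_vector_right_distrib by simp
  then show ?thesis
    using norm_le_bell_mat_transpose[OF assms(1,2), of "l + u"] step_sizes by simp
qed

text \<open>Each multiplier is minus its adjoint solution plus a remainder; the remainders are of
  the size of the two value increments. The adjoint solutions differ through the policy move and the
  errors of both kernels, because \<open>l\<close> belongs to the previous batch.\<close>

lemma dual_increment:
  assumes "valid p" "valid p'" "\<pi> \<in> policies" "\<pi>' \<in> policies"
    and "dual_at p \<pi> v0 v l" "dual_at p' \<pi>' v v1 l1"
  shows "norm (l1 - l) \<le> \<kappa> / \<eta>_val * norm (v1 - v) + \<kappa> / \<eta>_val * norm (v - v0) + \<kappa>\<^sup>2 * norm c *
    (kernel_size (kernel_diff p' P) + L_M * norm (\<pi>' - \<pi>) + kernel_size (kernel_diff p P))"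
proof -
  obtain u where u: "transpose (bell_mat \<gamma> p \<pi>) *v u = c"
    by (rule transpose_mult_solvable[OF valid_invertible[OF assms(1,3)]])
  obtain u' where u': "transpose (bell_mat \<gamma> p' \<pi>') *v u' = c"
    by (rule transpose_mult_solvable[OF valid_invertible[OF assms(2,4)]])
  have "l1 - l = (l1 + u') - (l + u) - (u' - u)" by simp
  also have "norm \<dots> \<le> norm (l1 + u') + norm (l + u) + norm (u' - u)"
    by (intro order_trans[OF norm_triangle_ineq4] add_right_mono norm_triangle_ineq4)
  finally show ?thesis
    using dual_remainder[OF assms(1,3,5) u] dual_remainder[OF assms(2,4,6) u']
      transpose_solution_diff[OF assms(1-4) u u'] by linarith
qed

definition reward_bound :: real where "reward_bound = table_size r"

lemma norm_rew_vec_emp: "\<pi> \<in> policies \<Longrightarrow> norm (rew_vec q \<pi>) \<le> reward_bound + table_size (table_diff q r)"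
  using norm_rew_vec_policy[of \<pi> q] table_size_le[of q r] unfolding reward_bound_def by linarith

text \<open>The multiplier update read backwards: the empirical Bellman matrix maps
  \<open>v1\<close> to the reward vector plus \<open>(l1 - l) / \<beta>\<close>.\<close>

lemma value_norm_raw:
  assumes "valid p" "\<pi> \<in> policies" "l1 = l + \<beta> *\<^sub>R res p q \<pi> v1"
  shows "norm v1 \<le> \<kappa> * (reward_bound + table_size (table_diff q r)) + \<kappa> / \<beta> * (norm l1 + norm l)"
proof -
  have "res p q \<pi> v1 = (1 / \<beta>) *\<^sub>R (l1 - l)" using \<beta>_pos by (simp add: assms(3))
  then have B: "bell_mat \<gamma> p \<pi> *v v1 = rew_vec q \<pi> + (1 / \<beta>) *\<^sub>R (l1 - l)"
    by (simp add: bell_res_def algebra_simps)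
  have "norm (bell_mat \<gamma> p \<pi> *v v1) \<le> norm (rew_vec q \<pi>) + norm ((1 / \<beta>) *\<^sub>R (l1 - l))"
    unfolding B by (rule norm_triangle_ineq)
  also have "\<dots> \<le> (reward_bound + table_size (table_diff q r)) + 1 / \<beta> * (norm l1 + norm l)"
    using norm_rew_vec_emp[OF assms(2), of q] norm_triangle_ineq4[of l1 l] \<beta>_pos
    by (intro add_mono) (auto intro!: divide_right_mono)
  finally have "\<kappa> * norm (bell_mat \<gamma> p \<pi> *v v1) \<le> \<kappa> * ((reward_bound + table_size (table_diff q r)) + 1 / \<beta> * (norm l1 + norm l))"
    by (rule mult_left_mono[OF _ \<kappa>_nonneg])
  then show ?thesis using norm_le_bell_mat[OF assms(1,2), of v1] by (simp add: algebra_simps)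
qed

lemma \<kappa>_\<beta>_\<eta>: "\<kappa> / \<beta> * (\<kappa> / \<eta>_val) \<le> 1 / 60"
  using \<beta>_bounds(1) \<beta>_pos step_sizes by (simp add: field_simps power2_eq_square)

lemma reward_bound_nonneg: "0 \<le> reward_bound"
  by (simp add: reward_bound_def table_size_nonneg)

text \<open>Bounding both multipliers by stationarity turns the raw estimate into a constant plus
  1/60 of |v1 - v| + |v - v0|, the 1/60 being the first margin on \<beta>. Triangle inequalities and
  solving for |v1| give 60/59 and the contracting weights 2/59 and 1/59.\<close>

lemma value_norm:
  assumes "valid p0'" "valid p" "\<pi> \<in> policies" "\<pi>' \<in> policies"
    and "dual_at p0' \<pi> v0 v l" "dual_at p \<pi>' v v1 l1" "l1 = l + \<beta> *\<^sub>R res p q \<pi>' v1"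
  shows "norm v1 \<le> (60/59) * (\<kappa> * (reward_bound + table_size (table_diff q r)) + 2 * (\<kappa>\<^sup>2 * norm c / \<beta>))
    + (2 * norm v + norm v0) / 59"
proof -
  have "norm l1 + norm l \<le> (\<kappa> * norm c + \<kappa> / \<eta>_val * norm (v1 - v)) + (\<kappa> * norm c + \<kappa> / \<eta>_val * norm (v - v0))"
    by (intro add_mono dual_norm[OF assms(2,4,6)] dual_norm[OF assms(1,3,5)])
  then have "\<kappa> / \<beta> * (norm l1 + norm l)
     \<le> \<kappa> / \<beta> * ((\<kappa> * norm c + \<kappa> / \<eta>_val * norm (v1 - v)) + (\<kappa> * norm c + \<kappa> / \<eta>_val * norm (v - v0)))"
    using \<kappa>_nonneg \<beta>_pos by (intro mult_left_mono) auto
  also have "\<dots> = 2 * (\<kappa>\<^sup>2 * norm c / \<beta>) + \<kappa> / \<beta> * (\<kappa> / \<eta>_val) * (norm (v1 - v) + norm (v - v0))"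
    by (simp add: algebra_simps power2_eq_square)
  also have "\<dots> \<le> 2 * (\<kappa>\<^sup>2 * norm c / \<beta>) + 1 / 60 * (norm (v1 - v) + norm (v - v0))"
    by (intro add_left_mono mult_right_mono \<kappa>_\<beta>_\<eta>) auto
  finally have t: "\<kappa> / \<beta> * (norm l1 + norm l) \<le> \<dots>" .
  have "x \<le> a + t \<Longrightarrow> t \<le> b + 1 / 60 * (y + z) \<Longrightarrow> y \<le> x + v \<Longrightarrow> z \<le> v + w \<Longrightarrow> x \<le> (60/59) * (a + b) + (2 * v + w) / 59"
    for a b t v w x y z :: real by (simp add: field_simps)
  from this[OF value_norm_raw[OF assms(2,4,7)] t norm_triangle_ineq4 norm_triangle_ineq4] show ?thesis .
qed

text \<open>The variant for the first update, where the initial multiplier satisfies no stationarity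
  equation and its norm therefore stays in the bound.\<close>

lemma first_value_norm:
  assumes "valid p" "\<pi>' \<in> policies" "dual_at p \<pi>' v v1 l1" "l1 = l + \<beta> *\<^sub>R res p q \<pi>' v1"
  shows "norm v1 \<le> (60/59) * (\<kappa> * (reward_bound + table_size (table_diff q r)) + \<kappa>\<^sup>2 * norm c / \<beta> + \<kappa> / \<beta> * norm l)
    + norm v / 59"
proof -
  have "norm l1 + norm l \<le> (\<kappa> * norm c + \<kappa> / \<eta>_val * norm (v1 - v)) + norm l"
    by (intro add_mono dual_norm[OF assms(1-3)] order_refl)
  then have "\<kappa> / \<beta> * (norm l1 + norm l)
     \<le> \<kappa> / \<beta> * ((\<kappa> * norm c + \<kappa> / \<eta>_val * norm (v1 - v)) + norm l)"
    using \<kappa>_nonneg \<beta>_pos by (intro mult_left_mono) auto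
  also have "\<dots> = \<kappa>\<^sup>2 * norm c / \<beta> + \<kappa> / \<beta> * norm l + \<kappa> / \<beta> * (\<kappa> / \<eta>_val) * norm (v1 - v)"
    by (simp add: algebra_simps power2_eq_square)
  also have "\<dots> \<le> \<kappa>\<^sup>2 * norm c / \<beta> + \<kappa> / \<beta> * norm l + 1 / 60 * norm (v1 - v)"
    by (intro add_left_mono mult_right_mono \<kappa>_\<beta>_\<eta>) auto
  finally have t: "\<kappa> / \<beta> * (norm l1 + norm l) \<le> \<dots>" .
  have "x \<le> a + t \<Longrightarrow> t \<le> b + b' + 1 / 60 * y \<Longrightarrow> y \<le> x + v \<Longrightarrow> x \<le> (60/59) * (a + b + b') + v / 59"
    for a b b' t v x y :: real by (simp add: field_simps)
  from this[OF value_norm_raw[OF assms(1,2,4)] t norm_triangle_ineq4] show ?thesis .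
qed

text \<open>With \<open>u\<close> the adjoint solution of the true model, c . v equals u . (R +
  reward vector), so the Lagrangian is the reduced value u . (reward vector) plus (l + u) . R +
  \<beta>/2 |R|^2. Completing the square costs |l + u|^2 / (2 \<beta>), whose part in the value
  increment is at most a 1/60 share of 1/\<eta> and is covered by the added 1/8.\<close>

lemma lag_lower_bound:
  assumes "valid p" "\<pi> \<in> policies" "dual_at p \<pi> v0 v l"
  shows "c \<bullet> (matrix_inv (bell_mat \<gamma> P \<pi>) *v rew_vec r \<pi>) - \<kappa> ^ 4 * (norm c)\<^sup>2 / \<beta> * (kernel_size (kernel_diff p P))\<^sup>2
    \<le> lag P r \<pi> v l + 1 / (8 * \<eta>_val) * (norm (v - v0))\<^sup>2"
proof -
  let ?B = "bell_mat \<gamma> P \<pi>" and ?e = "kernel_size (kernel_diff p P)" and ?Y = "norm (v - v0)"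
  define R where "R = res P r \<pi> v"
  note invB = valid_invertible[OF valid_P assms(2)]
  obtain u where u: "transpose ?B *v u = c" by (rule transpose_mult_solvable[OF invB])
  obtain w where w: "transpose (bell_mat \<gamma> p \<pi>) *v w = c"
    by (rule transpose_mult_solvable[OF valid_invertible[OF assms(1,2)]])
  have e0: "kernel_size (kernel_diff P P) = 0" by (simp add: kernel_size_def)
  have uw: "norm (w - u) \<le> \<kappa>\<^sup>2 * norm c * ?e"
    using transpose_solution_diff[OF valid_P assms(1) assms(2) assms(2) u w] e0 by simp
  \<comment> \<open>Stationarity of \<open>l\<close> refers to the empirical matrix while
    \<open>u\<close> belongs to the true one; the empirical adjoint solution \<open>w\<close>
    mediates.\<close>
  have lu: "norm (l + u) \<le> \<kappa> / \<eta>_val * ?Y + \<kappa>\<^sup>2 * norm c * ?e" (is "_ \<le> ?b1 + ?b2")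
  proof -
    have "l + u = (l + w) - (w - u)" by simp
    then have "norm (l + u) \<le> norm (l + w) + norm (w - u)" by (metis norm_triangle_ineq4)
    then show ?thesis using dual_remainder[OF assms w] uw by linarith
  qed
  have cb: "c \<bullet> x = u \<bullet> (?B *v x)" for x by (simp only: u inner_transpose_mult[symmetric])
  have 1: "c \<bullet> (matrix_inv ?B *v rew_vec r \<pi>) = u \<bullet> rew_vec r \<pi>"
    by (simp add: cb matrix_vector_mul_assoc matrix_inv_inverse[OF invB])
  have "?B *v v = R + rew_vec r \<pi>" by (simp add: R_def bell_res_def)
  then have 2: "lag P r \<pi> v l = u \<bullet> rew_vec r \<pi> + (l + u) \<bullet> R + \<beta> / 2 * (norm R)\<^sup>2"
    by (simp add: lagr_def cb R_def inner_add_left inner_add_right)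
  have "- ((l + u) \<bullet> R) \<le> norm (l + u) * norm R"
    using norm_cauchy_schwarz[of "- (l + u)" R] by (simp only: inner_minus_left norm_minus_cancel)
  \<comment> \<open>Weight \<beta>/2 spends exactly the whole quadratic penalty.\<close>
  also have "\<dots> \<le> \<beta> / 2 * (norm R)\<^sup>2 + (norm (l + u))\<^sup>2 / (2 * \<beta>)"
    using young[of "\<beta> / 2" "norm R" "norm (l + u)"] \<beta>_pos by (simp add: mult.commute)
  also have "(norm (l + u))\<^sup>2 \<le> 2 * (?b1\<^sup>2 + ?b2\<^sup>2)"
    using power_mono[OF lu norm_ge_zero, of 2] square_sum2[of ?b1 ?b2] by linarith
  finally have 3: "- ((l + u) \<bullet> R) \<le> \<beta> / 2 * (norm R)\<^sup>2 + (2 * (?b1\<^sup>2 + ?b2\<^sup>2)) / (2 * \<beta>)"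
    using \<beta>_pos by (simp add: divide_right_mono)
  have 4: "(2 * (?b1\<^sup>2 + ?b2\<^sup>2)) / (2 * \<beta>) = \<kappa> / \<beta> * (\<kappa> / \<eta>_val) * (1 / \<eta>_val * ?Y\<^sup>2) + \<kappa> ^ 4 * (norm c)\<^sup>2 / \<beta> * ?e\<^sup>2"
    using \<beta>_pos step_sizes by (simp add: power_mult_distrib power_divide field_simps power2_eq_square power4_eq_xxxx)
  have "\<kappa> / \<beta> * (\<kappa> / \<eta>_val) * (1 / \<eta>_val * ?Y\<^sup>2) \<le> 1 / 60 * (1 / \<eta>_val * ?Y\<^sup>2)"
    using step_sizes by (intro mult_right_mono \<kappa>_\<beta>_\<eta>) auto
  also have "\<dots> \<le> 1 / 8 * (1 / \<eta>_val * ?Y\<^sup>2)"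
    using step_sizes by (intro mult_right_mono) auto
  finally have "\<kappa> / \<beta> * (\<kappa> / \<eta>_val) * (1 / \<eta>_val * ?Y\<^sup>2) \<le> 1 / (8 * \<eta>_val) * ?Y\<^sup>2" by simp
  then show ?thesis using 1 2 3 4 by linarith
qed

text \<open>The objective is an exact quadratic around \<open>v1\<close>, so minimality kills the
  slope. The descent constant is 1/\<eta> rather than 1/(2 \<eta>): the slope of the Lagrangian part
  alone at \<open>v1\<close> is minus (v1 - v)/\<eta>, and pairing it with v - v1 gives the full
  square.\<close>

lemma value_step:
  assumes min: "\<And>w. lag p q \<pi> v1 l + 1 / (2 * \<eta>_val) * (norm (v1 - v))\<^sup>2
      \<le> lag p q \<pi> w l + 1 / (2 * \<eta>_val) * (norm (w - v))\<^sup>2"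
    and l1: "l1 = l + \<beta> *\<^sub>R res p q \<pi> v1"
  shows "dual_at p \<pi> v v1 l1"
    and "lag p q \<pi> v1 l + 1 / \<eta>_val * (norm (v1 - v))\<^sup>2 \<le> lag p q \<pi> v l"
proof -
  let ?B = "bell_mat \<gamma> p \<pi>"
  define g where "g = c + transpose ?B *v l1 + (1 / \<eta>_val) *\<^sub>R (v1 - v)"
  have res: "res p q \<pi> (v1 + d) = res p q \<pi> v1 + ?B *v d" for d
    by (simp add: bell_res_def matrix_vector_right_distrib)
  \<comment> \<open>The gradient in the value at \<open>v1\<close> under the old multiplier is
    \<open>c\<close> plus the transposed matrix applied to l + \<beta> R, and l + \<beta> R is
    \<open>l1\<close>.\<close>
  have lag: "lag p q \<pi> (v1 + d) l = lag p q \<pi> v1 l + (c + transpose ?B *v l1) \<bullet> d + \<beta> / 2 * (norm (?B *v d))\<^sup>2" for d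
  proof -
    have "(transpose ?B *v l1) \<bullet> d = l \<bullet> (?B *v d) + \<beta> * (res p q \<pi> v1 \<bullet> (?B *v d))"
      by (simp only: inner_transpose_mult l1 inner_add_left inner_scaleR_left)
    then show ?thesis
      unfolding lagr_def res power2_norm_eq_inner
      by (simp add: inner_add_left inner_add_right inner_commute[of "?B *v d" "res p q \<pi> v1"] field_simps
          del: transpose_matrix_vector)
  qed
  have prox: "1 / (2 * \<eta>_val) * (norm (v1 + d - v))\<^sup>2 = 1 / (2 * \<eta>_val) * (norm (v1 - v))\<^sup>2
      + ((1 / \<eta>_val) *\<^sub>R (v1 - v)) \<bullet> d + 1 / (2 * \<eta>_val) * (norm d)\<^sup>2" for d
  proof -
    have "v1 + d - v = (v1 - v) + d" by simp
    then have "(norm (v1 + d - v))\<^sup>2 = (norm (v1 - v))\<^sup>2 + 2 * ((v1 - v) \<bullet> d) + (norm d)\<^sup>2"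
      by (simp only: power2_norm_eq_inner inner_add_left inner_add_right) (simp add: inner_commute)
    then show ?thesis using step_sizes unfolding inner_scaleR_left by (simp add: field_simps)
  qed
  have nonneg: "0 \<le> g \<bullet> d + (\<beta> / 2 * (norm (?B *v d))\<^sup>2 + 1 / (2 * \<eta>_val) * (norm d)\<^sup>2)" for d
    using min[of "v1 + d"] unfolding lag prox g_def by (simp add: inner_add_left)
  have "0 \<le> (g \<bullet> g) * t + (\<beta> / 2 * (norm (?B *v g))\<^sup>2 + 1 / (2 * \<eta>_val) * (norm g)\<^sup>2) * t\<^sup>2" for t
    using nonneg[of "t *\<^sub>R g"]
    by (simp add: matrix_vector_mult_scaleR power_mult_distrib algebra_simps)
  then have "g \<bullet> g = 0" by (rule quadratic_nonneg_slope_zero)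
  then have g: "g = 0" by simp
  then have "(c + (1 / \<eta>_val) *\<^sub>R (v1 - v)) + transpose ?B *v l1 = 0" by (simp add: g_def algebra_simps)
  then have "transpose ?B *v l1 = - (c + (1 / \<eta>_val) *\<^sub>R (v1 - v))"
    by (rule minus_unique[symmetric])
  then show "dual_at p \<pi> v v1 l1" by (simp add: dual_at_def)
  have "(c + transpose ?B *v l1) = - ((1 / \<eta>_val) *\<^sub>R (v1 - v))"
    using g unfolding g_def by (simp add: eq_neg_iff_add_eq_0)
  moreover have "lag p q \<pi> v l = lag p q \<pi> v1 l + (c + transpose ?B *v l1) \<bullet> (v - v1) + \<beta> / 2 * (norm (?B *v (v - v1)))\<^sup>2"
    using lag[of "v - v1"] by simp
  moreover have "(- ((1 / \<eta>_val) *\<^sub>R (v1 - v))) \<bullet> (v - v1) = 1 / \<eta>_val * (norm (v1 - v))\<^sup>2"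
    by (simp add: power2_norm_eq_inner inner_diff_right inner_diff_left algebra_simps)
  moreover have "0 \<le> \<beta> / 2 * (norm (?B *v (v - v1)))\<^sup>2" using \<beta>_pos by simp
  ultimately show "lag p q \<pi> v1 l + 1 / \<eta>_val * (norm (v1 - v))\<^sup>2 \<le> lag p q \<pi> v l" by simp
qed

text \<open>The multiplier update is the only part of an iteration that raises the empirical
  Lagrangian; this increase is what the margins on \<beta> have to beat.\<close>

lemma multiplier_step:
  assumes "l1 = l + \<beta> *\<^sub>R res p q \<pi> v1"
  shows "lag p q \<pi> v1 l1 = lag p q \<pi> v1 l + (norm (l1 - l))\<^sup>2 / \<beta>"
proof -
  have "res p q \<pi> v1 \<bullet> res p q \<pi> v1 = (norm (res p q \<pi> v1))\<^sup>2" by (rule power2_norm_eq_inner[symmetric])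
  then show ?thesis
    using \<beta>_pos by (simp add: assms lagr_def inner_add_left power_mult_distrib power2_eq_square)
qed

end

section \<open>Absorption of the bias terms, as an inequality between real numbers\<close>

lemma square_sum2_le: "x\<^sup>2 \<le> K \<Longrightarrow> y\<^sup>2 \<le> K \<Longrightarrow> (x + y)\<^sup>2 \<le> 4 * K" for x y K :: real
  by (rule order_trans[OF square_sum2]) simp

lemma mult_le_mean_square: "x * y \<le> (x\<^sup>2 + y\<^sup>2) / 2" for x y :: real
  using zero_le_power2[of "x - y"] by (simp add: power2_diff)

text \<open>Letters: \<open>e\<close>, \<open>q\<close> are the kernel and reward errors of the
  batch and \<open>g\<close> the previous kernel error; \<open>X\<close>, \<open>Y\<close>,
  \<open>Z\<close> the increments of the policy, the value and the previous value; \<open>a\<close>,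
  \<open>b\<close> the norms of the current and the previous value; \<open>E0\<close>,
  \<open>E1\<close> the sizes of E before and after the step and \<open>F\<close> that of its
  change. Every error has square at most a multiple of K = (e^2 + q^2)(1 + a^4 + b^4) + g^2. Of the
  two bounds on \<open>F\<close>, the one by increments serves the bounded part of the multiplier;
  the one by \<open>E0 + E1\<close> suffices next to a factor \<open>Y\<close>.\<close>

lemma bias_terms_absorbed:
  fixes h A1 A2 A3 A4 L N D R C0 \<beta> :: real
  assumes h: "0 < h"
    and nn: "0 \<le> A1" "0 \<le> A2" "0 \<le> A3" "0 \<le> A4" "0 \<le> L" "0 \<le> N" "0 \<le> D" "0 \<le> R" "0 \<le> C0" "0 \<le> \<beta>"
  obtains C where "0 \<le> C"
    "\<And>e q g X Y Z a b E0 E1 F l1 dl Dn v1. \<lbrakk>0 \<le> e; 0 \<le> q; 0 \<le> g; 0 \<le> X; 0 \<le> Y; 0 \<le> Z; 0 \<le> a; 0 \<le> b;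
      0 \<le> E0; 0 \<le> E1; 0 \<le> F; e \<le> N; X \<le> D; E0 \<le> e * a + q; E1 \<le> e * v1 + q; F \<le> E0 + E1;
      F \<le> e * Y + X * (e * a + q); l1 \<le> A1 + A2 * Y; dl \<le> A2 * Y + A2 * Z + A3 * (e + L * X + g);
      Dn \<le> A4 * Y + X * (N * a + (R + q)); v1 \<le> C0 * (1 + q) + a + b\<rbrakk> \<Longrightarrow>
      l1 * F + dl * E1 + \<beta> * (Dn * E0) + \<beta> / 2 * E1\<^sup>2
        \<le> 4 * h * (X\<^sup>2 + Y\<^sup>2 + Z\<^sup>2) + C * ((e\<^sup>2 + q\<^sup>2) * (1 + a ^ 4 + b ^ 4) + g\<^sup>2)"
proof -
  define C1 where "C1 = 2 * (3 * (C0\<^sup>2 + (C0 * N + 1)\<^sup>2 + 1) + 1)"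
  define C2 where "C2 = 2 * (4 + C1)"
  define c1 where "c1 = A1\<^sup>2 * 1 / (4 * h)"
  define c2 where "c2 = A1\<^sup>2 * 4 / (4 * h)"
  define c3 where "c3 = A2\<^sup>2 * C2 / (4 * h)"
  define c4 where "c4 = A2\<^sup>2 * C1 / (4 * h)"
  define c6 where "c6 = (A3 * L)\<^sup>2 * C1 / (4 * h)"
  define c7 where "c7 = A3 * (2 + C1 / 2)"
  define c8 where "c8 = (\<beta> * A4)\<^sup>2 * 4 / (4 * h)"
  define c9 where "c9 = (\<beta> * N)\<^sup>2 * 4 / (4 * h)"
  define c10 where "c10 = (\<beta> * R)\<^sup>2 * 4 / (4 * h)"
  define c11 where "c11 = \<beta> * D * (5 / 2)"
  define c12 where "c12 = \<beta> / 2 * C1"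
  define C where "C = c1 + c2 + c3 + (c4 + c4) + c6 + c7 + c8 + c9 + c10 + c11 + c12"
  have C1: "0 \<le> C1" by (simp add: C1_def)
  then have C2: "0 \<le> C2" by (simp add: C2_def)
  have "0 \<le> C"
    unfolding C_def c1_def c2_def c3_def c4_def c6_def c7_def c8_def c9_def c10_def c11_def c12_def
    using h nn C1 C2 by (intro add_nonneg_nonneg mult_nonneg_nonneg divide_nonneg_nonneg) auto
  moreover have "l1 * F + dl * E1 + \<beta> * (Dn * E0) + \<beta> / 2 * E1\<^sup>2
        \<le> 4 * h * (X\<^sup>2 + Y\<^sup>2 + Z\<^sup>2) + C * ((e\<^sup>2 + q\<^sup>2) * (1 + a ^ 4 + b ^ 4) + g\<^sup>2)"
    if pos: "0 \<le> e" "0 \<le> q" "0 \<le> g" "0 \<le> X" "0 \<le> Y" "0 \<le> Z" "0 \<le> a" "0 \<le> b" "0 \<le> E0" "0 \<le> E1" "0 \<le> F"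
      and eN: "e \<le> N" and XD: "X \<le> D" and E0: "E0 \<le> e * a + q" and E1: "E1 \<le> e * v1 + q"
      and F01: "F \<le> E0 + E1" and F: "F \<le> e * Y + X * (e * a + q)" and l1: "l1 \<le> A1 + A2 * Y"
      and dl: "dl \<le> A2 * Y + A2 * Z + A3 * (e + L * X + g)"
      and Dn: "Dn \<le> A4 * Y + X * (N * a + (R + q))" and v1: "v1 \<le> C0 * (1 + q) + a + b"
    for e q g X Y Z a b E0 E1 F l1 dl Dn v1 :: real
  proof -
    define K where "K = (e\<^sup>2 + q\<^sup>2) * (1 + a ^ 4 + b ^ 4) + g\<^sup>2"
    define G where "G = e * a + q"
    have G0: "0 \<le> G" using pos by (simp add: G_def)
    have w: "e\<^sup>2 * x \<le> K" "q\<^sup>2 * x \<le> K" if "x \<le> 1 + a ^ 4 + b ^ 4" "0 \<le> x" for x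
    proof -
      have "e\<^sup>2 * x \<le> (e\<^sup>2 + q\<^sup>2) * (1 + a ^ 4 + b ^ 4)" "q\<^sup>2 * x \<le> (e\<^sup>2 + q\<^sup>2) * (1 + a ^ 4 + b ^ 4)"
        using that by (auto intro!: mult_mono)
      then show "e\<^sup>2 * x \<le> K" "q\<^sup>2 * x \<le> K" unfolding K_def using zero_le_power2[of g] by linarith+
    qed
    have p4: "0 \<le> a ^ 4" "0 \<le> b ^ 4" by simp_all
    have K: "e\<^sup>2 \<le> K" "q\<^sup>2 \<le> K" "g\<^sup>2 \<le> K" "(e * a)\<^sup>2 \<le> K" "(e * b)\<^sup>2 \<le> K" "(q * a)\<^sup>2 \<le> K" "(e * a\<^sup>2)\<^sup>2 \<le> K"
    proof -
      show "e\<^sup>2 \<le> K" "q\<^sup>2 \<le> K" using w[of 1] p4 by auto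
      have "0 \<le> (e\<^sup>2 + q\<^sup>2) * (1 + a ^ 4 + b ^ 4)" using p4 by (intro mult_nonneg_nonneg) auto
      then show "g\<^sup>2 \<le> K" by (simp add: K_def)
      have "a\<^sup>2 \<le> 1 + a ^ 4 + b ^ 4" using square_le_one_plus_fourth[of a] p4 by linarith
      from w[OF this] show "(e * a)\<^sup>2 \<le> K" "(q * a)\<^sup>2 \<le> K" by (auto simp: power_mult_distrib)
      have "b\<^sup>2 \<le> 1 + a ^ 4 + b ^ 4" using square_le_one_plus_fourth[of b] p4 by linarith
      from w(1)[OF this] show "(e * b)\<^sup>2 \<le> K" by (auto simp: power_mult_distrib)
      have "a ^ 4 \<le> 1 + a ^ 4 + b ^ 4" using p4 by linarith
      from w(1)[OF this] show "(e * a\<^sup>2)\<^sup>2 \<le> K" by (simp add: power_mult_distrib)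
    qed
    have G: "G\<^sup>2 \<le> 4 * K" unfolding G_def by (rule square_sum2_le[OF K(4,2)])
    have E0G: "E0 \<le> G" using E0 by (simp add: G_def)
    have E0sq: "E0\<^sup>2 \<le> 4 * K" using power_mono[OF E0G pos(9), of 2] G by linarith
    \<comment> \<open>The policy increment brings a factor \<open>a\<close> to an error that already
      contains \<open>e * a\<close>; its square contains e^2 a^4, which dictates the fourth powers
      in the weight.\<close>
    have aE0: "(a * E0)\<^sup>2 \<le> 4 * K"
    proof -
      have "a * E0 \<le> e * a\<^sup>2 + q * a"
        using mult_left_mono[OF E0 pos(7)] by (simp add: power2_eq_square algebra_simps)
      then have "(a * E0)\<^sup>2 \<le> (e * a\<^sup>2 + q * a)\<^sup>2" using pos by (intro power_mono) auto
      then show ?thesis using square_sum2_le[OF K(7,6)] by linarith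
    qed
    \<comment> \<open>The new value depends on the current batch and cannot be part of a weight
      fixed in advance. It is replaced by the two previous values and \<open>q\<close>; the
      resulting product \<open>e * q\<close> becomes linear in the error through
      \<open>e \<le> N\<close>.\<close>
    have E1sq: "E1\<^sup>2 \<le> C1 * K"
    proof -
      have "e * v1 \<le> e * (C0 * (1 + q) + a + b)" by (rule mult_left_mono[OF v1 pos(1)])
      moreover have "C0 * q * e \<le> C0 * q * N" by (intro mult_left_mono eN) (use nn pos in auto)
      ultimately have "E1 \<le> (C0 * e + (C0 * N + 1) * q + e * a) + e * b"
        using E1 by (simp add: algebra_simps)
      then have "E1\<^sup>2 \<le> ((C0 * e + (C0 * N + 1) * q + e * a) + e * b)\<^sup>2" using pos by (intro power_mono) auto
      also have "\<dots> \<le> 2 * (3 * ((C0 * e)\<^sup>2 + ((C0 * N + 1) * q)\<^sup>2 + (e * a)\<^sup>2) + (e * b)\<^sup>2)"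
        by (intro order_trans[OF square_sum2] mult_left_mono add_right_mono square_sum3) simp
      also have "\<dots> \<le> 2 * (3 * (C0\<^sup>2 * K + (C0 * N + 1)\<^sup>2 * K + K) + K)"
        unfolding power_mult_distrib[of C0 e] power_mult_distrib[of "C0 * N + 1" q]
        by (intro mult_left_mono add_mono K) auto
      also have "\<dots> = C1 * K" by (simp add: C1_def algebra_simps)
      finally show ?thesis .
    qed
    have Fsq: "F\<^sup>2 \<le> C2 * K"
    proof -
      have "F\<^sup>2 \<le> (E0 + E1)\<^sup>2" using F01 pos by (intro power_mono) auto
      then show ?thesis using square_sum2[of E0 E1] E0sq E1sq by (simp add: C2_def algebra_simps)
    qed
    have t1: "A1 * (Y * e) \<le> h * Y\<^sup>2 + c1 * K" unfolding c1_def by (rule young_absorb[OF h]) (use K in simp)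
    have t2: "A1 * (X * G) \<le> h * X\<^sup>2 + c2 * K" unfolding c2_def by (rule young_absorb[OF h G])
    have t3: "A2 * (Y * F) \<le> h * Y\<^sup>2 + c3 * K" unfolding c3_def by (rule young_absorb[OF h Fsq])
    have t4: "A2 * (Y * E1) \<le> h * Y\<^sup>2 + c4 * K" unfolding c4_def by (rule young_absorb[OF h E1sq])
    have t5: "A2 * (Z * E1) \<le> h * Z\<^sup>2 + c4 * K" unfolding c4_def by (rule young_absorb[OF h E1sq])
    have t6: "(A3 * L) * (X * E1) \<le> h * X\<^sup>2 + c6 * K" unfolding c6_def by (rule young_absorb[OF h E1sq])
    have t7: "A3 * ((e + g) * E1) \<le> c7 * K"
    proof -
      have "(e + g) * E1 \<le> ((e + g)\<^sup>2 + E1\<^sup>2) / 2"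
        by (rule mult_le_mean_square)
      also have "\<dots> \<le> (2 + C1 / 2) * K" using square_sum2[of e g] K E1sq by (simp add: algebra_simps)
      finally show ?thesis using mult_left_mono[OF _ nn(3)] by (fastforce simp: c7_def mult.assoc)
    qed
    have t8: "(\<beta> * A4) * (Y * E0) \<le> h * Y\<^sup>2 + c8 * K" unfolding c8_def by (rule young_absorb[OF h E0sq])
    have t9: "(\<beta> * N) * (X * (a * E0)) \<le> h * X\<^sup>2 + c9 * K" unfolding c9_def by (rule young_absorb[OF h aE0])
    have t10: "(\<beta> * R) * (X * E0) \<le> h * X\<^sup>2 + c10 * K" unfolding c10_def by (rule young_absorb[OF h E0sq])
    \<comment> \<open>Here \<open>q * E0\<close> is already quadratic in the errors, so the policy
      increment is simply bounded by \<open>D\<close>.\<close>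
    have t11: "\<beta> * (X * (q * E0)) \<le> c11 * K"
    proof -
      have "q * E0 \<le> (q\<^sup>2 + E0\<^sup>2) / 2" by (rule mult_le_mean_square)
      then have qE: "q * E0 \<le> 5 / 2 * K" using K(2) E0sq by simp
      have "X * (q * E0) \<le> D * (5 / 2 * K)" using pos nn by (intro mult_mono XD qE) auto
      from mult_left_mono[OF this nn(10)] show ?thesis by (simp add: c11_def mult.assoc)
    qed
    have t12: "\<beta> / 2 * E1\<^sup>2 \<le> c12 * K" using mult_left_mono[OF E1sq, of "\<beta> / 2"] nn by (simp add: c12_def mult.assoc)
    have s1: "l1 * F \<le> A1 * (Y * e) + A1 * (X * G) + A2 * (Y * F)"
    proof -
      have "l1 * F \<le> (A1 + A2 * Y) * F" by (rule mult_right_mono[OF l1 pos(11)])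
      moreover have "A1 * F \<le> A1 * (e * Y + X * G)" using F nn by (intro mult_left_mono) (auto simp: G_def)
      ultimately show ?thesis by (simp add: algebra_simps)
    qed
    have s2: "dl * E1 \<le> A2 * (Y * E1) + A2 * (Z * E1) + (A3 * L) * (X * E1) + A3 * ((e + g) * E1)"
      using mult_right_mono[OF dl pos(10)] by (simp add: algebra_simps)
    have s3: "\<beta> * (Dn * E0) \<le> (\<beta> * A4) * (Y * E0) + (\<beta> * N) * (X * (a * E0)) + (\<beta> * R) * (X * E0) + \<beta> * (X * (q * E0))"
      using mult_left_mono[OF mult_right_mono[OF Dn pos(9)] nn(10)] by (simp add: algebra_simps)
    have CK: "C * K = c1 * K + c2 * K + c3 * K + (c4 * K + c4 * K) + c6 * K + c7 * K + c8 * K + c9 * K + c10 * K + c11 * K + c12 * K"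
      by (simp add: C_def distrib_right)
    have hZ: "0 \<le> h * Z\<^sup>2" using h by simp
    \<comment> \<open>Four of the Young terms are charged to \<open>X\<close>, four to
      \<open>Y\<close> and one to \<open>Z\<close>, hence the common factor 4.\<close>
    have "4 * h * (X\<^sup>2 + Y\<^sup>2 + Z\<^sup>2) = 4 * (h * X\<^sup>2) + 4 * (h * Y\<^sup>2) + 4 * (h * Z\<^sup>2)" by (simp add: algebra_simps)
    then show ?thesis
      unfolding K_def[symmetric] CK
      using s1 s2 s3 t1 t2 t3 t4 t5 t6 t7 t8 t9 t10 t11 t12 hZ by linarith
  qed
  ultimately show thesis by (rule that)
qed

section \<open>Bias of the Lagrangian along a step, and the perturbed descent inequality\<close>

context bellman_admm_setup
begin

definition kernel_err :: "('s \<Rightarrow> 'a \<Rightarrow> 's \<Rightarrow> real) \<Rightarrow> real" where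
  "kernel_err p = kernel_size (kernel_diff p P)"

definition reward_err :: "('s \<Rightarrow> 'a \<Rightarrow> real) \<Rightarrow> real" where
  "reward_err q = table_size (table_diff q r)"

definition model_err :: "('s \<Rightarrow> 'a \<Rightarrow> 's \<Rightarrow> real) \<Rightarrow> ('s \<Rightarrow> 'a \<Rightarrow> real) \<Rightarrow> real" where
  "model_err p q = (kernel_err p)\<^sup>2 + (reward_err q)\<^sup>2"

lemma kernel_err_nonneg: "0 \<le> kernel_err p"
  by (simp add: kernel_err_def kernel_size_nonneg)

lemma reward_err_nonneg: "0 \<le> reward_err p"
  by (simp add: reward_err_def table_size_nonneg)

text \<open>The number of state-action pairs: each stochastic row has l1 norm 1.\<close>

definition entries :: real where "entries = kernel_size P"

lemma entries_nonneg: "0 \<le> entries"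
  by (simp add: entries_def kernel_size_nonneg)

lemma valid_kernel_size: "valid p \<Longrightarrow> kernel_size p = entries"
  unfolding entries_def
  by (subst (1 2) kernel_size_stochastic) (auto simp: valid_def P_stochastic)

lemma norm_policy_diff_entries:
  fixes \<pi> \<pi>' :: "real^'a^'s"
  shows "\<pi> \<in> policies \<Longrightarrow> \<pi>' \<in> policies \<Longrightarrow> norm (\<pi>' - \<pi>) \<le> 2 * entries"
  unfolding entries_def kernel_size_stochastic[OF P_stochastic] by (rule norm_policy_diff_le)

lemma kernel_err_le: "valid p \<Longrightarrow> kernel_err p \<le> 2 * entries"
  using kernel_size_diff_le[of p P] valid_kernel_size[OF valid_P] valid_kernel_size[of p]
  by (simp add: kernel_err_def)

text \<open>The two Lagrangians differ by terms in E, and only the change of this difference along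
  the step matters. Norm estimates reduce it to \<open>bias_terms_absorbed\<close>; the constant
  depends on \<delta> and on the problem, not on the iterates.\<close>

lemma bias_bound:
  assumes \<delta>: "0 < \<delta>"
  obtains C where "0 \<le> C"
    "\<And>p0' p q \<pi> \<pi>' v0 v v1 l l1. \<lbrakk>valid p0'; valid p; \<pi> \<in> policies; \<pi>' \<in> policies;
      dual_at p0' \<pi> v0 v l; dual_at p \<pi>' v v1 l1; l1 = l + \<beta> *\<^sub>R res p q \<pi>' v1\<rbrakk> \<Longrightarrow>
      (lag P r \<pi>' v1 l1 - lag p q \<pi>' v1 l1) - (lag P r \<pi> v l - lag p q \<pi> v l)
      \<le> \<delta> * ((norm (\<pi>' - \<pi>))\<^sup>2 + (norm (v1 - v))\<^sup>2 + (norm (v - v0))\<^sup>2)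
        + C * (model_err p q * (1 + norm v ^ 4 + norm v0 ^ 4) + (kernel_err p0')\<^sup>2)"
proof -
  \<comment> \<open>Compensates the factor 4 in \<open>bias_terms_absorbed\<close>.\<close>
  define h where "h = \<delta> / 4"
  have h: "0 < h" using \<delta> by (simp add: h_def)
  define A1 where "A1 = \<kappa> * norm c"
  define A2 where "A2 = \<kappa> / \<eta>_val"
  define A3 where "A3 = \<kappa>\<^sup>2 * norm c"
  define C0 where "C0 = (60/59) * (\<kappa> * (reward_bound + 1) + 2 * (\<kappa>\<^sup>2 * norm c / \<beta>))"
  \<comment> \<open>The absolute value of \<open>L_M\<close> enters because \<open>L_M\<close>
    itself has no sign.\<close>
  have nn: "0 \<le> A1" "0 \<le> A2" "0 \<le> A3" "0 \<le> 1 + entries" "0 \<le> \<bar>L_M\<bar>" "0 \<le> 2 * entries" "0 \<le> 2 * entries"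
      "0 \<le> reward_bound" "0 \<le> C0" "0 \<le> \<beta>"
    using \<kappa>_nonneg step_sizes \<beta>_pos reward_bound_nonneg entries_nonneg by (auto simp: A1_def A2_def A3_def C0_def intro!: add_nonneg_nonneg mult_nonneg_nonneg divide_nonneg_nonneg)
  obtain C where C: "0 \<le> C" "\<And>e q g X Y Z a b E0 E1 F l1 dl Dn v1. \<lbrakk>0 \<le> e; 0 \<le> q; 0 \<le> g; 0 \<le> X; 0 \<le> Y; 0 \<le> Z; 0 \<le> a; 0 \<le> b;
      0 \<le> E0; 0 \<le> E1; 0 \<le> F; e \<le> 2 * entries; X \<le> 2 * entries; E0 \<le> e * a + q; E1 \<le> e * v1 + q; F \<le> E0 + E1;
      F \<le> e * Y + X * (e * a + q); l1 \<le> A1 + A2 * Y; dl \<le> A2 * Y + A2 * Z + A3 * (e + \<bar>L_M\<bar> * X + g);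
      Dn \<le> (1 + entries) * Y + X * (2 * entries * a + (reward_bound + q)); v1 \<le> C0 * (1 + q) + a + b\<rbrakk> \<Longrightarrow>
      l1 * F + dl * E1 + \<beta> * (Dn * E0) + \<beta> / 2 * E1\<^sup>2
        \<le> 4 * h * (X\<^sup>2 + Y\<^sup>2 + Z\<^sup>2) + C * ((e\<^sup>2 + q\<^sup>2) * (1 + a ^ 4 + b ^ 4) + g\<^sup>2)"
    apply (rule bias_terms_absorbed[OF h nn])
    subgoal premises prems for C by (rule prems(1)[OF prems(2)], rule prems(3))
    done
  show thesis
  proof (rule that[OF C(1)])
    fix p0' p q \<pi> \<pi>' v0 v v1 l l1
    assume v: "valid p0'" "valid p" and \<pi>: "\<pi> \<in> policies" "\<pi>' \<in> policies"
      and dual: "dual_at p0' \<pi> v0 v l" "dual_at p \<pi>' v v1 l1" and l1: "l1 = l + \<beta> *\<^sub>R res p q \<pi>' v1"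
    define E0 where "E0 = res P r \<pi> v - res p q \<pi> v"
    define E1 where "E1 = res P r \<pi>' v1 - res p q \<pi>' v1"
    define D where "D = res p q \<pi>' v1 - res p q \<pi> v"
    let ?e = "kernel_err p" and ?q = "reward_err q" and ?g = "kernel_err p0'"
    let ?X = "norm (\<pi>' - \<pi>)" and ?Y = "norm (v1 - v)" and ?Z = "norm (v - v0)"
    have E0': "E0 = \<gamma> *\<^sub>R (trans_mat (kernel_diff p P) \<pi> *v v) + rew_vec (table_diff q r) \<pi>"
      unfolding E0_def by (rule bell_res_diff_models)
    have E1': "E1 = \<gamma> *\<^sub>R (trans_mat (kernel_diff p P) \<pi>' *v v1) + rew_vec (table_diff q r) \<pi>'"
      unfolding E1_def by (rule bell_res_diff_models)
    have \<gamma>s: "norm (\<gamma> *\<^sub>R x) \<le> norm x" for x :: "real^'s"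
      using discount by (simp add: mult_left_le_one_le)
    have bE: "norm (\<gamma> *\<^sub>R (trans_mat (kernel_diff p P) \<pi> *v x) + rew_vec (table_diff q r) \<pi>) \<le> ?e * norm x + ?q"
      if "\<pi> \<in> policies" for \<pi> x
      using norm_triangle_ineq[of "\<gamma> *\<^sub>R (trans_mat (kernel_diff p P) \<pi> *v x)" "rew_vec (table_diff q r) \<pi>"]
        \<gamma>s[of "trans_mat (kernel_diff p P) \<pi> *v x"] norm_trans_mat_policy[OF that, of "kernel_diff p P" x]
        norm_rew_vec_policy[OF that, of "table_diff q r"]
      unfolding kernel_err_def reward_err_def by linarith
    have b0: "norm E0 \<le> ?e * norm v + ?q" unfolding E0' by (rule bE[OF \<pi>(1)])
    have b1: "norm E1 \<le> ?e * norm v1 + ?q" unfolding E1' by (rule bE[OF \<pi>(2)])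
    \<comment> \<open>E is linear in the policy for fixed value and linear in the value up to the
      reward part, so its change is E at the new policy in the value increment plus E at the policy
      increment in the old value.\<close>
    have F: "norm (E1 - E0) \<le> ?e * ?Y + ?X * (?e * norm v + ?q)"
    proof -
      have "E1 - E0 = \<gamma> *\<^sub>R (trans_mat (kernel_diff p P) \<pi>' *v (v1 - v))
          + (\<gamma> *\<^sub>R (trans_mat (kernel_diff p P) (\<pi>' - \<pi>) *v v) + rew_vec (table_diff q r) (\<pi>' - \<pi>))"
        unfolding E0' E1' trans_mat_diff rew_vec_diff
        by (simp add: matrix_vector_mult_diff_distrib matrix_vector_mult_diff_rdistrib scaleR_diff_right)
      also have "norm \<dots> \<le> norm (\<gamma> *\<^sub>R (trans_mat (kernel_diff p P) \<pi>' *v (v1 - v)))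
          + (norm (\<gamma> *\<^sub>R (trans_mat (kernel_diff p P) (\<pi>' - \<pi>) *v v)) + norm (rew_vec (table_diff q r) (\<pi>' - \<pi>)))"
        by (intro order_trans[OF norm_triangle_ineq] add_left_mono norm_triangle_ineq)
      also have "\<dots> \<le> ?e * ?Y + (?X * ?e * norm v + ?X * ?q)"
        unfolding kernel_err_def reward_err_def
        by (intro add_mono order_trans[OF \<gamma>s] norm_trans_mat_policy \<pi> norm_trans_mat_mult norm_rew_vec entry_abs_le_norm)
      finally show ?thesis by (simp add: algebra_simps)
    qed
    have D: "norm D \<le> (1 + entries) * ?Y + ?X * (2 * entries * norm v + (reward_bound + ?q))"
    proof -
      have kp: "kernel_size p = entries" by (rule valid_kernel_size[OF v(2)])
      have "D = (v1 - v) - \<gamma> *\<^sub>R (trans_mat p \<pi>' *v (v1 - v))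
          - (\<gamma> *\<^sub>R (trans_mat p (\<pi>' - \<pi>) *v v) + rew_vec q (\<pi>' - \<pi>))"
        unfolding D_def bell_res_alt trans_mat_diff rew_vec_diff
        by (simp add: matrix_vector_mult_diff_distrib matrix_vector_mult_diff_rdistrib scaleR_diff_right)
      also have "norm \<dots> \<le> (?Y + norm (\<gamma> *\<^sub>R (trans_mat p \<pi>' *v (v1 - v))))
          + (norm (\<gamma> *\<^sub>R (trans_mat p (\<pi>' - \<pi>) *v v)) + norm (rew_vec q (\<pi>' - \<pi>)))"
        by (intro order_trans[OF norm_triangle_ineq4] add_mono norm_triangle_ineq norm_triangle_ineq4)
      also have "\<dots> \<le> (?Y + entries * ?Y) + (?X * entries * norm v + ?X * table_size q)"
        unfolding kp[symmetric]
        by (intro add_mono order_trans[OF \<gamma>s] norm_trans_mat_policy \<pi> norm_trans_mat_mult norm_rew_vec entry_abs_le_norm order_refl)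
      also have "\<dots> \<le> (?Y + entries * ?Y) + (?X * (2 * entries) * norm v + ?X * (reward_bound + ?q))"
        using table_size_le[of q r] entries_nonneg unfolding reward_err_def reward_bound_def
        by (intro add_mono mult_left_mono mult_right_mono order_refl) auto
      finally show ?thesis by (simp add: algebra_simps)
    qed
    have dl: "norm (l1 - l) \<le> A2 * ?Y + A2 * ?Z + A3 * (?e + \<bar>L_M\<bar> * ?X + ?g)"
    proof -
      have "A3 * (?e + L_M * ?X + ?g) \<le> A3 * (?e + \<bar>L_M\<bar> * ?X + ?g)"
        using nn(3) by (intro mult_left_mono add_mono mult_right_mono) auto
      then show ?thesis
        using dual_increment[OF v \<pi> dual] by (simp only: A2_def A3_def kernel_err_def)
    qed
    have nl1: "norm l1 \<le> A1 + A2 * ?Y"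
      using dual_norm[OF v(2) \<pi>(2) dual(2)] by (simp only: A1_def A2_def)
    have nv1: "norm v1 \<le> C0 * (1 + ?q) + norm v + norm v0"
    proof -
      define T where "T = 2 * (\<kappa>\<^sup>2 * norm c / \<beta>)"
      have "0 \<le> \<kappa> + \<kappa> * reward_bound * ?q + T * ?q"
        using \<kappa>_nonneg reward_bound_nonneg reward_err_nonneg \<beta>_pos by (simp add: T_def)
      then have "\<kappa> * (reward_bound + ?q) + T \<le> (\<kappa> * (reward_bound + 1) + T) * (1 + ?q)"
        by (simp add: algebra_simps)
      then have "(60/59) * (\<kappa> * (reward_bound + ?q) + T) \<le> (60/59) * ((\<kappa> * (reward_bound + 1) + T) * (1 + ?q))"
        by (rule mult_left_mono) simp
      then have "(60/59) * (\<kappa> * (reward_bound + ?q) + 2 * (\<kappa>\<^sup>2 * norm c / \<beta>)) \<le> C0 * (1 + ?q)"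
        by (simp only: C0_def T_def mult.assoc)
      moreover have "(2 * norm v + norm v0) / 59 \<le> norm v + norm v0" by simp
      ultimately show ?thesis
        using value_norm[OF v \<pi> dual l1] unfolding reward_err_def by linarith
    qed
    have main: "norm l1 * norm (E1 - E0) + norm (l1 - l) * norm E1 + \<beta> * (norm D * norm E0) + \<beta> / 2 * (norm E1)\<^sup>2
        \<le> 4 * h * (?X\<^sup>2 + ?Y\<^sup>2 + ?Z\<^sup>2) + C * ((?e\<^sup>2 + ?q\<^sup>2) * (1 + norm v ^ 4 + norm v0 ^ 4) + ?g\<^sup>2)"
      by (rule C(2)[OF kernel_err_nonneg reward_err_nonneg kernel_err_nonneg _ _ _ _ _ _ _ _ kernel_err_le[OF v(2)]
            norm_policy_diff_entries[OF \<pi>] b0 b1 _ F nl1 dl D nv1])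
         (use norm_triangle_ineq4[of E1 E0] in auto)
    \<comment> \<open>At the new point \<beta> R' is l1 - l; at the old point it is l1 - l - \<beta>
      D. The old term l . E0 thus combines to l1 . E0, so \<open>l1\<close> multiplies only the
      change of E.\<close>
    have "(lag P r \<pi>' v1 l1 - lag p q \<pi>' v1 l1) - (lag P r \<pi> v l - lag p q \<pi> v l)
        = l1 \<bullet> (E1 - E0) + (l1 - l) \<bullet> E1 + \<beta> * (D \<bullet> E0) + \<beta> / 2 * (norm E1)\<^sup>2 - \<beta> / 2 * (norm E0)\<^sup>2"
    proof -
      have d: "\<beta> * (res p q \<pi>' v1 \<bullet> x) = (l1 - l) \<bullet> x" for x by (simp add: l1)
      have r0: "res p q \<pi> v = res p q \<pi>' v1 - D" by (simp add: D_def)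
      have "\<beta> * (res p q \<pi> v \<bullet> E0) = (l1 - l) \<bullet> E0 - \<beta> * (D \<bullet> E0)"
        unfolding r0 by (simp only: inner_diff_left right_diff_distrib d)
      then show ?thesis
        unfolding lagr_diff_models[OF E0_def] lagr_diff_models[OF E1_def] d
        by (simp add: inner_diff_left inner_diff_right)
    qed
    also have "\<dots> \<le> norm l1 * norm (E1 - E0) + norm (l1 - l) * norm E1 + \<beta> * (norm D * norm E0) + \<beta> / 2 * (norm E1)\<^sup>2"
    proof -
      have "0 \<le> \<beta> / 2 * (norm E0)\<^sup>2" using \<beta>_pos by simp
      moreover have "\<beta> * (D \<bullet> E0) \<le> \<beta> * (norm D * norm E0)"
        using \<beta>_pos norm_cauchy_schwarz by (intro mult_left_mono) auto
      ultimately show ?thesis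
        using norm_cauchy_schwarz[of l1 "E1 - E0"] norm_cauchy_schwarz[of "l1 - l" E1] by linarith
    qed
    finally show "(lag P r \<pi>' v1 l1 - lag p q \<pi>' v1 l1) - (lag P r \<pi> v l - lag p q \<pi> v l)
      \<le> \<delta> * (?X\<^sup>2 + ?Y\<^sup>2 + ?Z\<^sup>2) + C * (model_err p q * (1 + norm v ^ 4 + norm v0 ^ 4) + ?g\<^sup>2)"
      using main by (simp add: h_def model_err_def)
  qed
qed

text \<open>What remains of the proximal terms, in units of 1/\<eta>. Policy: 1/2 - 3/10 (dual
  increment) - 1/10 (bias). Current value: 1 - 1/20 (dual) - 1/40 (bias) - 1/8 (merit). Previous
  value: 1/8 (merit) - 1/20 (dual) - 1/40 (bias).\<close>

definition rate_pol :: real where "rate_pol = 1 / (10 * \<eta>_pol)"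
definition rate_val :: real where "rate_val = 4 / (5 * \<eta>_val)"
definition rate_prev :: real where "rate_prev = 1 / (20 * \<eta>_val)"

text \<open>Quantifies over all data of one step, so that a single constant can be fixed before any
  run is considered. The reals \<open>f\<close> and \<open>f1\<close> stand for the costs of the old
  and the new policy.\<close>

definition descent_const :: "real \<Rightarrow> bool" where
  "descent_const C \<longleftrightarrow> 0 \<le> C \<and> (\<forall>p0' p q \<pi> \<pi>' v0 v v1 l l1 f f1.
    valid p0' \<longrightarrow> valid p \<longrightarrow> \<pi> \<in> policies \<longrightarrow> \<pi>' \<in> policies \<longrightarrow> dual_at p0' \<pi> v0 v l \<longrightarrow>
    f1 + lag p q \<pi>' v l + 1 / (2 * \<eta>_pol) * (norm (\<pi>' - \<pi>))\<^sup>2 \<le> f + lag p q \<pi> v l \<longrightarrow>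
    (\<forall>w. lag p q \<pi>' v1 l + 1 / (2 * \<eta>_val) * (norm (v1 - v))\<^sup>2
      \<le> lag p q \<pi>' w l + 1 / (2 * \<eta>_val) * (norm (w - v))\<^sup>2) \<longrightarrow>
    l1 = l + \<beta> *\<^sub>R res p q \<pi>' v1 \<longrightarrow>
    f1 + lag P r \<pi>' v1 l1 + 1 / (8 * \<eta>_val) * (norm (v1 - v))\<^sup>2
      + rate_pol * (norm (\<pi>' - \<pi>))\<^sup>2 + rate_val * (norm (v1 - v))\<^sup>2 + rate_prev * (norm (v - v0))\<^sup>2
    \<le> f + lag P r \<pi> v l + 1 / (8 * \<eta>_val) * (norm (v - v0))\<^sup>2
      + C * (model_err p q * (1 + norm v ^ 4 + norm v0 ^ 4) + (kernel_err p0')\<^sup>2))"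

lemma descent_const_exists: "\<exists>C. descent_const C"
proof -
  \<comment> \<open>The shares 1/10 and 1/40 that the budget leaves for the bias.\<close>
  define \<delta> where "\<delta> = min (1 / (10 * \<eta>_pol)) (1 / (40 * \<eta>_val))"
  have \<delta>: "0 < \<delta>" "\<delta> \<le> 1 / (10 * \<eta>_pol)" "\<delta> \<le> 1 / (40 * \<eta>_val)" using step_sizes by (auto simp: \<delta>_def)
  obtain C where C: "0 \<le> C"
    "\<And>p0' p q \<pi> \<pi>' v0 v v1 l l1. \<lbrakk>valid p0'; valid p; \<pi> \<in> policies; \<pi>' \<in> policies;
      dual_at p0' \<pi> v0 v l; dual_at p \<pi>' v v1 l1; l1 = l + \<beta> *\<^sub>R res p q \<pi>' v1\<rbrakk> \<Longrightarrow>
      (lag P r \<pi>' v1 l1 - lag p q \<pi>' v1 l1) - (lag P r \<pi> v l - lag p q \<pi> v l)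
      \<le> \<delta> * ((norm (\<pi>' - \<pi>))\<^sup>2 + (norm (v1 - v))\<^sup>2 + (norm (v - v0))\<^sup>2)
        + C * (model_err p q * (1 + norm v ^ 4 + norm v0 ^ 4) + (kernel_err p0')\<^sup>2)"
    apply (rule bias_bound[OF \<delta>(1)])
    subgoal premises prems for C by (rule prems(1)[OF prems(2)], rule prems(3))
    done
  define A3 where "A3 = \<kappa>\<^sup>2 * norm c"
  define C' where "C' = 9 * A3\<^sup>2 / \<beta>"
  have C': "0 \<le> C'" using \<beta>_pos by (simp add: C'_def)
  have "descent_const (C + C')"
    unfolding descent_const_def
  proof (intro conjI allI impI)
    show "0 \<le> C + C'" using C(1) C' by simp
    fix p0' p q and \<pi> \<pi>' :: "real^'a^'s" and v0 v v1 l l1 f f1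
    assume v: "valid p0'" "valid p" and \<pi>: "\<pi> \<in> policies" "\<pi>' \<in> policies" and dual: "dual_at p0' \<pi> v0 v l"
      and pstep: "f1 + lag p q \<pi>' v l + 1 / (2 * \<eta>_pol) * (norm (\<pi>' - \<pi>))\<^sup>2 \<le> f + lag p q \<pi> v l"
      and vmin: "\<forall>w. lag p q \<pi>' v1 l + 1 / (2 * \<eta>_val) * (norm (v1 - v))\<^sup>2
        \<le> lag p q \<pi>' w l + 1 / (2 * \<eta>_val) * (norm (w - v))\<^sup>2"
      and l1: "l1 = l + \<beta> *\<^sub>R res p q \<pi>' v1"
    note vstep = value_step[OF vmin[rule_format] l1]
    note mstep = multiplier_step[OF l1]
    note dl = dual_increment[OF v \<pi> dual vstep(1)]
    note bias = C(2)[OF v \<pi> dual vstep(1) l1]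
    define X Y Z where "X = norm (\<pi>' - \<pi>)" and "Y = norm (v1 - v)" and "Z = norm (v - v0)"
    define e g where "e = kernel_err p" and "g = kernel_err p0'"
    define K where "K = model_err p q * (1 + norm v ^ 4 + norm v0 ^ 4) + g\<^sup>2"
    have eg: "e\<^sup>2 + g\<^sup>2 \<le> K"
    proof -
      have "e\<^sup>2 * 1 \<le> model_err p q * (1 + norm v ^ 4 + norm v0 ^ 4)"
        by (intro mult_mono) (auto simp: model_err_def e_def)
      then show ?thesis by (simp add: K_def)
    qed
    have "(norm (l1 - l))\<^sup>2 \<le> (\<kappa> / \<eta>_val * Y + \<kappa> / \<eta>_val * Z + A3 * (e + L_M * X + g))\<^sup>2"
      using dl unfolding X_def Y_def Z_def A3_def e_def g_def kernel_err_def by (intro power_mono) auto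
    also have "\<dots> \<le> 3 * ((\<kappa> / \<eta>_val * Y)\<^sup>2 + (\<kappa> / \<eta>_val * Z)\<^sup>2 + (A3 * (e + L_M * X + g))\<^sup>2)"
      by (rule square_sum3)
    also have "(A3 * (e + L_M * X + g))\<^sup>2 \<le> A3\<^sup>2 * (3 * (e\<^sup>2 + (L_M * X)\<^sup>2 + g\<^sup>2))"
      unfolding power_mult_distrib[of A3] by (intro mult_left_mono square_sum3) simp
    finally have "(norm (l1 - l))\<^sup>2 \<le> 3 * ((\<kappa> / \<eta>_val * Y)\<^sup>2 + (\<kappa> / \<eta>_val * Z)\<^sup>2 + A3\<^sup>2 * (3 * (e\<^sup>2 + (L_M * X)\<^sup>2 + g\<^sup>2)))"
      by simp
    then have "(norm (l1 - l))\<^sup>2 / \<beta> \<le> 3 * ((\<kappa> / \<eta>_val * Y)\<^sup>2 + (\<kappa> / \<eta>_val * Z)\<^sup>2 + A3\<^sup>2 * (3 * (e\<^sup>2 + (L_M * X)\<^sup>2 + g\<^sup>2))) / \<beta>"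
      using \<beta>_pos by (intro divide_right_mono) auto
    also have "\<dots> = 3 * (\<kappa> / \<beta> * (\<kappa> / \<eta>_val)) * (1 / \<eta>_val * (Y\<^sup>2 + Z\<^sup>2)) + 9 * (A3\<^sup>2 * L_M\<^sup>2) / \<beta> * X\<^sup>2 + C' * (e\<^sup>2 + g\<^sup>2)"
      using \<beta>_pos step_sizes by (simp add: C'_def power_mult_distrib power_divide field_simps power2_eq_square)
    \<comment> \<open>Both margins on \<beta> are spent here: 3/60 = 1/20 on the value increments
      and 9/30 = 3/10 on the policy increment.\<close>
    also have "\<dots> \<le> 3 * (1 / 60) * (1 / \<eta>_val * (Y\<^sup>2 + Z\<^sup>2)) + 3 / (10 * \<eta>_pol) * X\<^sup>2 + C' * K"
    proof (intro add_mono mult_left_mono mult_right_mono \<kappa>_\<beta>_\<eta> eg C')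
      have "30 * \<eta>_pol * (A3\<^sup>2 * L_M\<^sup>2) \<le> \<beta>"
        using \<beta>_bounds(2) by (simp add: A3_def power_mult_distrib power2_eq_square power4_eq_xxxx mult_ac)
      then show "9 * (A3\<^sup>2 * L_M\<^sup>2) / \<beta> \<le> 3 / (10 * \<eta>_pol)"
        using \<beta>_pos step_sizes by (simp add: divide_le_eq le_divide_eq)
    qed (use step_sizes in auto)
    finally have dl2: "(norm (l1 - l))\<^sup>2 / \<beta> \<le> 1 / 20 * (1 / \<eta>_val * Y\<^sup>2) + 1 / 20 * (1 / \<eta>_val * Z\<^sup>2)
        + 3 / 10 * (1 / \<eta>_pol * X\<^sup>2) + C' * K"
      by (simp add: algebra_simps)
    have dX: "\<delta> * X\<^sup>2 \<le> 1 / 10 * (1 / \<eta>_pol * X\<^sup>2)"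
      using mult_right_mono[OF \<delta>(2), of "X\<^sup>2"] by simp
    have dYZ: "\<delta> * W\<^sup>2 \<le> 1 / 40 * (1 / \<eta>_val * W\<^sup>2)" for W
      using mult_right_mono[OF \<delta>(3), of "W\<^sup>2"] by simp
    have b: "(lag P r \<pi>' v1 l1 - lag p q \<pi>' v1 l1) - (lag P r \<pi> v l - lag p q \<pi> v l)
        \<le> \<delta> * X\<^sup>2 + \<delta> * Y\<^sup>2 + \<delta> * Z\<^sup>2 + C * K"
      using bias unfolding X_def Y_def Z_def K_def g_def by (simp add: distrib_left)
    have e1: "1 / (2 * \<eta>_pol) * X\<^sup>2 = 1 / 2 * (1 / \<eta>_pol * X\<^sup>2)" "1 / (8 * \<eta>_val) * W\<^sup>2 = 1 / 8 * (1 / \<eta>_val * W\<^sup>2)"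
      "rate_pol * X\<^sup>2 = 1 / 10 * (1 / \<eta>_pol * X\<^sup>2)" "rate_val * W\<^sup>2 = 4 / 5 * (1 / \<eta>_val * W\<^sup>2)" "rate_prev * W\<^sup>2 = 1 / 20 * (1 / \<eta>_val * W\<^sup>2)" for W
      by (auto simp: rate_pol_def rate_val_def rate_prev_def)
    have p: "f1 + lag p q \<pi>' v l + 1 / (2 * \<eta>_pol) * X\<^sup>2 \<le> f + lag p q \<pi> v l" using pstep by (simp only: X_def)
    have vs: "lag p q \<pi>' v1 l + 1 / \<eta>_val * Y\<^sup>2 \<le> lag p q \<pi>' v l" using vstep(2) by (simp only: Y_def)
    have nnX: "0 \<le> 1 / \<eta>_pol * X\<^sup>2" and nnW: "0 \<le> 1 / \<eta>_val * W\<^sup>2" for W using step_sizes by auto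
    have "f1 + lag P r \<pi>' v1 l1 + 1 / (8 * \<eta>_val) * Y\<^sup>2 + rate_pol * X\<^sup>2 + rate_val * Y\<^sup>2 + rate_prev * Z\<^sup>2
      \<le> f + lag P r \<pi> v l + 1 / (8 * \<eta>_val) * Z\<^sup>2 + (C * K + C' * K)"
      using p vs mstep dl2 b dX dYZ[of Y] dYZ[of Z] nnX nnW[of Y] nnW[of Z] unfolding e1 by linarith
    then show "f1 + lag P r \<pi>' v1 l1 + 1 / (8 * \<eta>_val) * (norm (v1 - v))\<^sup>2
        + rate_pol * (norm (\<pi>' - \<pi>))\<^sup>2 + rate_val * (norm (v1 - v))\<^sup>2 + rate_prev * (norm (v - v0))\<^sup>2
      \<le> f + lag P r \<pi> v l + 1 / (8 * \<eta>_val) * (norm (v - v0))\<^sup>2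
        + (C + C') * (model_err p q * (1 + norm v ^ 4 + norm v0 ^ 4) + (kernel_err p0')\<^sup>2)"
      unfolding X_def Y_def Z_def K_def g_def by (simp add: distrib_right)
  qed
  then show ?thesis ..
qed

end

section \<open>Visit counts and ratio averages\<close>

text \<open>One term of the exponential series; used with n = 1 and n = 4.\<close>

lemma exp_neg_le_power:
  fixes x :: real
  assumes "0 < x"
  shows "exp (- x) \<le> fact n / x ^ n"
proof -
  have "x ^ n / fact n \<le> exp x"
  proof -
    have s: "(\<lambda>k. x ^ k /\<^sub>R fact k) sums exp x"
      by (rule exp_converges)
    have "(\<Sum>k\<in>{n}. x ^ k /\<^sub>R fact k) \<le> exp x"
      using assms by (subst sums_unique[OF s], intro sum_le_suminf sums_summable[OF s]) auto
    then show ?thesis by (simp add: field_simps)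
  qed
  then show ?thesis
    using assms by (simp add: exp_minus field_simps)
qed

section \<open>Exponential estimates for the number of visits\<close>

lemma subalgebra_trans: "subalgebra A B \<Longrightarrow> subalgebra B C \<Longrightarrow> subalgebra A C"
  by (auto simp: subalgebra_def)

text \<open>Conditional lower bounds are expressed by nonnegative test functions in
  \<open>ennreal\<close>, which avoids integrability questions and versions of conditional
  expectations. The assumption \<open>visit\<close> looks two steps ahead: the history at the start
  of step \<open>t\<close> bounds the chance of a visit at step \<open>t + 1\<close>.\<close>

locale visit_process = prob_space M for M :: "'w measure" +
  fixes m :: nat and H G :: "nat \<Rightarrow> 'w measure" and I :: "nat \<Rightarrow> 'w \<Rightarrow> real" and p :: real
  assumes H_sub: "\<And>t. t \<le> m \<Longrightarrow> subalgebra M (H t)"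
    and H_G: "\<And>t. t < m \<Longrightarrow> subalgebra (G t) (H t)"
    and G_H: "\<And>t. t < m \<Longrightarrow> subalgebra (H (Suc t)) (G t)"
    and I_meas: "\<And>t. t < m \<Longrightarrow> I t \<in> borel_measurable (G t)"
    and I_01: "\<And>t \<omega>. I t \<omega> \<in> {0, 1}"
    and p_pos: "0 < p" and p_le: "p \<le> 1"
    and m_pos: "1 \<le> m"
    and visit: "\<And>t W. Suc t < m \<Longrightarrow> W \<in> borel_measurable (H t) \<Longrightarrow>
        ennreal p * (\<integral>\<^sup>+\<omega>. W \<omega> \<partial>M) \<le> (\<integral>\<^sup>+\<omega>. W \<omega> * ennreal (I (Suc t) \<omega>) \<partial>M)"
begin

lemma I_bounds: "0 \<le> I t \<omega>" "I t \<omega> \<le> 1" "I t \<omega> * I t \<omega> = I t \<omega>"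
  using I_01[of t \<omega>] by auto

lemma H_mono: "s \<le> t \<Longrightarrow> t \<le> m \<Longrightarrow> subalgebra (H t) (H s)"
proof (induction t)
  case 0
  then show ?case by (simp add: subalgebra_def)
next
  case (Suc t)
  show ?case
  proof (cases "s = Suc t")
    case True
    then show ?thesis by (simp add: subalgebra_def)
  next
    case False
    with Suc show ?thesis
      by (meson G_H H_G subalgebra_trans Suc_leD Suc_le_lessD le_SucE)
  qed
qed

lemma I_meas_H: "s < t \<Longrightarrow> t \<le> m \<Longrightarrow> I s \<in> borel_measurable (H t)"
  by (rule measurable_from_subalg[OF _ I_meas])
     (auto intro: subalgebra_trans[OF H_mono[of "Suc s" t] G_H])

lemma I_meas_M: "s < m \<Longrightarrow> I s \<in> borel_measurable M"
  using measurable_from_subalg[OF H_sub I_meas_H] by blast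

text \<open>For an indicator, exp (-I) \<le> 1 - I/2, because exp (-1) \<le> 1/2. Integration gives
  the factor 1 - p/2, which is at most exp (-p/2).\<close>

lemma one_visit:
  assumes t: "Suc t < m" and W: "W \<in> borel_measurable (H t)"
  shows "(\<integral>\<^sup>+\<omega>. W \<omega> * ennreal (exp (- I (Suc t) \<omega>)) \<partial>M) \<le> ennreal (exp (- p / 2)) * (\<integral>\<^sup>+\<omega>. W \<omega> \<partial>M)"
\<comment> \<open>The estimate rearranges an inequality, which in \<open>ennreal\<close> needs a
  finite right-hand side.\<close>
proof (cases "(\<integral>\<^sup>+\<omega>. W \<omega> \<partial>M) = \<infinity>")
  case True
  then show ?thesis by (simp add: ennreal_mult_top)
next
  case False
  have [measurable]: "W \<in> borel_measurable M" "I (Suc t) \<in> borel_measurable M"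
    using measurable_from_subalg[OF H_sub W] t I_meas_M by auto
  let ?x = "\<integral>\<^sup>+\<omega>. W \<omega> * ennreal (exp (- I (Suc t) \<omega>)) \<partial>M"
  let ?y = "\<integral>\<^sup>+\<omega>. W \<omega> * ennreal (I (Suc t) \<omega>) \<partial>M"
  let ?w = "\<integral>\<^sup>+\<omega>. W \<omega> \<partial>M"
  have e: "exp (-1) \<le> (1/2::real)"
    using exp_ge_add_one_self[of 1] by (simp add: exp_minus field_simps)
  have pw: "ennreal (exp (- I (Suc t) \<omega>)) + ennreal (1/2) * ennreal (I (Suc t) \<omega>) \<le> 1" for \<omega>
  proof -
    have "exp (- I (Suc t) \<omega>) + 1/2 * I (Suc t) \<omega> \<le> 1"
      using I_01[of "Suc t" \<omega>] e by auto
    then show ?thesis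
      using I_bounds[of "Suc t" \<omega>]
      by (simp add: ennreal_mult[symmetric] ennreal_plus[symmetric] del: ennreal_half ennreal_plus)
  qed
  have "?x + ennreal (1/2) * ?y
      = (\<integral>\<^sup>+\<omega>. W \<omega> * (ennreal (exp (- I (Suc t) \<omega>)) + ennreal (1/2) * ennreal (I (Suc t) \<omega>)) \<partial>M)"
    by (subst nn_integral_cmult[symmetric], simp, subst nn_integral_add[symmetric])
       (auto intro!: nn_integral_cong simp: algebra_simps)
  also have "\<dots> \<le> ?w"
    by (intro nn_integral_mono) (use mult_left_mono[OF pw] in fastforce)
  finally have 1: "?x + ennreal (1/2) * ?y \<le> ?w" .
  have 2: "ennreal p * ?w \<le> ?y" by (rule visit[OF t W])
  have "?x + 0 \<le> ?x + ennreal (1/2) * ?y" by (rule add_left_mono) simp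
  from order_trans[OF this 1] have "?x \<le> ?w" by simp
  obtain w where w: "?w = ennreal w" "0 \<le> w" using False by (cases ?w) auto
  obtain x where x: "?x = ennreal x" "0 \<le> x" using \<open>?x \<le> ?w\<close> w by (cases ?x) (auto simp: top_unique)
  have "?x + ennreal (1/2) * (ennreal p * ?w) \<le> ?w"
    by (rule order_trans[OF add_left_mono[OF mult_left_mono[OF 2]] 1]) simp
  then have "ennreal (x + 1/2 * (p * w)) \<le> ennreal w"
    using x w p_pos by (simp add: ennreal_mult'[symmetric] ennreal_plus[symmetric] del: ennreal_plus ennreal_half)
  then have "x + 1/2 * (p * w) \<le> w"
    using w by (simp add: ennreal_le_iff)
  then have "x \<le> (1 + (- p / 2)) * w" by (simp add: algebra_simps)
  also have "\<dots> \<le> exp (- p / 2) * w"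
    using exp_ge_add_one_self[of "- p / 2"] w(2) by (rule mult_right_mono)
  finally show ?thesis
    using x w by (simp add: ennreal_mult'[symmetric] ennreal_leI)
qed

text \<open>Only every second step is counted, so that blocks of length two do not overlap. After
  one block the weight times exp (-I) is again a test function, two steps later, and the induction
  runs over all weights.\<close>

lemma many_visits:
  assumes "u + 2 * n \<le> m" and "W \<in> borel_measurable (H u)"
  shows "(\<integral>\<^sup>+\<omega>. W \<omega> * ennreal (exp (- (\<Sum>j<n. I (Suc (u + 2 * j)) \<omega>))) \<partial>M)
      \<le> ennreal (exp (- (real n * p / 2))) * (\<integral>\<^sup>+\<omega>. W \<omega> \<partial>M)"
  using assms
proof (induction n arbitrary: u W)
  case 0
  then show ?case by simp
next
  case (Suc n)
  let ?W = "\<lambda>\<omega>. W \<omega> * ennreal (exp (- I (Suc u) \<omega>))"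
  have [measurable]: "W \<in> borel_measurable (H (u + 2))" "I (Suc u) \<in> borel_measurable (H (u + 2))"
    using Suc.prems by (auto intro!: I_meas_H measurable_from_subalg[OF H_mono Suc.prems(2)])
  have e: "W \<omega> * ennreal (exp (- (\<Sum>j<Suc n. I (Suc (u + 2 * j)) \<omega>)))
      = ?W \<omega> * ennreal (exp (- (\<Sum>j<n. I (Suc ((u + 2) + 2 * j)) \<omega>)))" for \<omega>
    by (simp add: sum.lessThan_Suc_shift exp_add exp_diff exp_minus mult.assoc
        field_simps ennreal_mult'[symmetric] del: sum.lessThan_Suc)
  have "(\<integral>\<^sup>+\<omega>. W \<omega> * ennreal (exp (- (\<Sum>j<Suc n. I (Suc (u + 2 * j)) \<omega>))) \<partial>M)
      \<le> ennreal (exp (- (real n * p / 2))) * (\<integral>\<^sup>+\<omega>. ?W \<omega> \<partial>M)"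
    unfolding e
  proof (rule Suc.IH)
    show "?W \<in> borel_measurable (H (u + 2))" by measurable
  qed (use Suc.prems in auto)
  also have "\<dots> \<le> ennreal (exp (- (real n * p / 2))) * (ennreal (exp (- p / 2)) * (\<integral>\<^sup>+\<omega>. W \<omega> \<partial>M))"
    by (intro mult_left_mono one_visit) (use Suc.prems in auto)
  also have "\<dots> = ennreal (exp (- (real (Suc n) * p / 2))) * (\<integral>\<^sup>+\<omega>. W \<omega> \<partial>M)"
    by (subst mult.assoc[symmetric], subst ennreal_mult'[symmetric]) (auto simp: algebra_simps add_divide_distrib simp flip: exp_add)
  finally show ?case .
qed

definition count :: "'w \<Rightarrow> real" where
  "count \<omega> = (\<Sum>t<m. I t \<omega>)"

lemma block_le_count:
  assumes "u + 2 * n \<le> m"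
  shows "(\<Sum>j<n. I (Suc (u + 2 * j)) \<omega>) \<le> count \<omega>"
proof -
  have "(\<Sum>j<n. I (Suc (u + 2 * j)) \<omega>) = (\<Sum>t\<in>(\<lambda>j. Suc (u + 2 * j)) ` {..<n}. I t \<omega>)"
    by (subst sum.reindex) (auto simp: inj_on_def)
  also have "\<dots> \<le> count \<omega>"
    unfolding count_def using assms by (intro sum_mono2) (auto simp: I_bounds)
  finally show ?thesis .
qed

text \<open>A Chernoff bound at level m p / 16: the integrand is at least the weight wherever the
  blocks contain fewer visits than that. Requiring only \<open>m \<le> 4 * n + 3\<close> allows the
  blocks to fill about half of the batch.\<close>

lemma few_visits:
  assumes "u + 2 * n \<le> m" and n: "m \<le> 4 * n + 3" and "W \<in> borel_measurable (H u)"
  shows "(\<integral>\<^sup>+\<omega>. W \<omega> * ennreal (exp (real m * p / 16 - (\<Sum>j<n. I (Suc (u + 2 * j)) \<omega>))) \<partial>M)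
      \<le> ennreal (2 * exp (- (real m * p / 16))) * (\<integral>\<^sup>+\<omega>. W \<omega> \<partial>M)"
proof -
  have [measurable]: "W \<in> borel_measurable M" "(\<lambda>\<omega>. \<Sum>j<n. I (Suc (u + 2 * j)) \<omega>) \<in> borel_measurable M"
    using assms measurable_from_subalg[OF H_sub assms(3)]
    by (auto intro!: I_meas_M borel_measurable_sum)
  have "(\<integral>\<^sup>+\<omega>. W \<omega> * ennreal (exp (real m * p / 16 - (\<Sum>j<n. I (Suc (u + 2 * j)) \<omega>))) \<partial>M)
    = (\<integral>\<^sup>+\<omega>. ennreal (exp (real m * p / 16)) * (W \<omega> * ennreal (exp (- (\<Sum>j<n. I (Suc (u + 2 * j)) \<omega>)))) \<partial>M)"
    by (intro nn_integral_cong, subst mult.left_commute, subst ennreal_mult'[symmetric])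
       (auto simp flip: exp_add)
  also have "\<dots> = ennreal (exp (real m * p / 16)) *
      (\<integral>\<^sup>+\<omega>. W \<omega> * ennreal (exp (- (\<Sum>j<n. I (Suc (u + 2 * j)) \<omega>))) \<partial>M)"
    by (subst nn_integral_cmult) auto
  also have "\<dots> \<le> ennreal (exp (real m * p / 16)) *
      (ennreal (exp (- (real n * p / 2))) * (\<integral>\<^sup>+\<omega>. W \<omega> \<partial>M))"
    by (intro mult_left_mono many_visits assms) auto
  also have "\<dots> = ennreal (exp (real m * p / 16 - real n * p / 2)) * (\<integral>\<^sup>+\<omega>. W \<omega> \<partial>M)"
    by (subst mult.assoc[symmetric], subst ennreal_mult'[symmetric]) (auto simp flip: exp_add)
  also have "\<dots> \<le> ennreal (2 * exp (- (real m * p / 16))) * (\<integral>\<^sup>+\<omega>. W \<omega> \<partial>M)"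
  proof (intro mult_right_mono ennreal_leI)
    \<comment> \<open>Rounding costs 3p/8 \<le> 1/2 in the exponent, and exp (1/2) \<le> 2.\<close>
    have "real m \<le> 4 * real n + 3" using n by linarith
    then have "p * real m \<le> p * (4 * real n + 3)"
      using p_pos by (intro mult_left_mono) auto
    then have "real m * p / 16 - real n * p / 2 \<le> 1/2 + - (real m * p / 16)"
      using p_le by (simp add: algebra_simps)
    then have "exp (real m * p / 16 - real n * p / 2) \<le> exp (1/2) * exp (- (real m * p / 16))"
      by (simp flip: exp_add)
    also have "exp (1/2) \<le> (2::real)"
      using exp_bound_half[of "1/2::real"] by simp
    finally show "exp (real m * p / 16 - real n * p / 2) \<le> 2 * exp (- (real m * p / 16))"
      by simp
  qed auto
  finally show ?thesis .
qed

text \<open>With a = m p / 16, the inverse count is at most 1/a where the count reaches a, and at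
  most 1 \<le> exp (a - count) elsewhere. Since exp (-a) \<le> 1/a, the total is 3/a = 48/(p
  m).\<close>

lemma inverse_visits:
  assumes "u + 2 * n \<le> m" and n: "m \<le> 4 * n + 3" and W: "W \<in> borel_measurable (H u)"
  shows "(\<integral>\<^sup>+\<omega>. W \<omega> * ennreal (1 / max 1 (\<Sum>j<n. I (Suc (u + 2 * j)) \<omega>)) \<partial>M)
      \<le> ennreal (48 / (p * real m)) * (\<integral>\<^sup>+\<omega>. W \<omega> \<partial>M)"
proof -
  have [measurable]: "W \<in> borel_measurable M" "(\<lambda>\<omega>. \<Sum>j<n. I (Suc (u + 2 * j)) \<omega>) \<in> borel_measurable M"
    using assms measurable_from_subalg[OF H_sub assms(3)]
    by (auto intro!: I_meas_M borel_measurable_sum)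
  let ?N = "\<lambda>\<omega>. \<Sum>j<n. I (Suc (u + 2 * j)) \<omega>"
  define a where "a = real m * p / 16"
  have a: "0 < a" using m_pos p_pos by (simp add: a_def)
  have pw: "1 / max 1 x \<le> 1 / a + exp (a - x)" for x :: real
  proof (cases "a \<le> x")
    case True
    then have "1 / max 1 x \<le> 1 / a" using a by (intro divide_left_mono) auto
    then show ?thesis by (simp add: add_increasing2)
  next
    case False
    then have "1 \<le> exp (a - x)" by simp
    moreover have "1 / max 1 x \<le> 1" by simp
    moreover have "0 \<le> 1 / a" using a by simp
    ultimately show ?thesis by linarith
  qed
  have "(\<integral>\<^sup>+\<omega>. W \<omega> * ennreal (1 / max 1 (?N \<omega>)) \<partial>M)
      \<le> (\<integral>\<^sup>+\<omega>. ennreal (1 / a) * W \<omega> + W \<omega> * ennreal (exp (a - ?N \<omega>)) \<partial>M)"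
  proof (intro nn_integral_mono)
    fix \<omega>
    have "W \<omega> * ennreal (1 / max 1 (?N \<omega>)) \<le> W \<omega> * ennreal (1 / a + exp (a - ?N \<omega>))"
      by (intro mult_left_mono ennreal_leI pw) auto
    also have "\<dots> = ennreal (1 / a) * W \<omega> + W \<omega> * ennreal (exp (a - ?N \<omega>))"
      using a by (simp add: ennreal_plus algebra_simps)
    finally show "W \<omega> * ennreal (1 / max 1 (?N \<omega>)) \<le> \<dots>" .
  qed
  also have "\<dots> = ennreal (1 / a) * (\<integral>\<^sup>+\<omega>. W \<omega> \<partial>M) + (\<integral>\<^sup>+\<omega>. W \<omega> * ennreal (exp (a - ?N \<omega>)) \<partial>M)"
    by (subst nn_integral_add) (auto simp: nn_integral_cmult)
  also have "\<dots> \<le> ennreal (1 / a) * (\<integral>\<^sup>+\<omega>. W \<omega> \<partial>M) + ennreal (2 * exp (- a)) * (\<integral>\<^sup>+\<omega>. W \<omega> \<partial>M)"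
    unfolding a_def by (intro add_left_mono few_visits assms)
  also have "\<dots> = ennreal (1 / a + 2 * exp (- a)) * (\<integral>\<^sup>+\<omega>. W \<omega> \<partial>M)"
    using a by (simp add: ennreal_plus algebra_simps)
  also have "\<dots> \<le> ennreal (48 / (p * real m)) * (\<integral>\<^sup>+\<omega>. W \<omega> \<partial>M)"
  proof (intro mult_right_mono ennreal_leI)
    have "exp (- a) \<le> 1 / a" using exp_neg_le_power[OF a, of 1] by simp
    then have "1 / a + 2 * exp (- a) \<le> 3 / a" by (simp add: field_simps)
    also have "\<dots> = 48 / (p * real m)" by (simp add: a_def field_simps)
    finally show "1 / a + 2 * exp (- a) \<le> 48 / (p * real m)" .
  qed auto
  finally show ?thesis .
qed

end

text \<open>The noise appears only multiplied by the visit indicator, since transition noise is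
  measured against the row of one fixed pair and is centred only when that pair is visited. Both
  moment assumptions are conditional on \<open>G t\<close>, tested by weights.\<close>

locale noisy_visits = visit_process M m H G I p
  for M :: "'w measure" and m H G I p +
  fixes \<xi> :: "nat \<Rightarrow> 'w \<Rightarrow> real" and B :: real
  assumes \<xi>_meas: "\<And>t. t < m \<Longrightarrow> \<xi> t \<in> borel_measurable (H (Suc t))"
    and centred: "\<And>t X. t < m \<Longrightarrow> X \<in> borel_measurable (G t) \<Longrightarrow> integrable M X \<Longrightarrow>
        integrable M (\<lambda>\<omega>. X \<omega> * (I t \<omega> * \<xi> t \<omega>)) \<Longrightarrow> (\<integral>\<omega>. X \<omega> * (I t \<omega> * \<xi> t \<omega>) \<partial>M) = 0"
    and fourth_moment: "\<And>t X. t < m \<Longrightarrow> X \<in> borel_measurable (G t) \<Longrightarrow>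
        (\<integral>\<^sup>+\<omega>. X \<omega> * ennreal (I t \<omega> * \<xi> t \<omega> ^ 4) \<partial>M) \<le> ennreal B * (\<integral>\<^sup>+\<omega>. X \<omega> \<partial>M)"
    and B_ge: "1 \<le> B"
begin

lemma \<xi>_meas_M: "t < m \<Longrightarrow> \<xi> t \<in> borel_measurable M"
  using measurable_from_subalg[OF H_sub \<xi>_meas] by auto

definition visit_sum :: "nat \<Rightarrow> 'w \<Rightarrow> real" where
  "visit_sum n \<omega> = (\<Sum>t<n. I t \<omega> * \<xi> t \<omega>)"

text \<open>The self-normalised average that represents the error of one empirical entry;
  \<open>d\<close> is the error of the value that fills an unvisited entry.\<close>

definition visit_avg :: "real \<Rightarrow> 'w \<Rightarrow> real" where
  "visit_avg d \<omega> = (if count \<omega> = 0 then d else visit_sum m \<omega> / count \<omega>)"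

lemma count_meas [measurable]: "count \<in> borel_measurable M"
  unfolding count_def by (auto intro!: borel_measurable_sum I_meas_M)

lemma visit_sum_meas: "n \<le> m \<Longrightarrow> visit_sum n \<in> borel_measurable M"
  unfolding visit_sum_def
  by (auto intro!: borel_measurable_sum borel_measurable_times I_meas_M \<xi>_meas_M)

lemma visit_avg_meas [measurable]: "visit_avg d \<in> borel_measurable M"
proof -
  note [measurable] = visit_sum_meas[OF order_refl]
  show ?thesis unfolding visit_avg_def by measurable
qed

lemma visit_sum_meas_H: "n \<le> m \<Longrightarrow> visit_sum n \<in> borel_measurable (H n)"
  unfolding visit_sum_def
  by (auto intro!: borel_measurable_sum borel_measurable_times I_meas_H
      intro: measurable_from_subalg[OF H_mono \<xi>_meas])

text \<open>From 2 x^2 \<le> 1 + x^4 the conditional second moment is at most (1 + B)/2, and this is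
  at most \<open>B\<close> because \<open>1 \<le> B\<close>.\<close>

lemma second_moment_term:
  assumes t: "t < m" and W: "W \<in> borel_measurable (G t)" "\<And>\<omega>. 0 \<le> W \<omega>" "\<And>\<omega>. W \<omega> \<le> b"
  shows "integrable M (\<lambda>\<omega>. W \<omega> * (I t \<omega> * \<xi> t \<omega>)\<^sup>2)"
    and "(\<integral>\<omega>. W \<omega> * (I t \<omega> * \<xi> t \<omega>)\<^sup>2 \<partial>M) \<le> B * (\<integral>\<omega>. W \<omega> \<partial>M)"
proof -
  have GM: "subalgebra M (G t)"
    using H_sub[of "Suc t"] G_H[OF t] t by (auto intro: subalgebra_trans)
  have [measurable]: "W \<in> borel_measurable M" "I t \<in> borel_measurable M" "\<xi> t \<in> borel_measurable M"
    using measurable_from_subalg[OF GM W(1)] I_meas_M[OF t] \<xi>_meas_M[OF t] by auto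
  have intW: "integrable M W"
    by (rule integrable_const_bound[of _ b]) (use W in auto)
  have pw: "W \<omega> * (I t \<omega> * \<xi> t \<omega>)\<^sup>2 \<le> 1/2 * W \<omega> + 1/2 * (W \<omega> * (I t \<omega> * \<xi> t \<omega> ^ 4))" for \<omega>
  proof -
    have "2 * \<xi> t \<omega> ^ 2 \<le> 1 + \<xi> t \<omega> ^ 4"
      using zero_le_power2[of "\<xi> t \<omega> ^ 2 - 1"] by (simp add: power2_eq_square power4_eq_xxxx algebra_simps)
    then have "(I t \<omega> * \<xi> t \<omega>)\<^sup>2 \<le> 1/2 + 1/2 * (I t \<omega> * \<xi> t \<omega> ^ 4)"
      using I_01[of t \<omega>] by auto
    from mult_left_mono[OF this W(2)] show ?thesis by (simp add: algebra_simps)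
  qed
  have "(\<integral>\<^sup>+\<omega>. ennreal (W \<omega> * (I t \<omega> * \<xi> t \<omega>)\<^sup>2) \<partial>M)
      \<le> (\<integral>\<^sup>+\<omega>. ennreal (1/2) * ennreal (W \<omega>) + ennreal (1/2) * (ennreal (W \<omega>) * ennreal (I t \<omega> * \<xi> t \<omega> ^ 4)) \<partial>M)"
  proof (rule nn_integral_mono)
    fix \<omega>
    have "ennreal (W \<omega> * (I t \<omega> * \<xi> t \<omega>)\<^sup>2) \<le> ennreal (1/2 * W \<omega> + 1/2 * (W \<omega> * (I t \<omega> * \<xi> t \<omega> ^ 4)))"
      by (rule ennreal_leI[OF pw])
    also have "\<dots> = ennreal (1/2 * W \<omega>) + ennreal (1/2 * (W \<omega> * (I t \<omega> * \<xi> t \<omega> ^ 4)))"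
      using W(2) I_bounds by (intro ennreal_plus) auto
    also have "\<dots> = ennreal (1/2) * ennreal (W \<omega>) + ennreal (1/2) * (ennreal (W \<omega>) * ennreal (I t \<omega> * \<xi> t \<omega> ^ 4))"
      using W(2) I_bounds by (simp only: ennreal_mult' zero_le_divide_1_iff zero_le_numeral)
    finally show "ennreal (W \<omega> * (I t \<omega> * \<xi> t \<omega>)\<^sup>2) \<le> \<dots>" .
  qed
  also have "\<dots> = ennreal (1/2) * (\<integral>\<^sup>+\<omega>. W \<omega> \<partial>M) + ennreal (1/2) * (\<integral>\<^sup>+\<omega>. W \<omega> * ennreal (I t \<omega> * \<xi> t \<omega> ^ 4) \<partial>M)"
    by (simp add: nn_integral_add nn_integral_cmult)
  also have "\<dots> \<le> ennreal (1/2) * (\<integral>\<^sup>+\<omega>. W \<omega> \<partial>M) + ennreal (1/2) * (ennreal B * (\<integral>\<^sup>+\<omega>. W \<omega> \<partial>M))"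
    by (intro add_left_mono mult_left_mono fourth_moment t) (use W in auto)
  also have "(\<integral>\<^sup>+\<omega>. W \<omega> \<partial>M) = ennreal (\<integral>\<omega>. W \<omega> \<partial>M)"
    by (rule nn_integral_eq_integral[OF intW]) (use W in auto)
  also have "ennreal (1/2) * ennreal (\<integral>\<omega>. W \<omega> \<partial>M) + ennreal (1/2) * (ennreal B * ennreal (\<integral>\<omega>. W \<omega> \<partial>M))
      = ennreal (1/2 * (\<integral>\<omega>. W \<omega> \<partial>M) + 1/2 * (B * (\<integral>\<omega>. W \<omega> \<partial>M)))"
    using W(2) B_ge by (subst ennreal_plus) (auto simp: ennreal_mult'[symmetric] simp del: ennreal_half)
  also have "\<dots> \<le> ennreal (B * (\<integral>\<omega>. W \<omega> \<partial>M))"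
  proof (rule ennreal_leI)
    have "1 * (\<integral>\<omega>. W \<omega> \<partial>M) \<le> B * (\<integral>\<omega>. W \<omega> \<partial>M)"
      using W(2) B_ge by (intro mult_right_mono) auto
    then show "1/2 * (\<integral>\<omega>. W \<omega> \<partial>M) + 1/2 * (B * (\<integral>\<omega>. W \<omega> \<partial>M)) \<le> B * (\<integral>\<omega>. W \<omega> \<partial>M)" by simp
  qed
  finally have le: "(\<integral>\<^sup>+\<omega>. ennreal (W \<omega> * (I t \<omega> * \<xi> t \<omega>)\<^sup>2) \<partial>M) \<le> ennreal (B * (\<integral>\<omega>. W \<omega> \<partial>M))" .
  show int: "integrable M (\<lambda>\<omega>. W \<omega> * (I t \<omega> * \<xi> t \<omega>)\<^sup>2)"
    by (rule integrableI_nonneg) (use le W(2) in \<open>auto intro: le_less_trans\<close>)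
  show "(\<integral>\<omega>. W \<omega> * (I t \<omega> * \<xi> t \<omega>)\<^sup>2 \<partial>M) \<le> B * (\<integral>\<omega>. W \<omega> \<partial>M)"
    using le W(2) B_ge by (subst (asm) nn_integral_eq_integral[OF int]) (auto simp: ennreal_le_iff)
qed

lemma visit_sum_square_integrable: "n \<le> m \<Longrightarrow> integrable M (\<lambda>\<omega>. (visit_sum n \<omega>)\<^sup>2)"
proof (induction n)
  case 0
  then show ?case by (simp add: visit_sum_def)
next
  case (Suc n)
  have 1: "integrable M (\<lambda>\<omega>. (I n \<omega> * \<xi> n \<omega>)\<^sup>2)"
    using second_moment_term(1)[of n "\<lambda>_. 1" 1] Suc.prems by simp
  have 2: "integrable M (\<lambda>\<omega>. (visit_sum n \<omega>)\<^sup>2)" using Suc by simp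
  show ?case
  proof (rule Bochner_Integration.integrable_bound)
    show "integrable M (\<lambda>\<omega>. 2 * (visit_sum n \<omega>)\<^sup>2 + 2 * (I n \<omega> * \<xi> n \<omega>)\<^sup>2)" using 1 2 by simp
    show "(\<lambda>\<omega>. (visit_sum (Suc n) \<omega>)\<^sup>2) \<in> borel_measurable M"
      using visit_sum_meas[OF Suc.prems] by measurable
    have "(x + y)\<^sup>2 \<le> 2 * x\<^sup>2 + 2 * y\<^sup>2" for x y :: real
      using zero_le_power2[of "x - y"] by (simp add: power2_eq_square algebra_simps)
    then show "AE \<omega> in M. norm ((visit_sum (Suc n) \<omega>)\<^sup>2) \<le> norm (2 * (visit_sum n \<omega>)\<^sup>2 + 2 * (I n \<omega> * \<xi> n \<omega>)\<^sup>2)"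
      by (simp add: visit_sum_def)
  qed
qed

text \<open>Orthogonality of martingale increments: a weight known at the start of the batch times
  the partial sum is \<open>G n\<close>-measurable, so the cross term vanishes by
  \<open>centred\<close>. The bound on \<open>W\<close> makes these products integrable.\<close>

lemma visit_sum_second_moment:
  assumes W: "W \<in> borel_measurable (H 0)" "\<And>\<omega>. 0 \<le> W \<omega>" "\<And>\<omega>. W \<omega> \<le> b"
  shows "n \<le> m \<Longrightarrow> integrable M (\<lambda>\<omega>. W \<omega> * (visit_sum n \<omega>)\<^sup>2) \<and>
      (\<integral>\<omega>. W \<omega> * (visit_sum n \<omega>)\<^sup>2 \<partial>M) \<le> real n * B * (\<integral>\<omega>. W \<omega> \<partial>M)"
proof (induction n)
  case 0
  then show ?case by (simp add: visit_sum_def)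
next
  case (Suc n)
  then have n: "n < m" by simp
  have HM: "subalgebra M (H 0)" using H_sub by simp
  have HG: "subalgebra (G n) (H n)" "subalgebra (G n) (H 0)"
    using H_G[OF n] H_mono[of 0 n] n by (auto intro: subalgebra_trans)
  have WG [measurable]: "W \<in> borel_measurable (G n)" by (rule measurable_from_subalg[OF HG(2) W(1)])
  have [measurable]: "W \<in> borel_measurable M" by (rule measurable_from_subalg[OF HM W(1)])
  have ZG [measurable]: "visit_sum n \<in> borel_measurable (G n)"
    using measurable_from_subalg[OF HG(1) visit_sum_meas_H] n by simp
  have [measurable]: "visit_sum n \<in> borel_measurable M" "I n \<in> borel_measurable M" "\<xi> n \<in> borel_measurable M"
    using visit_sum_meas I_meas_M \<xi>_meas_M n by auto
  define Z where "Z = visit_sum n"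
  define e where "e \<omega> = I n \<omega> * \<xi> n \<omega>" for \<omega>
  have [measurable]: "Z \<in> borel_measurable M" "e \<in> borel_measurable M"
    unfolding Z_def e_def by measurable
  have intZ: "integrable M (\<lambda>\<omega>. (Z \<omega>)\<^sup>2)"
    unfolding Z_def using visit_sum_square_integrable n by simp
  have inte: "integrable M (\<lambda>\<omega>. (e \<omega>)\<^sup>2)"
    unfolding e_def using second_moment_term(1)[of n "\<lambda>_. 1" 1] n by simp
  have b: "0 \<le> b" using W(2,3) order_trans by blast
  have xy: "2 * (\<bar>x\<bar> * \<bar>y\<bar>) \<le> x\<^sup>2 + y\<^sup>2" for x y :: real
    using zero_le_power2[of "\<bar>x\<bar> - \<bar>y\<bar>"] by (simp add: power2_eq_square algebra_simps)
  have intWZ: "integrable M (\<lambda>\<omega>. W \<omega> * Z \<omega>)"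
  proof (rule Bochner_Integration.integrable_bound)
    show "integrable M (\<lambda>\<omega>. b * (1 + (Z \<omega>)\<^sup>2))" using intZ by simp
    show "AE \<omega> in M. norm (W \<omega> * Z \<omega>) \<le> norm (b * (1 + (Z \<omega>)\<^sup>2))"
    proof (rule AE_I2)
      fix \<omega>
      have "\<bar>Z \<omega>\<bar> \<le> 1 + (Z \<omega>)\<^sup>2" using xy[of 1 "Z \<omega>"] zero_le_power2[of "Z \<omega>"] by simp
      then show "norm (W \<omega> * Z \<omega>) \<le> norm (b * (1 + (Z \<omega>)\<^sup>2))"
        using W(2,3)[of \<omega>] b by (simp add: abs_mult mult_mono)
    qed
  qed measurable
  have intWZe: "integrable M (\<lambda>\<omega>. W \<omega> * Z \<omega> * e \<omega>)"
  proof (rule Bochner_Integration.integrable_bound)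
    show "integrable M (\<lambda>\<omega>. b * ((Z \<omega>)\<^sup>2 + (e \<omega>)\<^sup>2))" using intZ inte by simp
    show "AE \<omega> in M. norm (W \<omega> * Z \<omega> * e \<omega>) \<le> norm (b * ((Z \<omega>)\<^sup>2 + (e \<omega>)\<^sup>2))"
    proof (rule AE_I2)
      fix \<omega>
      have "\<bar>Z \<omega>\<bar> * \<bar>e \<omega>\<bar> \<le> (Z \<omega>)\<^sup>2 + (e \<omega>)\<^sup>2"
        using xy[of "Z \<omega>" "e \<omega>"] zero_le_power2[of "Z \<omega>"] zero_le_power2[of "e \<omega>"] by linarith
      then show "norm (W \<omega> * Z \<omega> * e \<omega>) \<le> norm (b * ((Z \<omega>)\<^sup>2 + (e \<omega>)\<^sup>2))"
        using W(2,3)[of \<omega>] b by (simp add: abs_mult mult_mono mult.assoc)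
    qed
  qed measurable
  have zero: "(\<integral>\<omega>. W \<omega> * Z \<omega> * e \<omega> \<partial>M) = 0"
    unfolding e_def
    by (rule centred[OF n]) (use intWZ intWZe[unfolded e_def] in \<open>auto simp: Z_def\<close>)
  note m2 = second_moment_term[OF n WG W(2,3), folded e_def]
  have ih: "integrable M (\<lambda>\<omega>. W \<omega> * (Z \<omega>)\<^sup>2)" "(\<integral>\<omega>. W \<omega> * (Z \<omega>)\<^sup>2 \<partial>M) \<le> real n * B * (\<integral>\<omega>. W \<omega> \<partial>M)"
    using Suc unfolding Z_def by auto
  have e: "W \<omega> * (visit_sum (Suc n) \<omega>)\<^sup>2 = W \<omega> * (Z \<omega>)\<^sup>2 + 2 * (W \<omega> * Z \<omega> * e \<omega>) + W \<omega> * (e \<omega>)\<^sup>2" for \<omega>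
    by (simp add: visit_sum_def Z_def e_def power2_eq_square algebra_simps)
  show ?case
  proof
    have i2: "integrable M (\<lambda>\<omega>. 2 * (W \<omega> * Z \<omega> * e \<omega>))" using intWZe by simp
    note i12 = Bochner_Integration.integrable_add[OF ih(1) i2]
    show "integrable M (\<lambda>\<omega>. W \<omega> * (visit_sum (Suc n) \<omega>)\<^sup>2)"
      unfolding e by (rule Bochner_Integration.integrable_add[OF i12 m2(1)])
    have "(\<integral>\<omega>. W \<omega> * (visit_sum (Suc n) \<omega>)\<^sup>2 \<partial>M)
        = (\<integral>\<omega>. W \<omega> * (Z \<omega>)\<^sup>2 \<partial>M) + 2 * (\<integral>\<omega>. W \<omega> * Z \<omega> * e \<omega> \<partial>M) + (\<integral>\<omega>. W \<omega> * (e \<omega>)\<^sup>2 \<partial>M)"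
      unfolding e Bochner_Integration.integral_add[OF i12 m2(1)] Bochner_Integration.integral_add[OF ih(1) i2]
      by simp
    also have "\<dots> \<le> real n * B * (\<integral>\<omega>. W \<omega> \<partial>M) + B * (\<integral>\<omega>. W \<omega> \<partial>M)"
      using ih(2) m2(2) zero by simp
    finally show "(\<integral>\<omega>. W \<omega> * (visit_sum (Suc n) \<omega>)\<^sup>2 \<partial>M) \<le> real (Suc n) * B * (\<integral>\<omega>. W \<omega> \<partial>M)"
      by (simp add: algebra_simps)
  qed
qed

lemma count_cases: "count \<omega> = 0 \<or> 1 \<le> count \<omega>"
proof (cases "\<exists>t<m. I t \<omega> = 1")
  case True
  then obtain t where t: "t < m" "I t \<omega> = 1" by auto
  have "I t \<omega> \<le> count \<omega>"
    unfolding count_def using t by (intro member_le_sum) (auto simp: I_bounds)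
  then show ?thesis using t by simp
next
  case False
  then have "I t \<omega> = 0" if "t < m" for t using I_01[of t \<omega>] that by auto
  then show ?thesis by (simp add: count_def)
qed

lemma visit_sum_square_le: "(visit_sum m \<omega>)\<^sup>2 \<le> count \<omega> * (\<Sum>t<m. I t \<omega> * (\<xi> t \<omega>)\<^sup>2)"
proof -
  have "(\<Sum>t<m. I t \<omega> * (I t \<omega> * \<xi> t \<omega>))\<^sup>2 \<le> (\<Sum>t<m. (I t \<omega>)\<^sup>2) * (\<Sum>t<m. (I t \<omega> * \<xi> t \<omega>)\<^sup>2)"
    by (rule Cauchy_Schwarz_ineq_sum)
  moreover have "I t \<omega> * (I t \<omega> * \<xi> t \<omega>) = I t \<omega> * \<xi> t \<omega>" "(I t \<omega>)\<^sup>2 = I t \<omega>"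
      "(I t \<omega> * \<xi> t \<omega>)\<^sup>2 = I t \<omega> * (\<xi> t \<omega>)\<^sup>2" for t
    using I_01[of t \<omega>] by auto
  ultimately show ?thesis
    by (simp add: visit_sum_def count_def)
qed

text \<open>Cauchy-Schwarz twice over the visited steps, each time paying with the count.\<close>

lemma visit_sum_fourth_le: "(visit_sum m \<omega>) ^ 4 \<le> count \<omega> ^ 3 * (\<Sum>t<m. I t \<omega> * \<xi> t \<omega> ^ 4)"
proof -
  have "(\<Sum>t<m. I t \<omega> * (I t \<omega> * (\<xi> t \<omega>)\<^sup>2))\<^sup>2 \<le> (\<Sum>t<m. (I t \<omega>)\<^sup>2) * (\<Sum>t<m. (I t \<omega> * (\<xi> t \<omega>)\<^sup>2)\<^sup>2)"
    by (rule Cauchy_Schwarz_ineq_sum)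
  moreover have "I t \<omega> * (I t \<omega> * (\<xi> t \<omega>)\<^sup>2) = I t \<omega> * (\<xi> t \<omega>)\<^sup>2" "(I t \<omega>)\<^sup>2 = I t \<omega>"
      "(I t \<omega> * (\<xi> t \<omega>)\<^sup>2)\<^sup>2 = I t \<omega> * \<xi> t \<omega> ^ 4" for t
    using I_01[of t \<omega>] by (auto simp: power2_eq_square power4_eq_xxxx)
  ultimately have 1: "(\<Sum>t<m. I t \<omega> * (\<xi> t \<omega>)\<^sup>2)\<^sup>2 \<le> count \<omega> * (\<Sum>t<m. I t \<omega> * \<xi> t \<omega> ^ 4)"
    by (simp add: count_def)
  have "(visit_sum m \<omega>) ^ 4 = ((visit_sum m \<omega>)\<^sup>2)\<^sup>2" by simp
  also have "\<dots> \<le> (count \<omega> * (\<Sum>t<m. I t \<omega> * (\<xi> t \<omega>)\<^sup>2))\<^sup>2"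
    by (rule power_mono[OF visit_sum_square_le]) simp
  also have "\<dots> \<le> (count \<omega>)\<^sup>2 * (count \<omega> * (\<Sum>t<m. I t \<omega> * \<xi> t \<omega> ^ 4))"
    unfolding power_mult_distrib by (rule mult_left_mono[OF 1]) simp
  finally show ?thesis by (simp add: power2_eq_square power3_eq_cube)
qed

text \<open>Where the count reaches \<open>a\<close>, the deterministic \<open>a\<close> may replace
  it and the numerator keeps its martingale structure. Where it does not, the exponential is at
  least 1 and multiplies a crude deterministic bound. The last term needs no rare event at
  all.\<close>

lemma visit_avg_square_le:
  assumes a: "0 < a" and n: "2 * n \<le> m"
  shows "(visit_avg d \<omega>)\<^sup>2 \<le> (visit_sum m \<omega>)\<^sup>2 / a\<^sup>2
      + exp (a - (\<Sum>j<n. I (Suc (0 + 2 * j)) \<omega>)) * (d\<^sup>2 + real m ^ 3 / 2)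
      + (\<Sum>t<m. I t \<omega> * \<xi> t \<omega> ^ 4) / (2 * (real m)\<^sup>2)" (is "_ \<le> ?A + ?E * ?D + ?F")
proof -
  have nn: "0 \<le> ?A" "0 \<le> ?D" "0 \<le> ?F"
    by (auto intro!: divide_nonneg_nonneg sum_nonneg simp: I_bounds)
  show ?thesis
  proof (cases "a \<le> count \<omega>")
    case True
    then have "(visit_avg d \<omega>)\<^sup>2 = (visit_sum m \<omega>)\<^sup>2 / (count \<omega>)\<^sup>2"
      using a by (simp add: visit_avg_def power_divide)
    also have "\<dots> \<le> ?A"
      using a True by (intro divide_left_mono power_mono) auto
    finally show ?thesis using nn by (simp add: add_increasing2)
  next
    case False
    have m0: "0 < real m" using m_pos by simp
    have "1 \<le> ?E" using block_le_count[of 0 n \<omega>] n False by simp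
    then have D: "?D \<le> ?E * ?D" using nn(2) mult_right_mono[of 1 ?E ?D] by simp
    have "(visit_avg d \<omega>)\<^sup>2 \<le> d\<^sup>2 + (\<Sum>t<m. I t \<omega> * (\<xi> t \<omega>)\<^sup>2)"
    proof (cases "count \<omega> = 0")
      case True
      then show ?thesis by (auto simp: visit_avg_def I_bounds intro!: sum_nonneg)
    next
      case False
      then have 1: "1 \<le> count \<omega>" using count_cases by blast
      have s: "0 \<le> (\<Sum>t<m. I t \<omega> * (\<xi> t \<omega>)\<^sup>2)" by (auto simp: I_bounds intro!: sum_nonneg)
      have "(visit_sum m \<omega>)\<^sup>2 \<le> count \<omega> * (\<Sum>t<m. I t \<omega> * (\<xi> t \<omega>)\<^sup>2)" by (rule visit_sum_square_le)
      also have "\<dots> \<le> (count \<omega>)\<^sup>2 * (\<Sum>t<m. I t \<omega> * (\<xi> t \<omega>)\<^sup>2)"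
        using 1 s self_le_power[of "count \<omega>" 2] by (intro mult_right_mono) auto
      finally have "(visit_avg d \<omega>)\<^sup>2 \<le> (\<Sum>t<m. I t \<omega> * (\<xi> t \<omega>)\<^sup>2)"
        using 1 False by (simp add: visit_avg_def power_divide divide_le_eq mult.commute)
      then show ?thesis by (simp add: add_increasing)
    qed
    \<comment> \<open>The square is split as m^2/2 + x^4/(2 m^2). The noise is correlated with the
      event of few visits, so only the deterministic half is charged to that event; the other half,
      summed over the batch, has mean of order 1/m.\<close>
    also have "(\<Sum>t<m. I t \<omega> * (\<xi> t \<omega>)\<^sup>2) \<le> (\<Sum>t<m. (real m)\<^sup>2 / 2 + I t \<omega> * \<xi> t \<omega> ^ 4 / (2 * (real m)\<^sup>2))"
    proof (rule sum_mono)
      fix t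
      have "0 \<le> (real m - (\<xi> t \<omega>)\<^sup>2 / real m)\<^sup>2" by simp
      then have "2 * (\<xi> t \<omega>)\<^sup>2 \<le> (real m)\<^sup>2 + \<xi> t \<omega> ^ 4 / (real m)\<^sup>2"
        using m0 by (simp add: power2_diff power_divide)
      then have "(\<xi> t \<omega>)\<^sup>2 \<le> (real m)\<^sup>2 / 2 + \<xi> t \<omega> ^ 4 / (2 * (real m)\<^sup>2)" by simp
      then show "I t \<omega> * (\<xi> t \<omega>)\<^sup>2 \<le> (real m)\<^sup>2 / 2 + I t \<omega> * \<xi> t \<omega> ^ 4 / (2 * (real m)\<^sup>2)"
        using I_01[of t \<omega>] by auto
    qed
    also have "(\<Sum>t<m. (real m)\<^sup>2 / 2 + I t \<omega> * \<xi> t \<omega> ^ 4 / (2 * (real m)\<^sup>2)) = real m ^ 3 / 2 + ?F"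
      by (simp add: sum.distrib sum_divide_distrib power2_eq_square power3_eq_cube)
    finally show ?thesis using D nn by linarith
  qed
qed

text \<open>The three constants are m B / a^2 with a = m p / 16, the exponentially small event
  against a bound of order m^3, and the fourth-order remainder.\<close>

lemma visit_avg_second_moment_bounded:
  assumes W: "W \<in> borel_measurable (H 0)" "\<And>\<omega>. 0 \<le> W \<omega>" "\<And>\<omega>. W \<omega> \<le> b"
  shows "(\<integral>\<^sup>+\<omega>. ennreal (W \<omega>) * ennreal ((visit_avg d \<omega>)\<^sup>2) \<partial>M)
    \<le> ennreal ((256 * B / p\<^sup>2 + (d\<^sup>2 + 1) * (48 * 16 ^ 4 / p ^ 4) + B) / real m) * (\<integral>\<^sup>+\<omega>. ennreal (W \<omega>) \<partial>M)"
proof -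
  define n where "n = m div 2"
  have n: "0 + 2 * n \<le> m" "m \<le> 4 * n + 3" by (auto simp: n_def)
  define a where "a = real m * p / 16"
  have m0: "0 < real m" using m_pos by simp
  have a: "0 < a" using m0 p_pos by (simp add: a_def)
  define E where "E \<omega> = exp (a - (\<Sum>j<n. I (Suc (0 + 2 * j)) \<omega>))" for \<omega>
  define D where "D = d\<^sup>2 + real m ^ 3 / 2"
  have D: "0 \<le> D" by (simp add: D_def)
  have HM: "subalgebra M (H 0)" using H_sub by simp
  have HG: "W \<in> borel_measurable (G t)" if "t < m" for t
    using H_G[OF that] H_mono[of 0 t] that by (auto intro: subalgebra_trans measurable_from_subalg[OF _ W(1)])
  have Wm [measurable]: "W \<in> borel_measurable M" by (rule measurable_from_subalg[OF HM W(1)])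
  have [measurable]: "visit_sum m \<in> borel_measurable M" by (rule visit_sum_meas) simp
  have [measurable]: "E \<in> borel_measurable M"
    unfolding E_def using n by (intro borel_measurable_exp[THEN measurable_compose_rev] borel_measurable_diff
      borel_measurable_const borel_measurable_sum I_meas_M) auto
  have Im [measurable]: "(\<lambda>\<omega>. ennreal (I t \<omega> * \<xi> t \<omega> ^ 4)) \<in> borel_measurable M" if "t < m" for t
    using I_meas_M[OF that] \<xi>_meas_M[OF that] by measurable
  let ?w = "\<integral>\<^sup>+\<omega>. ennreal (W \<omega>) \<partial>M"
  have "(\<integral>\<^sup>+\<omega>. ennreal (W \<omega>) * ennreal ((visit_avg d \<omega>)\<^sup>2) \<partial>M)
    \<le> (\<integral>\<^sup>+\<omega>. (ennreal (1 / a\<^sup>2) * ennreal (W \<omega> * (visit_sum m \<omega>)\<^sup>2) + ennreal D * (ennreal (W \<omega>) * ennreal (E \<omega>)))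
        + ennreal (1 / (2 * (real m)\<^sup>2)) * (\<Sum>t<m. ennreal (W \<omega>) * ennreal (I t \<omega> * \<xi> t \<omega> ^ 4)) \<partial>M)"
  proof (rule nn_integral_mono)
    fix \<omega>
    have F: "0 \<le> (\<Sum>t<m. I t \<omega> * \<xi> t \<omega> ^ 4)" by (auto intro!: sum_nonneg simp: I_bounds)
    have "ennreal (W \<omega>) * ennreal ((visit_avg d \<omega>)\<^sup>2) \<le> ennreal (W \<omega>) * ennreal ((visit_sum m \<omega>)\<^sup>2 / a\<^sup>2 + E \<omega> * D
        + (\<Sum>t<m. I t \<omega> * \<xi> t \<omega> ^ 4) / (2 * (real m)\<^sup>2))"
      unfolding E_def D_def using n by (intro mult_left_mono ennreal_leI visit_avg_square_le a) auto
    also have "\<dots> = ennreal (1 / a\<^sup>2 * (W \<omega> * (visit_sum m \<omega>)\<^sup>2) + D * (W \<omega> * E \<omega>)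
        + 1 / (2 * (real m)\<^sup>2) * (W \<omega> * (\<Sum>t<m. I t \<omega> * \<xi> t \<omega> ^ 4)))"
      using W(2)[of \<omega>] by (subst ennreal_mult'[symmetric]) (auto simp: algebra_simps)
    also have "\<dots> = (ennreal (1 / a\<^sup>2 * (W \<omega> * (visit_sum m \<omega>)\<^sup>2)) + ennreal (D * (W \<omega> * E \<omega>)))
        + ennreal (1 / (2 * (real m)\<^sup>2) * (W \<omega> * (\<Sum>t<m. I t \<omega> * \<xi> t \<omega> ^ 4)))"
      using W(2)[of \<omega>] D F by (subst ennreal_plus) (auto simp: E_def intro!: ennreal_plus)
    also have "\<dots> = (ennreal (1 / a\<^sup>2) * ennreal (W \<omega> * (visit_sum m \<omega>)\<^sup>2) + ennreal D * (ennreal (W \<omega>) * ennreal (E \<omega>)))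
        + ennreal (1 / (2 * (real m)\<^sup>2)) * (ennreal (W \<omega>) * ennreal (\<Sum>t<m. I t \<omega> * \<xi> t \<omega> ^ 4))"
      using W(2)[of \<omega>] D by (subst ennreal_mult', simp)+ simp
    also have "ennreal (\<Sum>t<m. I t \<omega> * \<xi> t \<omega> ^ 4) = (\<Sum>t<m. ennreal (I t \<omega> * \<xi> t \<omega> ^ 4))"
      by (rule sum_ennreal[symmetric]) (auto simp: I_bounds)
    finally show "ennreal (W \<omega>) * ennreal ((visit_avg d \<omega>)\<^sup>2)
      \<le> (ennreal (1 / a\<^sup>2) * ennreal (W \<omega> * (visit_sum m \<omega>)\<^sup>2) + ennreal D * (ennreal (W \<omega>) * ennreal (E \<omega>)))
        + ennreal (1 / (2 * (real m)\<^sup>2)) * (\<Sum>t<m. ennreal (W \<omega>) * ennreal (I t \<omega> * \<xi> t \<omega> ^ 4))"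
      by (simp only: sum_distrib_left)
  qed
  also have "\<dots> = (ennreal (1 / a\<^sup>2) * (\<integral>\<^sup>+\<omega>. ennreal (W \<omega> * (visit_sum m \<omega>)\<^sup>2) \<partial>M)
        + ennreal D * (\<integral>\<^sup>+\<omega>. ennreal (W \<omega>) * ennreal (E \<omega>) \<partial>M))
        + ennreal (1 / (2 * (real m)\<^sup>2)) * (\<Sum>t<m. \<integral>\<^sup>+\<omega>. ennreal (W \<omega>) * ennreal (I t \<omega> * \<xi> t \<omega> ^ 4) \<partial>M)"
  proof -
    have "(\<integral>\<^sup>+\<omega>. (\<Sum>t<m. ennreal (W \<omega>) * ennreal (I t \<omega> * \<xi> t \<omega> ^ 4)) \<partial>M)
        = (\<Sum>t<m. \<integral>\<^sup>+\<omega>. ennreal (W \<omega>) * ennreal (I t \<omega> * \<xi> t \<omega> ^ 4) \<partial>M)"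
      using Im by (intro nn_integral_sum) auto
    moreover have "(\<lambda>\<omega>. \<Sum>t<m. ennreal (W \<omega>) * ennreal (I t \<omega> * \<xi> t \<omega> ^ 4)) \<in> borel_measurable M"
      using Im by (intro borel_measurable_sum) auto
    ultimately show ?thesis by (simp add: nn_integral_add nn_integral_cmult)
  qed
  also have "\<dots> \<le> (ennreal (1 / a\<^sup>2) * (ennreal (real m * B) * ?w)
        + ennreal D * (ennreal (2 * exp (- a)) * ?w))
        + ennreal (1 / (2 * (real m)\<^sup>2)) * (\<Sum>t<m. ennreal B * ?w)"
  proof (intro add_mono mult_left_mono sum_mono)
    have iW: "integrable M W"
      by (rule integrable_const_bound[of _ b]) (use W in auto)
    have "(\<integral>\<^sup>+\<omega>. ennreal (W \<omega> * (visit_sum m \<omega>)\<^sup>2) \<partial>M) = ennreal (\<integral>\<omega>. W \<omega> * (visit_sum m \<omega>)\<^sup>2 \<partial>M)"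
      using visit_sum_second_moment[OF W, of m] W(2) by (intro nn_integral_eq_integral) auto
    also have "\<dots> \<le> ennreal (real m * B * (\<integral>\<omega>. W \<omega> \<partial>M))"
      using visit_sum_second_moment[OF W, of m] by (intro ennreal_leI) auto
    also have "\<dots> = ennreal (real m * B) * ?w"
      using W(2) B_ge by (subst nn_integral_eq_integral[OF iW]) (auto simp: ennreal_mult')
    finally show "(\<integral>\<^sup>+\<omega>. ennreal (W \<omega> * (visit_sum m \<omega>)\<^sup>2) \<partial>M) \<le> ennreal (real m * B) * ?w" .
    show "(\<integral>\<^sup>+\<omega>. ennreal (W \<omega>) * ennreal (E \<omega>) \<partial>M) \<le> ennreal (2 * exp (- a)) * ?w"
      unfolding E_def a_def by (rule few_visits[OF n]) (use W in auto)
    show "(\<integral>\<^sup>+\<omega>. ennreal (W \<omega>) * ennreal (I t \<omega> * \<xi> t \<omega> ^ 4) \<partial>M) \<le> ennreal B * ?w" if "t \<in> {..<m}" for t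
      using that HG by (intro fourth_moment) auto
  qed auto
  also have "\<dots> = ennreal (1 / a\<^sup>2 * (real m * B) + D * (2 * exp (- a)) + 1 / (2 * (real m)\<^sup>2) * (real m * B)) * ?w"
  proof -
    have "ennreal (1 / a\<^sup>2 * (real m * B) + D * (2 * exp (- a)) + 1 / (2 * (real m)\<^sup>2) * (real m * B))
       = ennreal (1 / a\<^sup>2) * ennreal (real m * B) + ennreal D * ennreal (2 * exp (- a))
         + ennreal (1 / (2 * (real m)\<^sup>2)) * (ennreal (real m) * ennreal B)"
      using D B_ge by (simp add: ennreal_mult'[symmetric] ennreal_plus[symmetric] del: ennreal_plus)
    then show ?thesis by (simp add: distrib_right mult.assoc ennreal_of_nat_eq_real_of_nat)
  qed
  also have "\<dots> \<le> ennreal ((256 * B / p\<^sup>2 + (d\<^sup>2 + 1) * (48 * 16 ^ 4 / p ^ 4) + B) / real m) * ?w"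
  proof (intro mult_right_mono ennreal_leI)
    have 1: "1 / a\<^sup>2 * (real m * B) = 256 * B / p\<^sup>2 / real m"
      using m0 p_pos by (simp add: a_def power2_eq_square field_simps)
    have 2: "1 / (2 * (real m)\<^sup>2) * (real m * B) \<le> B / real m"
      using m0 B_ge by (simp add: power2_eq_square field_simps)
    have "d\<^sup>2 * 1 \<le> d\<^sup>2 * real m ^ 3" using m_pos by (intro mult_left_mono) (auto simp: one_le_power)
    then have "D \<le> (d\<^sup>2 + 1) * real m ^ 3"
      using zero_le_power[of "real m" 3] m0 unfolding D_def distrib_right by linarith
    \<comment> \<open>The fourth power is the one that beats m^3 and still leaves 1/m; 48 is 2 times
      4!.\<close>
    moreover have "2 * exp (- a) \<le> 48 / a ^ 4" using exp_neg_le_power[OF a, of 4] by (simp add: fact_numeral)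
    ultimately have "D * (2 * exp (- a)) \<le> (d\<^sup>2 + 1) * real m ^ 3 * (48 / a ^ 4)"
      using D by (intro mult_mono) auto
    also have "\<dots> = (d\<^sup>2 + 1) * (48 * 16 ^ 4 / p ^ 4) / real m"
      using m0 p_pos by (simp add: a_def power_mult_distrib power_divide power4_eq_xxxx power3_eq_cube field_simps)
    finally show "1 / a\<^sup>2 * (real m * B) + D * (2 * exp (- a)) + 1 / (2 * (real m)\<^sup>2) * (real m * B)
        \<le> (256 * B / p\<^sup>2 + (d\<^sup>2 + 1) * (48 * 16 ^ 4 / p ^ 4) + B) / real m"
      using 1 2 by (simp add: add_divide_distrib)
  qed auto
  finally show ?thesis .
qed

text \<open>The weights in use are fourth powers of value norms, hence unbounded; truncation and
  monotone convergence remove the bound.\<close>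

lemma visit_avg_second_moment:
  assumes W: "W \<in> borel_measurable (H 0)"
  shows "(\<integral>\<^sup>+\<omega>. ennreal (W \<omega>) * ennreal ((visit_avg d \<omega>)\<^sup>2) \<partial>M)
    \<le> ennreal ((256 * B / p\<^sup>2 + (d\<^sup>2 + 1) * (48 * 16 ^ 4 / p ^ 4) + B) / real m) * (\<integral>\<^sup>+\<omega>. ennreal (W \<omega>) \<partial>M)"
    (is "_ \<le> ?C * _")
proof -
  let ?W = "\<lambda>n \<omega>. max 0 (min (W \<omega>) (real n))"
  have HM: "subalgebra M (H 0)" using H_sub by simp
  have Wm [measurable]: "W \<in> borel_measurable M" by (rule measurable_from_subalg[OF HM W])
  have SUPW: "(SUP n. ennreal (?W n \<omega>)) = ennreal (W \<omega>)" for \<omega>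
  proof (rule antisym)
    show "(SUP n. ennreal (?W n \<omega>)) \<le> ennreal (W \<omega>)"
      by (rule SUP_least) (auto simp: max_def min_def intro: ennreal_leI)
    obtain n where "W \<omega> \<le> real n" using real_arch_simple by blast
    then have "ennreal (W \<omega>) = ennreal (?W n \<omega>)" by (auto simp: max_def ennreal_neg)
    then show "ennreal (W \<omega>) \<le> (SUP n. ennreal (?W n \<omega>))" by (auto intro: SUP_upper2)
  qed
  have inc: "incseq (\<lambda>n \<omega>. ennreal (?W n \<omega>) * ennreal ((visit_avg d \<omega>)\<^sup>2))"
    by (intro monoI le_funI mult_right_mono ennreal_leI) auto
  have "(\<integral>\<^sup>+\<omega>. ennreal (W \<omega>) * ennreal ((visit_avg d \<omega>)\<^sup>2) \<partial>M)
      = (\<integral>\<^sup>+\<omega>. (SUP n. ennreal (?W n \<omega>) * ennreal ((visit_avg d \<omega>)\<^sup>2)) \<partial>M)"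
    by (intro nn_integral_cong, subst SUP_mult_right_ennreal[symmetric]) (simp only: SUPW)
  also have "\<dots> = (SUP n. \<integral>\<^sup>+\<omega>. ennreal (?W n \<omega>) * ennreal ((visit_avg d \<omega>)\<^sup>2) \<partial>M)"
    by (rule nn_integral_monotone_convergence_SUP[OF inc]) measurable
  also have "\<dots> \<le> ?C * (\<integral>\<^sup>+\<omega>. ennreal (W \<omega>) \<partial>M)"
  proof (rule SUP_least)
    fix n
    have "(\<integral>\<^sup>+\<omega>. ennreal (?W n \<omega>) * ennreal ((visit_avg d \<omega>)\<^sup>2) \<partial>M) \<le> ?C * (\<integral>\<^sup>+\<omega>. ennreal (?W n \<omega>) \<partial>M)"
      by (rule visit_avg_second_moment_bounded[of _ "real n"]) (use W in auto)
    also have "\<dots> \<le> ?C * (\<integral>\<^sup>+\<omega>. ennreal (W \<omega>) \<partial>M)"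
      by (intro mult_left_mono nn_integral_mono) (auto simp: max_def min_def intro: ennreal_leI)
    finally show "(\<integral>\<^sup>+\<omega>. ennreal (?W n \<omega>) * ennreal ((visit_avg d \<omega>)\<^sup>2) \<partial>M) \<le> ?C * (\<integral>\<^sup>+\<omega>. ennreal (W \<omega>) \<partial>M)" .
  qed
  finally show ?thesis .
qed

text \<open>
  The number of visits is correlated with the noise of step \<open>t\<close>, but it dominates both the
  number of visits before \<open>t\<close> and the number of visits after \<open>t\<close>, one of which involves a
  positive fraction of the batch.
\<close>

lemma fourth_moment_over_count:
  assumes t: "t < m"
  shows "(\<integral>\<^sup>+\<omega>. ennreal (I t \<omega> * \<xi> t \<omega> ^ 4) * ennreal (1 / max 1 (count \<omega>)) \<partial>M) \<le> ennreal (48 * B / (p * real m))"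
proof -
  have [measurable]: "I t \<in> borel_measurable M" "\<xi> t \<in> borel_measurable M"
    using I_meas_M[OF t] \<xi>_meas_M[OF t] by auto
  have one: "(\<integral>\<^sup>+\<omega>. 1 \<partial>M) = 1" by (simp add: emeasure_space_1)
  have C: "ennreal (48 / (p * real m)) * ennreal B = ennreal (48 * B / (p * real m))"
    using p_pos B_ge by (subst ennreal_mult'[symmetric]) auto
  show ?thesis
  proof (cases "2 * t < m")
    case True
    define n where "n = (m - t - 1) div 2"
    have n: "Suc t + 2 * n \<le> m" "m \<le> 4 * n + 3" using t True unfolding n_def by linarith+
    have IH: "I t \<in> borel_measurable (H (Suc t))" using I_meas_H t by auto
    have \<xi>H: "\<xi> t \<in> borel_measurable (H (Suc t))" using \<xi>_meas t by auto
    have "(\<integral>\<^sup>+\<omega>. ennreal (I t \<omega> * \<xi> t \<omega> ^ 4) * ennreal (1 / max 1 (count \<omega>)) \<partial>M)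
      \<le> (\<integral>\<^sup>+\<omega>. ennreal (I t \<omega> * \<xi> t \<omega> ^ 4) * ennreal (1 / max 1 (\<Sum>j<n. I (Suc (Suc t + 2 * j)) \<omega>)) \<partial>M)"
      by (intro nn_integral_mono mult_left_mono ennreal_leI divide_left_mono max.mono order_refl block_le_count n) auto
    \<comment> \<open>The noise of step \<open>t\<close> itself serves as the weight, known when the
      later blocks begin.\<close>
    also have "\<dots> \<le> ennreal (48 / (p * real m)) * (\<integral>\<^sup>+\<omega>. ennreal (I t \<omega> * \<xi> t \<omega> ^ 4) \<partial>M)"
      by (rule inverse_visits[OF n]) (use IH \<xi>H in measurable)
    also have "\<dots> \<le> ennreal (48 / (p * real m)) * ennreal B"
      using fourth_moment[OF t, of "\<lambda>_. 1"] one by (intro mult_left_mono) auto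
    finally show ?thesis unfolding C .
  next
    case False
    define n where "n = t div 2"
    have n: "0 + 2 * n \<le> m" "m \<le> 4 * n + 3" "2 * n \<le> t" using t False unfolding n_def by linarith+
    have HG: "subalgebra (G t) (H t)" by (rule H_G[OF t])
    let ?X = "\<lambda>\<omega>. ennreal (1 / max 1 (\<Sum>j<n. I (Suc (0 + 2 * j)) \<omega>))"
    have NH: "(\<lambda>\<omega>. \<Sum>j<n. I (Suc (0 + 2 * j)) \<omega>) \<in> borel_measurable (G t)"
      using n t by (intro borel_measurable_sum measurable_from_subalg[OF HG] I_meas_H) auto
    have X: "?X \<in> borel_measurable (G t)" using NH by measurable
    have "(\<integral>\<^sup>+\<omega>. ennreal (I t \<omega> * \<xi> t \<omega> ^ 4) * ennreal (1 / max 1 (count \<omega>)) \<partial>M)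
      \<le> (\<integral>\<^sup>+\<omega>. ?X \<omega> * ennreal (I t \<omega> * \<xi> t \<omega> ^ 4) \<partial>M)"
    proof (rule nn_integral_mono)
      fix \<omega>
      have "ennreal (1 / max 1 (count \<omega>)) \<le> ?X \<omega>"
        by (intro ennreal_leI divide_left_mono max.mono order_refl block_le_count n) auto
      then show "ennreal (I t \<omega> * \<xi> t \<omega> ^ 4) * ennreal (1 / max 1 (count \<omega>)) \<le> ?X \<omega> * ennreal (I t \<omega> * \<xi> t \<omega> ^ 4)"
        by (subst mult.commute) (rule mult_right_mono, auto)
    qed
    also have "\<dots> \<le> ennreal B * (\<integral>\<^sup>+\<omega>. ?X \<omega> \<partial>M)" by (rule fourth_moment[OF t X])
    also have "\<dots> \<le> ennreal B * ennreal (48 / (p * real m))"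
      using inverse_visits[OF n(1,2), of "\<lambda>_. 1"] one by (intro mult_left_mono) auto
    finally show ?thesis using C by (simp add: mult.commute)
  qed
qed

text \<open>Dividing \<open>visit_sum_fourth_le\<close> by the fourth power of the count leaves a
  single inverse count, and m terms of order 1/m add up to a constant. A bound uniform in m is
  enough for the moment recursion.\<close>

lemma visit_avg_fourth_moment:
  "(\<integral>\<^sup>+\<omega>. ennreal ((visit_avg d \<omega>) ^ 4) \<partial>M) \<le> ennreal (d ^ 4 + 48 * B / p)"
proof -
  have m0: "0 < real m" using m_pos by simp
  have Im: "(\<lambda>\<omega>. ennreal (I t \<omega> * \<xi> t \<omega> ^ 4)) \<in> borel_measurable M" if "t < m" for t
    using I_meas_M[OF that] \<xi>_meas_M[OF that] by measurable
  have "(\<integral>\<^sup>+\<omega>. ennreal ((visit_avg d \<omega>) ^ 4) \<partial>M)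
      \<le> (\<integral>\<^sup>+\<omega>. ennreal (d ^ 4) + (\<Sum>t<m. ennreal (I t \<omega> * \<xi> t \<omega> ^ 4) * ennreal (1 / max 1 (count \<omega>))) \<partial>M)"
  proof (rule nn_integral_mono)
    fix \<omega>
    have F: "0 \<le> (\<Sum>t<m. I t \<omega> * \<xi> t \<omega> ^ 4)" by (auto intro!: sum_nonneg simp: I_bounds)
    have "(visit_avg d \<omega>) ^ 4 \<le> d ^ 4 + (\<Sum>t<m. I t \<omega> * \<xi> t \<omega> ^ 4) * (1 / max 1 (count \<omega>))"
    proof (cases "count \<omega> = 0")
      case True
      then show ?thesis using F by (simp add: visit_avg_def)
    next
      case False
      then have 1: "1 \<le> count \<omega>" using count_cases by blast
      have "(visit_avg d \<omega>) ^ 4 = (visit_sum m \<omega>) ^ 4 / count \<omega> ^ 4"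
        using False by (simp add: visit_avg_def power_divide)
      also have "\<dots> \<le> (count \<omega> ^ 3 * (\<Sum>t<m. I t \<omega> * \<xi> t \<omega> ^ 4)) / count \<omega> ^ 4"
        by (intro divide_right_mono visit_sum_fourth_le) simp
      also have "\<dots> = (\<Sum>t<m. I t \<omega> * \<xi> t \<omega> ^ 4) * (1 / max 1 (count \<omega>))"
        using 1 by (simp add: power3_eq_cube power4_eq_xxxx)
      finally show ?thesis by (simp add: add_increasing)
    qed
    then have "ennreal ((visit_avg d \<omega>) ^ 4) \<le> ennreal (d ^ 4 + (\<Sum>t<m. I t \<omega> * \<xi> t \<omega> ^ 4) * (1 / max 1 (count \<omega>)))"
      by (rule ennreal_leI)
    also have "\<dots> = ennreal (d ^ 4) + ennreal (\<Sum>t<m. I t \<omega> * \<xi> t \<omega> ^ 4) * ennreal (1 / max 1 (count \<omega>))"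
      using F by (subst ennreal_plus) (auto simp: ennreal_mult'[symmetric])
    also have "ennreal (\<Sum>t<m. I t \<omega> * \<xi> t \<omega> ^ 4) = (\<Sum>t<m. ennreal (I t \<omega> * \<xi> t \<omega> ^ 4))"
      by (rule sum_ennreal[symmetric]) (auto simp: I_bounds)
    finally show "ennreal ((visit_avg d \<omega>) ^ 4)
        \<le> ennreal (d ^ 4) + (\<Sum>t<m. ennreal (I t \<omega> * \<xi> t \<omega> ^ 4) * ennreal (1 / max 1 (count \<omega>)))"
      by (simp only: sum_distrib_right)
  qed
  also have "\<dots> = ennreal (d ^ 4) + (\<Sum>t<m. \<integral>\<^sup>+\<omega>. ennreal (I t \<omega> * \<xi> t \<omega> ^ 4) * ennreal (1 / max 1 (count \<omega>)) \<partial>M)"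
  proof -
    have m1: "(\<lambda>\<omega>. ennreal (I t \<omega> * \<xi> t \<omega> ^ 4) * ennreal (1 / max 1 (count \<omega>))) \<in> borel_measurable M" if "t < m" for t
      using Im[OF that] by measurable
    then have "(\<integral>\<^sup>+\<omega>. (\<Sum>t<m. ennreal (I t \<omega> * \<xi> t \<omega> ^ 4) * ennreal (1 / max 1 (count \<omega>))) \<partial>M)
        = (\<Sum>t<m. \<integral>\<^sup>+\<omega>. ennreal (I t \<omega> * \<xi> t \<omega> ^ 4) * ennreal (1 / max 1 (count \<omega>)) \<partial>M)"
      by (intro nn_integral_sum) auto
    moreover have "(\<lambda>\<omega>. \<Sum>t<m. ennreal (I t \<omega> * \<xi> t \<omega> ^ 4) * ennreal (1 / max 1 (count \<omega>))) \<in> borel_measurable M"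
      using m1 by (intro borel_measurable_sum) auto
    ultimately show ?thesis by (simp add: nn_integral_add emeasure_space_1)
  qed
  also have "\<dots> \<le> ennreal (d ^ 4) + (\<Sum>t<m. ennreal (48 * B / (p * real m)))"
    by (intro add_left_mono sum_mono fourth_moment_over_count) auto
  also have "\<dots> = ennreal (d ^ 4 + 48 * B / p)"
    using m0 p_pos B_ge by (simp add: ennreal_of_nat_eq_real_of_nat ennreal_mult'[symmetric] ennreal_plus[symmetric] field_simps del: ennreal_plus)
  finally show ?thesis .
qed

end

section \<open>Empirical model errors\<close>

text \<open>Translates a conditional probability into test functions. Since
  \<open>real_cond_exp\<close> is a difference of two real parts of nonnegative conditional
  expectations, the negative part has to vanish and the positive one to be finite almost
  everywhere.\<close>

lemma nn_integral_cond_prob: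
  assumes "prob_space M" and sub: "subalgebra M F" and E: "E \<in> sets M"
    and W: "W \<in> borel_measurable F"
    and cond: "AE \<omega> in M. real_cond_exp M F (indicat_real E) \<omega> = g \<omega>"
  shows "(\<integral>\<^sup>+\<omega>. W \<omega> * indicator E \<omega> \<partial>M) = (\<integral>\<^sup>+\<omega>. W \<omega> * ennreal (g \<omega>) \<partial>M)"
proof -
  interpret prob_space M by fact
  interpret finite_measure_subalgebra M F by standard (rule sub)
  have m: "(\<lambda>\<omega>. ennreal (indicat_real E \<omega>)) \<in> borel_measurable M" using E by measurable
  let ?N = "nn_cond_exp M F (\<lambda>\<omega>. ennreal (indicat_real E \<omega>))"
  have "(\<integral>\<^sup>+\<omega>. 1 * ?N \<omega> \<partial>M) = (\<integral>\<^sup>+\<omega>. 1 * ennreal (indicat_real E \<omega>) \<partial>M)"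
    by (rule nn_cond_exp_intg) (use m in auto)
  also have "\<dots> \<le> (\<integral>\<^sup>+\<omega>. 1 \<partial>M)" by (intro nn_integral_mono) (auto simp: indicator_def)
  also have "\<dots> < \<infinity>" by (simp add: emeasure_space_1)
  finally have "(\<integral>\<^sup>+\<omega>. ?N \<omega> \<partial>M) \<noteq> \<infinity>" by simp
  then have fin: "AE \<omega> in M. ?N \<omega> \<noteq> \<infinity>" by (intro nn_integral_PInf_AE) auto
  have zero: "AE \<omega> in M. nn_cond_exp M F (\<lambda>\<omega>. ennreal (- indicat_real E \<omega>)) \<omega> = 0"
  proof -
    have "(\<lambda>\<omega>. ennreal (- indicat_real E \<omega>)) = (\<lambda>\<omega>. 0)" by (auto simp: indicator_def ennreal_neg)
    moreover have "AE \<omega> in M. 0 = nn_cond_exp M F (\<lambda>\<omega>. 0) \<omega>" by (rule nn_cond_exp_F_meas) auto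
    ultimately show ?thesis by auto
  qed
  have "(\<integral>\<^sup>+\<omega>. W \<omega> * indicator E \<omega> \<partial>M) = (\<integral>\<^sup>+\<omega>. W \<omega> * ennreal (indicat_real E \<omega>) \<partial>M)"
    by (intro nn_integral_cong) (auto simp: indicator_def)
  also have "\<dots> = (\<integral>\<^sup>+\<omega>. W \<omega> * ?N \<omega> \<partial>M)"
    by (rule nn_cond_exp_intg[symmetric]) (use m W in auto)
  also have "\<dots> = (\<integral>\<^sup>+\<omega>. W \<omega> * ennreal (g \<omega>) \<partial>M)"
  proof (intro nn_integral_cong_AE)
    show "AE \<omega> in M. W \<omega> * ?N \<omega> = W \<omega> * ennreal (g \<omega>)"
      using fin zero cond
    proof eventually_elim
      case (elim \<omega>)
      then have "g \<omega> = enn2real (?N \<omega>)" by (simp add: real_cond_exp_def)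
      then show ?case using elim(1) by (simp add: ennreal_enn2real_if)
    qed
  qed
  finally show ?thesis .
qed

lemma square_kernel_size_le:
  fixes d :: "'s::finite \<Rightarrow> 'a::finite \<Rightarrow> 's \<Rightarrow> real"
  shows "(kernel_size d)\<^sup>2 \<le> real (CARD('s \<times> 'a \<times> 's)) * (\<Sum>s\<in>UNIV. \<Sum>a\<in>UNIV. \<Sum>s'\<in>UNIV. (d s a s')\<^sup>2)"
proof -
  let ?f = "\<lambda>(s, a, s'). \<bar>d s a s'\<bar>"
  have "kernel_size d = sum ?f UNIV"
    by (simp add: kernel_size_def sum.cartesian_product UNIV_Times_UNIV[symmetric] del: UNIV_Times_UNIV)
  moreover have "(\<Sum>s\<in>UNIV. \<Sum>a\<in>UNIV. \<Sum>s'\<in>UNIV. (d s a s')\<^sup>2) = (\<Sum>i\<in>UNIV. (?f i)\<^sup>2)"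
    by (simp add: sum.cartesian_product UNIV_Times_UNIV[symmetric] case_prod_unfold del: UNIV_Times_UNIV)
  ultimately show ?thesis
    using sum_squared_le_sum_of_squares[of ?f "UNIV :: ('s \<times> 'a \<times> 's) set"] by (simp add: mult.commute)
qed

lemma square_table_size_le:
  fixes d :: "'s::finite \<Rightarrow> 'a::finite \<Rightarrow> real"
  shows "(table_size d)\<^sup>2 \<le> real (CARD('s \<times> 'a)) * (\<Sum>s\<in>UNIV. \<Sum>a\<in>UNIV. (d s a)\<^sup>2)"
proof -
  let ?f = "\<lambda>(s, a). \<bar>d s a\<bar>"
  have "table_size d = sum ?f UNIV"
    by (simp add: table_size_def sum.cartesian_product UNIV_Times_UNIV[symmetric] del: UNIV_Times_UNIV)
  moreover have "(\<Sum>s\<in>UNIV. \<Sum>a\<in>UNIV. (d s a)\<^sup>2) = (\<Sum>i\<in>UNIV. (?f i)\<^sup>2)"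
    by (simp add: sum.cartesian_product UNIV_Times_UNIV[symmetric] case_prod_unfold del: UNIV_Times_UNIV)
  ultimately show ?thesis
    using sum_squared_le_sum_of_squares[of ?f "UNIV :: ('s \<times> 'a) set"] by (simp add: mult.commute)
qed

lemma fourth_table_size_le:
  fixes d :: "'s::finite \<Rightarrow> 'a::finite \<Rightarrow> real"
  shows "(table_size d) ^ 4 \<le> real (CARD('s \<times> 'a)) ^ 3 * (\<Sum>s\<in>UNIV. \<Sum>a\<in>UNIV. (d s a) ^ 4)"
proof -
  let ?n = "real (CARD('s \<times> 'a))"
  let ?d = "\<lambda>s a. (d s a)\<^sup>2"
  have "(table_size d) ^ 4 = ((table_size d)\<^sup>2)\<^sup>2" by simp
  also have "\<dots> \<le> (?n * table_size ?d)\<^sup>2"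
    using square_table_size_le[of d] by (intro power_mono) (auto simp: table_size_def)
  also have "\<dots> \<le> ?n\<^sup>2 * (?n * (\<Sum>s\<in>UNIV. \<Sum>a\<in>UNIV. (?d s a)\<^sup>2))"
    unfolding power_mult_distrib by (intro mult_left_mono square_table_size_le) simp
  also have "\<dots> = ?n ^ 3 * (\<Sum>s\<in>UNIV. \<Sum>a\<in>UNIV. (d s a) ^ 4)"
    by (simp add: power2_eq_square power3_eq_cube power4_eq_xxxx mult.assoc)
  finally show ?thesis .
qed

context bellman_admm_setup
begin

text \<open>
  A reset that lands in a given state, followed by a given action without reset: this takes two
  steps, so the visits are counted in blocks of length two.
\<close>

definition visit_rate :: real where "visit_rate = (1 - \<gamma>) * \<rho>_min * (\<alpha> * \<gamma>)"

lemma visit_rate_pos: "0 < visit_rate"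
  using discount \<rho>_min_pos \<alpha>_pos by (simp add: visit_rate_def)

text \<open>This and the following constants live in the setup, with the moment bound and the
  fill-in rewards as parameters, so that they are fixed before a probability space or a schedule is
  chosen.\<close>

definition avg_second :: "real \<Rightarrow> real \<Rightarrow> real" where
  "avg_second B d = 256 * B / visit_rate\<^sup>2 + (d\<^sup>2 + 1) * (48 * 16 ^ 4 / visit_rate ^ 4) + B"

definition avg_fourth :: "real \<Rightarrow> real \<Rightarrow> real" where
  "avg_fourth B d = d ^ 4 + 48 * B / visit_rate"

definition kernel_second :: "real \<Rightarrow> real" where
  "kernel_second B = real (CARD('s \<times> 'a \<times> 's)) *
    (\<Sum>s\<in>UNIV. \<Sum>a\<in>UNIV. \<Sum>s'\<in>UNIV. avg_second B (p0 s a s' - P s a s'))"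

definition reward_second :: "real \<Rightarrow> ('s \<Rightarrow> 'a \<Rightarrow> real) \<Rightarrow> real" where
  "reward_second B q0 = real (CARD('s \<times> 'a)) * (\<Sum>s\<in>UNIV. \<Sum>a\<in>UNIV. avg_second B (q0 s a - r s a))"

definition reward_fourth :: "real \<Rightarrow> ('s \<Rightarrow> 'a \<Rightarrow> real) \<Rightarrow> real" where
  "reward_fourth B q0 = real (CARD('s \<times> 'a)) ^ 3 * (\<Sum>s\<in>UNIV. \<Sum>a\<in>UNIV. avg_fourth B (q0 s a - r s a))"

lemma avg_second_nonneg: "1 \<le> B \<Longrightarrow> 0 \<le> avg_second B d"
  using visit_rate_pos by (auto simp: avg_second_def intro!: add_nonneg_nonneg)

lemma avg_fourth_nonneg: "1 \<le> B \<Longrightarrow> 0 \<le> avg_fourth B d"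
  using visit_rate_pos by (auto simp: avg_fourth_def intro!: add_nonneg_nonneg)

lemma kernel_second_nonneg: "1 \<le> B \<Longrightarrow> 0 \<le> kernel_second B"
  by (auto simp: kernel_second_def intro!: mult_nonneg_nonneg sum_nonneg avg_second_nonneg)

lemma reward_second_nonneg: "1 \<le> B \<Longrightarrow> 0 \<le> reward_second B q0"
  by (auto simp: reward_second_def intro!: mult_nonneg_nonneg sum_nonneg avg_second_nonneg)

lemma reward_fourth_nonneg: "1 \<le> B \<Longrightarrow> 0 \<le> reward_fourth B q0"
  by (auto simp: reward_fourth_def intro!: mult_nonneg_nonneg sum_nonneg avg_fourth_nonneg)

end

section \<open>The sampled batch as a noisy visit process\<close>

context bellman_admm_run
begin

text \<open>Backward induction: the end of a batch lies in the next history, and each earlier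
  algebra in its successor.\<close>

lemma H_sub_M: "t \<le> m k \<Longrightarrow> subalgebra M (H k t)"
proof (induction "m k - t" arbitrary: t)
  case 0
  then have "t = m k" by simp
  then show ?case using subalgebra_trans[OF F_sub H_F] by simp
next
  case (Suc j)
  then have t: "t < m k" by simp
  have "subalgebra M (H k (Suc t))" using Suc by (intro Suc.hyps(1)) auto
  then show ?case using subalgebra_trans[OF subalgebra_trans[OF _ G_H[OF t]] H_G[OF t]] by blast
qed

lemma G_sub_M: "t < m k \<Longrightarrow> subalgebra M (G k t)"
  using subalgebra_trans[OF H_sub_M[of "Suc t"] G_H] by simp

definition visit_ind :: "nat \<Rightarrow> 's \<Rightarrow> 'a \<Rightarrow> nat \<Rightarrow> 'w \<Rightarrow> real" where
  "visit_ind k s a t \<omega> = of_bool (S k t \<omega> = s \<and> A k t \<omega> = a \<and> \<not> U k t \<omega>)"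

lemma S_meas_G: "t < m k \<Longrightarrow> S k t \<in> measurable (G k t) (count_space UNIV)"
  using measurable_from_subalg[OF H_G S_meas] by simp

lemma visit_ind_meas: "t < m k \<Longrightarrow> visit_ind k s a t \<in> borel_measurable (G k t)"
  unfolding visit_ind_def using S_meas_G[of t k] A_meas[of t k] U_meas[of t k] by measurable

lemma visit_rate_le_1: "visit_rate \<le> 1"
proof -
  obtain \<omega> where \<omega>: "\<omega> \<in> space M" using not_empty by blast
  have "\<alpha> \<le> 1" using bpol_lower[OF \<omega>, of 0] policy_entry_abs[OF bpol_policy[OF \<omega>, of 0]]
    by (metis abs_le_D1 order_trans)
  moreover have "\<rho>_min \<le> 1"
  proof -
    fix s :: 's
    have "\<rho> s \<le> (\<Sum>s\<in>UNIV. \<rho> s)" using \<rho>_prob by (intro member_le_sum) (auto simp: prob_vec_def)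
    then show ?thesis using \<rho>_lower[of s] \<rho>_prob by (simp add: prob_vec_def)
  qed
  ultimately show ?thesis
    unfolding visit_rate_def using discount \<rho>_min_pos \<alpha>_pos by (intro mult_le_one) auto
qed

text \<open>Three conditionings in turn: on \<open>H k t\<close>, a reset has probability 1 -
  \<gamma> after summing over the actions; on \<open>G k t\<close>, the reset lands in
  \<open>s\<close> with probability at least \<open>\<rho>_min\<close>; on
  \<open>H k (Suc t)\<close>, action \<open>a\<close> without reset has probability at least
  \<alpha> \<gamma>.\<close>

lemma visit_lower:
  assumes t: "Suc t < m k" and W: "W \<in> borel_measurable (H k t)"
  shows "ennreal visit_rate * (\<integral>\<^sup>+\<omega>. W \<omega> \<partial>M) \<le> (\<integral>\<^sup>+\<omega>. W \<omega> * ennreal (visit_ind k s a (Suc t) \<omega>) \<partial>M)"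
proof -
  have t': "t < m k" using t by simp
  note P = prob_space_axioms
  have HM: "subalgebra M (H k t)" "subalgebra M (G k t)" "subalgebra M (H k (Suc t))" "subalgebra M (G k (Suc t))"
    using t H_sub_M G_sub_M by auto
  have Wm [measurable]: "W \<in> borel_measurable M" "W \<in> borel_measurable (G k t)" "W \<in> borel_measurable (H k (Suc t))"
    using measurable_from_subalg[OF HM(1) W] measurable_from_subalg[OF H_G[OF t'] W]
      measurable_from_subalg[OF G_H[OF t']] by auto
  note [measurable] = U_meas[OF t'] measurable_from_subalg[OF HM(2) U_meas[OF t']]
    measurable_from_subalg[OF G_H[OF t'] U_meas[OF t']] measurable_from_subalg[OF HM(2) A_meas[OF t']]
  have S': "S k (Suc t) \<in> measurable (H k (Suc t)) (count_space UNIV)" using S_meas t by auto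
  note [measurable] = S' measurable_from_subalg[OF HM(3) S'] measurable_from_subalg[OF HM(4) A_meas[OF t]]
    measurable_from_subalg[OF HM(4) U_meas[OF t]]
  let ?W1 = "\<lambda>\<omega>. W \<omega> * of_bool (U k t \<omega>)"
  let ?W2 = "\<lambda>\<omega>. ?W1 \<omega> * of_bool (S k (Suc t) \<omega> = s)"
  define x where "x = (\<integral>\<^sup>+\<omega>. W \<omega> \<partial>M)"
  have 1: "(\<integral>\<^sup>+\<omega>. ?W1 \<omega> \<partial>M) = ennreal (1 - \<gamma>) * x"
  proof -
    let ?E = "\<lambda>b. {\<omega> \<in> space M. A k t \<omega> = b \<and> U k t \<omega> = True}"
    have E: "?E b \<in> sets M" for b by measurable
    have pw: "of_bool (U k t \<omega>) = (\<Sum>b\<in>UNIV. indicator (?E b) \<omega> :: ennreal)" if "\<omega> \<in> space M" for \<omega>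
      using that by (auto simp: indicator_def of_bool_def)
    have "(\<integral>\<^sup>+\<omega>. ?W1 \<omega> \<partial>M) = (\<integral>\<^sup>+\<omega>. (\<Sum>b\<in>UNIV. W \<omega> * indicator (?E b) \<omega>) \<partial>M)"
      by (intro nn_integral_cong) (simp add: pw sum_distrib_left)
    also have "\<dots> = (\<Sum>b\<in>UNIV. \<integral>\<^sup>+\<omega>. W \<omega> * indicator (?E b) \<omega> \<partial>M)"
      using E by (intro nn_integral_sum) measurable
    also have "\<dots> = (\<Sum>b\<in>UNIV. \<integral>\<^sup>+\<omega>. W \<omega> * ennreal (bpol k \<omega> $ S k t \<omega> $ b * (if True then 1 - \<gamma> else \<gamma>)) \<partial>M)"
      by (intro sum.cong refl nn_integral_cond_prob[OF P HM(1) E W] action_coin_law[OF t'])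
    also have "\<dots> = (\<integral>\<^sup>+\<omega>. (\<Sum>b\<in>UNIV. W \<omega> * ennreal (bpol k \<omega> $ S k t \<omega> $ b * (1 - \<gamma>))) \<partial>M)"
    proof -
      \<comment> \<open>The state index is random; a finite sum over its possible values reduces the
        claim to fixed entries.\<close>
      have b: "(\<lambda>\<omega>. bpol k \<omega> $ S k t \<omega> $ b) \<in> borel_measurable M" for b
      proof -
        have [measurable]: "S k t \<in> measurable M (count_space UNIV)"
          using measurable_from_subalg[OF HM(1) S_meas] t by simp
        have bm: "bpol k \<in> borel_measurable M" by (rule measurable_from_subalg[OF F_sub bpol_meas])
        have "(\<lambda>\<omega>. bpol k \<omega> $ s $ b) \<in> borel_measurable M" for s
          by (intro borel_measurable_continuous_on[OF _ bm, of "\<lambda>x. x $ s $ b"]) (auto intro!: continuous_intros)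
        then have "(\<lambda>\<omega>. \<Sum>s\<in>UNIV. of_bool (S k t \<omega> = s) * bpol k \<omega> $ s $ b) \<in> borel_measurable M"
          by (intro borel_measurable_sum borel_measurable_times) auto
        then show ?thesis by (simp add: of_bool_def if_distrib[of "\<lambda>x. x * _"] cong: if_cong)
      qed
      show ?thesis using b by (subst nn_integral_sum) auto
    qed
    also have "\<dots> = (\<integral>\<^sup>+\<omega>. ennreal (1 - \<gamma>) * W \<omega> \<partial>M)"
    proof (rule nn_integral_cong)
      fix \<omega> assume "\<omega> \<in> space M"
      then have p: "0 \<le> bpol k \<omega> $ S k t \<omega> $ b" "(\<Sum>b\<in>UNIV. bpol k \<omega> $ S k t \<omega> $ b) = 1" for b
        using bpol_policy[of \<omega> k] by (auto simp: policies_def prob_vec_def)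
      have "(\<Sum>b\<in>UNIV. W \<omega> * ennreal (bpol k \<omega> $ S k t \<omega> $ b * (1 - \<gamma>)))
          = W \<omega> * ennreal (\<Sum>b\<in>UNIV. bpol k \<omega> $ S k t \<omega> $ b * (1 - \<gamma>))"
        using p discount unfolding sum_distrib_left[symmetric] by (subst sum_ennreal) auto
      also have "(\<Sum>b\<in>UNIV. bpol k \<omega> $ S k t \<omega> $ b * (1 - \<gamma>)) = 1 - \<gamma>"
        by (simp only: sum_distrib_right[symmetric] p mult_1)
      finally show "(\<Sum>b\<in>UNIV. W \<omega> * ennreal (bpol k \<omega> $ S k t \<omega> $ b * (1 - \<gamma>))) = ennreal (1 - \<gamma>) * W \<omega>"
        by (simp add: mult.commute)
    qed
    also have "\<dots> = ennreal (1 - \<gamma>) * x" by (simp add: nn_integral_cmult x_def)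
    finally show ?thesis .
  qed
  have 2: "ennreal \<rho>_min * (\<integral>\<^sup>+\<omega>. ?W1 \<omega> \<partial>M) \<le> (\<integral>\<^sup>+\<omega>. ?W2 \<omega> \<partial>M)"
  proof -
    let ?E = "{\<omega> \<in> space M. S k (Suc t) \<omega> = s}"
    have E: "?E \<in> sets M" by measurable
    have "(\<integral>\<^sup>+\<omega>. ?W2 \<omega> \<partial>M) = (\<integral>\<^sup>+\<omega>. ?W1 \<omega> * indicator ?E \<omega> \<partial>M)"
      by (intro nn_integral_cong) (auto simp: indicator_def)
    also have "\<dots> = (\<integral>\<^sup>+\<omega>. ?W1 \<omega> * ennreal (if U k t \<omega> then \<rho> s else P (S k t \<omega>) (A k t \<omega>) s) \<partial>M)"
      by (rule nn_integral_cond_prob[OF P HM(2) E _ next_state_law[OF t']]) measurable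
    also have "\<dots> \<ge> (\<integral>\<^sup>+\<omega>. ennreal \<rho>_min * ?W1 \<omega> \<partial>M)"
    proof (rule nn_integral_mono)
      fix \<omega>
      show "ennreal \<rho>_min * ?W1 \<omega> \<le> ?W1 \<omega> * ennreal (if U k t \<omega> then \<rho> s else P (S k t \<omega>) (A k t \<omega>) s)"
        by (cases "U k t \<omega>") (auto simp: mult.commute[of "ennreal \<rho>_min"] intro!: mult_left_mono ennreal_leI \<rho>_lower)
    qed
    finally show ?thesis by (simp add: nn_integral_cmult)
  qed
  have 3: "ennreal (\<alpha> * \<gamma>) * (\<integral>\<^sup>+\<omega>. ?W2 \<omega> \<partial>M) \<le> (\<integral>\<^sup>+\<omega>. W \<omega> * ennreal (visit_ind k s a (Suc t) \<omega>) \<partial>M)"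
  proof -
    let ?E = "{\<omega> \<in> space M. A k (Suc t) \<omega> = a \<and> U k (Suc t) \<omega> = False}"
    have E: "?E \<in> sets M" by measurable
    have "ennreal (\<alpha> * \<gamma>) * (\<integral>\<^sup>+\<omega>. ?W2 \<omega> \<partial>M) = (\<integral>\<^sup>+\<omega>. ?W2 \<omega> * ennreal (\<alpha> * \<gamma>) \<partial>M)"
      by (subst nn_integral_cmult[symmetric]) (auto simp: mult.commute)
    also have "\<dots> \<le> (\<integral>\<^sup>+\<omega>. ?W2 \<omega> * ennreal (bpol k \<omega> $ S k (Suc t) \<omega> $ a * (if False then 1 - \<gamma> else \<gamma>)) \<partial>M)"
      using discount by (intro nn_integral_mono mult_left_mono ennreal_leI) (auto intro!: mult_right_mono bpol_lower)
    also have "\<dots> = (\<integral>\<^sup>+\<omega>. ?W2 \<omega> * indicator ?E \<omega> \<partial>M)"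
      by (rule nn_integral_cond_prob[OF P HM(3) E _ action_coin_law[OF t], symmetric]) measurable
    also have "\<dots> \<le> (\<integral>\<^sup>+\<omega>. W \<omega> * ennreal (visit_ind k s a (Suc t) \<omega>) \<partial>M)"
      by (intro nn_integral_mono) (auto simp: visit_ind_def indicator_def)
    finally show ?thesis .
  qed
  have "ennreal visit_rate * x = ennreal (\<alpha> * \<gamma>) * (ennreal \<rho>_min * (ennreal (1 - \<gamma>) * x))"
    using discount \<rho>_min_pos \<alpha>_pos by (simp add: visit_rate_def ennreal_mult' mult_ac)
  also have "\<dots> \<le> ennreal (\<alpha> * \<gamma>) * (\<integral>\<^sup>+\<omega>. ?W2 \<omega> \<partial>M)"
    using 2 unfolding 1 by (rule mult_left_mono) simp
  also note 3
  finally show ?thesis by (simp add: x_def)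
qed

lemma visit_process: "visit_process M (m k) (H k) (G k) (visit_ind k s a) visit_rate"
proof (unfold_locales)
  show "visit_ind k s a t \<omega> \<in> {0, 1}" for t \<omega> by (simp add: visit_ind_def)
  show "visit_rate \<le> 1" by (rule visit_rate_le_1)
qed (use H_sub_M H_G G_H visit_ind_meas visit_rate_pos visit_lower batch_nonempty in auto)

text \<open>The maximum with 1 covers the transition noise, which is bounded by 1, and provides the
  \<open>1 \<le> B\<close> used in \<open>second_moment_term\<close>.\<close>

definition noise_bound :: real where "noise_bound = max 1 M4"

definition reward_noise :: "nat \<Rightarrow> nat \<Rightarrow> 'w \<Rightarrow> real" where
  "reward_noise k t \<omega> = Y k t \<omega> - r (S k t \<omega>) (A k t \<omega>)"

definition trans_noise :: "nat \<Rightarrow> 's \<Rightarrow> 'a \<Rightarrow> 's \<Rightarrow> nat \<Rightarrow> 'w \<Rightarrow> real" where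
  "trans_noise k s a s' t \<omega> = of_bool (S k (Suc t) \<omega> = s') - P s a s'"

lemma reward_noisy_visits:
  "noisy_visits M (m k) (H k) (G k) (visit_ind k s a) visit_rate (reward_noise k) noise_bound"
proof (rule noisy_visits.intro[OF visit_process], rule noisy_visits_axioms.intro)
  fix t assume t: "t < m k"
  have GH: "subalgebra (H k (Suc t)) (G k t)" by (rule G_H[OF t])
  have GM: "subalgebra M (G k t)" by (rule G_sub_M[OF t])
  have HM: "subalgebra M (H k (Suc t))" using H_sub_M t by simp
  note [measurable] = Y_meas[OF t] measurable_from_subalg[OF GH A_meas[OF t]] measurable_from_subalg[OF GH S_meas_G[OF t]]
  have "(\<lambda>\<omega>. r (S k t \<omega>) (A k t \<omega>)) \<in> borel_measurable (H k (Suc t))"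
  proof -
    have "(\<lambda>\<omega>. (\<lambda>(s, a). r s a) (S k t \<omega>, A k t \<omega>)) \<in> borel_measurable (H k (Suc t))"
      by (rule measurable_compose[of _ _ "count_space UNIV"]) auto
    then show ?thesis by simp
  qed
  then show \<xi>: "reward_noise k t \<in> borel_measurable (H k (Suc t))" unfolding reward_noise_def by measurable
  have \<xi>M: "reward_noise k t \<in> borel_measurable M" by (rule measurable_from_subalg[OF HM \<xi>])
  interpret sub: finite_measure_subalgebra M "G k t" by standard (rule GM)
  {
    fix X assume X: "X \<in> borel_measurable (G k t)"
      "integrable M (\<lambda>\<omega>. X \<omega> * (visit_ind k s a t \<omega> * reward_noise k t \<omega>))"
    have XI: "(\<lambda>\<omega>. X \<omega> * visit_ind k s a t \<omega>) \<in> borel_measurable (G k t)"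
      using X(1) visit_ind_meas[OF t] by measurable
    have int: "integrable M (\<lambda>\<omega>. (X \<omega> * visit_ind k s a t \<omega>) * reward_noise k t \<omega>)"
      using X(2) by (simp only: mult.assoc)
    have "(\<integral>\<omega>. (X \<omega> * visit_ind k s a t \<omega>) * reward_noise k t \<omega> \<partial>M)
        = (\<integral>\<omega>. (X \<omega> * visit_ind k s a t \<omega>) * real_cond_exp M (G k t) (reward_noise k t) \<omega> \<partial>M)"
      by (rule sub.real_cond_exp_intg(2)[OF int XI \<xi>M, symmetric])
    also have "\<dots> = (\<integral>\<omega>. 0 \<partial>M)"
      using noise_mean[OF t] unfolding reward_noise_def[symmetric]
      using measurable_from_subalg[OF GM XI] by (intro integral_cong_AE) auto
    finally show "(\<integral>\<omega>. X \<omega> * (visit_ind k s a t \<omega> * reward_noise k t \<omega>) \<partial>M) = 0"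
      by (simp add: mult.assoc)
  next
    fix X :: "'w \<Rightarrow> ennreal" assume X: "X \<in> borel_measurable (G k t)"
    have XM [measurable]: "X \<in> borel_measurable M" by (rule measurable_from_subalg[OF GM X])
    have p4: "(\<lambda>\<omega>. ennreal (\<bar>reward_noise k t \<omega>\<bar> ^ 4)) \<in> borel_measurable M" using \<xi>M by measurable
    have "(\<integral>\<^sup>+\<omega>. X \<omega> * ennreal (visit_ind k s a t \<omega> * reward_noise k t \<omega> ^ 4) \<partial>M)
        \<le> (\<integral>\<^sup>+\<omega>. X \<omega> * ennreal (\<bar>reward_noise k t \<omega>\<bar> ^ 4) \<partial>M)"
      by (intro nn_integral_mono mult_left_mono ennreal_leI) (auto simp: visit_ind_def power_even_abs)
    also have "\<dots> = (\<integral>\<^sup>+\<omega>. X \<omega> * nn_cond_exp M (G k t) (\<lambda>\<omega>. ennreal (\<bar>reward_noise k t \<omega>\<bar> ^ 4)) \<omega> \<partial>M)"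
      by (rule sub.nn_cond_exp_intg[OF X p4, symmetric])
    also have "\<dots> \<le> (\<integral>\<^sup>+\<omega>. X \<omega> * ennreal noise_bound \<partial>M)"
      using noise_fourth_moment[OF t] unfolding reward_noise_def[symmetric]
    proof (intro nn_integral_mono_AE, eventually_elim)
      case (elim \<omega>)
      have "ennreal M4 \<le> ennreal noise_bound" by (rule ennreal_leI) (simp add: noise_bound_def)
      from order_trans[OF elim(2) this] show ?case by (rule mult_left_mono) simp
    qed
    also have "\<dots> = ennreal noise_bound * (\<integral>\<^sup>+\<omega>. X \<omega> \<partial>M)"
      by (subst mult.commute) (simp add: nn_integral_cmult)
    finally show "(\<integral>\<^sup>+\<omega>. X \<omega> * ennreal (visit_ind k s a t \<omega> * reward_noise k t \<omega> ^ 4) \<partial>M)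
        \<le> ennreal noise_bound * (\<integral>\<^sup>+\<omega>. X \<omega> \<partial>M)" .
  }
qed (simp add: noise_bound_def)

text \<open>On a visit the coin shows no reset and the pair is \<open>(s, a)\<close>, so
  \<open>next_state_law\<close> gives exactly \<open>P s a s'\<close> and the noise is centred. Its
  fourth power is at most 1.\<close>

lemma trans_noisy_visits:
  "noisy_visits M (m k) (H k) (G k) (visit_ind k s a) visit_rate (trans_noise k s a s') noise_bound"
proof (rule noisy_visits.intro[OF visit_process], rule noisy_visits_axioms.intro)
  fix t assume t: "t < m k"
  have GM: "subalgebra M (G k t)" by (rule G_sub_M[OF t])
  have HM: "subalgebra M (H k (Suc t))" using H_sub_M t by simp
  have S': "S k (Suc t) \<in> measurable (H k (Suc t)) (count_space UNIV)" using S_meas t by simp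
  note [measurable] = S' measurable_from_subalg[OF HM S']
  show \<xi>: "trans_noise k s a s' t \<in> borel_measurable (H k (Suc t))" unfolding trans_noise_def by measurable
  interpret sub: finite_measure_subalgebra M "G k t" by standard (rule GM)
  let ?E = "{\<omega> \<in> space M. S k (Suc t) \<omega> = s'}"
  have E: "?E \<in> sets M" by measurable
  {
    fix X :: "'w \<Rightarrow> real" assume X: "X \<in> borel_measurable (G k t)" "integrable M X"
    have XI: "(\<lambda>\<omega>. X \<omega> * visit_ind k s a t \<omega>) \<in> borel_measurable (G k t)"
      using X(1) visit_ind_meas[OF t] by measurable
    note XIM = measurable_from_subalg[OF GM XI]
    have int1: "integrable M (\<lambda>\<omega>. X \<omega> * visit_ind k s a t \<omega>)"
      by (rule Bochner_Integration.integrable_bound[OF X(2) XIM]) (auto simp: visit_ind_def)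
    have int2: "integrable M (\<lambda>\<omega>. (X \<omega> * visit_ind k s a t \<omega>) * indicat_real ?E \<omega>)"
      by (rule integrable_real_mult_indicator[OF E int1])
    have "(\<integral>\<omega>. (X \<omega> * visit_ind k s a t \<omega>) * indicat_real ?E \<omega> \<partial>M)
        = (\<integral>\<omega>. (X \<omega> * visit_ind k s a t \<omega>) * real_cond_exp M (G k t) (indicat_real ?E) \<omega> \<partial>M)"
      by (rule sub.real_cond_exp_intg(2)[OF int2 XI, symmetric]) (use E in measurable)
    also have "\<dots> = (\<integral>\<omega>. (X \<omega> * visit_ind k s a t \<omega>) * P s a s' \<partial>M)"
    proof (rule integral_cong_AE)
      show "AE \<omega> in M. (X \<omega> * visit_ind k s a t \<omega>) * real_cond_exp M (G k t) (indicat_real ?E) \<omega>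
          = (X \<omega> * visit_ind k s a t \<omega>) * P s a s'"
        using next_state_law[OF t, of s'] by eventually_elim (auto simp: visit_ind_def)
    qed (use XIM in measurable)
    finally have eq: "(\<integral>\<omega>. (X \<omega> * visit_ind k s a t \<omega>) * indicat_real ?E \<omega> \<partial>M)
        = (\<integral>\<omega>. (X \<omega> * visit_ind k s a t \<omega>) * P s a s' \<partial>M)" .
    have "(\<integral>\<omega>. X \<omega> * (visit_ind k s a t \<omega> * trans_noise k s a s' t \<omega>) \<partial>M)
        = (\<integral>\<omega>. (X \<omega> * visit_ind k s a t \<omega>) * indicat_real ?E \<omega> - (X \<omega> * visit_ind k s a t \<omega>) * P s a s' \<partial>M)"
      by (intro Bochner_Integration.integral_cong refl)
         (auto simp: trans_noise_def indicator_def algebra_simps)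
    also have "\<dots> = 0"
      using eq int1 int2 by (subst Bochner_Integration.integral_diff) auto
    finally show "(\<integral>\<omega>. X \<omega> * (visit_ind k s a t \<omega> * trans_noise k s a s' t \<omega>) \<partial>M) = 0" .
  next
    fix X :: "'w \<Rightarrow> ennreal" assume X: "X \<in> borel_measurable (G k t)"
    have [measurable]: "X \<in> borel_measurable M" by (rule measurable_from_subalg[OF GM X])
    have p01: "0 \<le> P s a s'" "P s a s' \<le> 1"
    proof -
      have "P s a s' \<le> (\<Sum>s'\<in>UNIV. P s a s')"
        using P_stochastic[of s a] by (intro member_le_sum) (auto simp: prob_vec_def)
      then show "0 \<le> P s a s'" "P s a s' \<le> 1" using P_stochastic[of s a] by (auto simp: prob_vec_def)
    qed
    have "visit_ind k s a t \<omega> * trans_noise k s a s' t \<omega> ^ 4 \<le> noise_bound" for \<omega>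
    proof -
      have "\<bar>trans_noise k s a s' t \<omega>\<bar> \<le> 1" using p01 by (auto simp: trans_noise_def)
      then have "\<bar>trans_noise k s a s' t \<omega>\<bar> ^ 4 \<le> 1" by (intro power_le_one) auto
      then show ?thesis by (auto simp: visit_ind_def noise_bound_def power_even_abs)
    qed
    then have "(\<integral>\<^sup>+\<omega>. X \<omega> * ennreal (visit_ind k s a t \<omega> * trans_noise k s a s' t \<omega> ^ 4) \<partial>M)
        \<le> (\<integral>\<^sup>+\<omega>. X \<omega> * ennreal noise_bound \<partial>M)"
      by (intro nn_integral_mono mult_left_mono ennreal_leI) auto
    also have "\<dots> = ennreal noise_bound * (\<integral>\<^sup>+\<omega>. X \<omega> \<partial>M)"
      by (subst mult.commute) (simp add: nn_integral_cmult)
    finally show "(\<integral>\<^sup>+\<omega>. X \<omega> * ennreal (visit_ind k s a t \<omega> * trans_noise k s a s' t \<omega> ^ 4) \<partial>M)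
        \<le> ennreal noise_bound * (\<integral>\<^sup>+\<omega>. X \<omega> \<partial>M)" .
  }
qed (simp add: noise_bound_def)

abbreviation emp_P :: "nat \<Rightarrow> 'w \<Rightarrow> 's \<Rightarrow> 'a \<Rightarrow> 's \<Rightarrow> real" where
  "emp_P k \<omega> \<equiv> emp_trans p0 (m k) (S k) (A k) (U k) \<omega>"

abbreviation emp_r :: "nat \<Rightarrow> 'w \<Rightarrow> 's \<Rightarrow> 'a \<Rightarrow> real" where
  "emp_r k \<omega> \<equiv> emp_rew q0 (m k) (S k) (A k) (U k) (Y k) \<omega>"

lemma sum_visit_ind:
  "(\<Sum>t<m k. visit_ind k s a t \<omega> * f t) = (\<Sum>t\<in>visits (m k) (S k) (A k) (U k) \<omega> s a. f t)"
proof -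
  have "(\<Sum>t<m k. visit_ind k s a t \<omega> * f t) = (\<Sum>t\<in>{..<m k}. if t \<in> visits (m k) (S k) (A k) (U k) \<omega> s a then f t else 0)"
    by (intro sum.cong) (auto simp: visit_ind_def visits_def)
  also have "\<dots> = (\<Sum>t\<in>{..<m k} \<inter> visits (m k) (S k) (A k) (U k) \<omega> s a. f t)"
    by (rule sum.inter_restrict[symmetric]) simp
  also have "{..<m k} \<inter> visits (m k) (S k) (A k) (U k) \<omega> s a = visits (m k) (S k) (A k) (U k) \<omega> s a"
    by (auto simp: visits_def)
  finally show ?thesis .
qed

lemma finite_visits: "finite (visits n S' A' U' \<omega> s a)"
  by (simp add: visits_def)

text \<open>Subtracting \<open>r s a\<close> from every visited observation shifts the average by
  the same amount; the unvisited case matches the default \<open>q0 s a - r s a\<close>.\<close>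

lemma emp_r_error:
  "noisy_visits.visit_avg (m k) (visit_ind k s a) (reward_noise k) (q0 s a - r s a) \<omega> = emp_r k \<omega> s a - r s a"
proof -
  interpret noisy_visits M "m k" "H k" "G k" "visit_ind k s a" visit_rate "reward_noise k" noise_bound
    by (rule reward_noisy_visits)
  let ?V = "visits (m k) (S k) (A k) (U k) \<omega> s a"
  have c: "count \<omega> = real (card ?V)"
    using sum_visit_ind[of k s a \<omega> "\<lambda>_. 1"] by (simp add: count_def)
  have "visit_sum (m k) \<omega> = (\<Sum>t\<in>?V. reward_noise k t \<omega>)"
    by (simp add: visit_sum_def sum_visit_ind)
  also have "\<dots> = (\<Sum>t\<in>?V. Y k t \<omega> - r s a)"
    by (intro sum.cong) (auto simp: reward_noise_def visits_def)
  finally show ?thesis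
    using finite_visits[of "m k" "S k" "A k" "U k" \<omega> s a]
    by (simp add: visit_avg_def c emp_rew_def sum_subtractf card_eq_0_iff diff_divide_distrib)
qed

lemma emp_P_error:
  "noisy_visits.visit_avg (m k) (visit_ind k s a) (trans_noise k s a s') (p0 s a s' - P s a s') \<omega>
    = emp_P k \<omega> s a s' - P s a s'"
proof -
  interpret noisy_visits M "m k" "H k" "G k" "visit_ind k s a" visit_rate "trans_noise k s a s'" noise_bound
    by (rule trans_noisy_visits)
  let ?V = "visits (m k) (S k) (A k) (U k) \<omega> s a"
  have fin: "finite ?V" by (rule finite_visits)
  have c: "count \<omega> = real (card ?V)"
    using sum_visit_ind[of k s a \<omega> "\<lambda>_. 1"] by (simp add: count_def)
  have "visit_sum (m k) \<omega> = (\<Sum>t\<in>?V. trans_noise k s a s' t \<omega>)"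
    by (simp add: visit_sum_def sum_visit_ind)
  also have "\<dots> = (\<Sum>t\<in>?V. of_bool (S k (Suc t) \<omega> = s')) - real (card ?V) * P s a s'"
    by (simp add: trans_noise_def sum_subtractf)
  also have "(\<Sum>t\<in>?V. of_bool (S k (Suc t) \<omega> = s')) = real (card {t \<in> ?V. S k (Suc t) \<omega> = s'})"
    using fin by (simp add: of_bool_def sum.If_cases Int_def)
  finally show ?thesis
    using fin by (simp add: visit_avg_def c emp_trans_def card_eq_0_iff diff_divide_distrib)
qed

lemma emp_r_meas: "(\<lambda>\<omega>. emp_r k \<omega> s a - r s a) \<in> borel_measurable M"
  unfolding emp_r_error[symmetric] by (rule noisy_visits.visit_avg_meas[OF reward_noisy_visits])

lemma emp_P_meas: "(\<lambda>\<omega>. emp_P k \<omega> s a s' - P s a s') \<in> borel_measurable M"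
  unfolding emp_P_error[symmetric] by (rule noisy_visits.visit_avg_meas[OF trans_noisy_visits])

lemma kernel_err_meas [measurable]: "(\<lambda>\<omega>. kernel_err (emp_P k \<omega>)) \<in> borel_measurable M"
  unfolding kernel_err_def kernel_size_def by (intro borel_measurable_sum borel_measurable_abs emp_P_meas)

lemma reward_err_meas [measurable]: "(\<lambda>\<omega>. reward_err (emp_r k \<omega>)) \<in> borel_measurable M"
  unfolding reward_err_def table_size_def by (intro borel_measurable_sum borel_measurable_abs emp_r_meas)

lemma noise_bound_ge: "1 \<le> noise_bound"
  by (simp add: noise_bound_def)

lemma kernel_err_second_moment:
  assumes W: "W \<in> borel_measurable (F k)"
  shows "(\<integral>\<^sup>+\<omega>. ennreal (W \<omega>) * ennreal ((kernel_err (emp_P k \<omega>))\<^sup>2) \<partial>M)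
    \<le> ennreal (kernel_second noise_bound / real (m k)) * (\<integral>\<^sup>+\<omega>. ennreal (W \<omega>) \<partial>M)"
proof -
  have m0: "0 < real (m k)" using batch_nonempty[of k] by simp
  have WH: "W \<in> borel_measurable (H k 0)" by (rule measurable_from_subalg[OF F_H W])
  have [measurable]: "W \<in> borel_measurable M" by (rule measurable_from_subalg[OF F_sub W])
  note [measurable] = emp_P_meas
  let ?n = "real (CARD('s \<times> 'a \<times> 's))"
  let ?x = "\<lambda>s a s' \<omega>. ennreal (W \<omega>) * ennreal ((emp_P k \<omega> s a s' - P s a s')\<^sup>2)"
  have "(\<integral>\<^sup>+\<omega>. ennreal (W \<omega>) * ennreal ((kernel_err (emp_P k \<omega>))\<^sup>2) \<partial>M)
      \<le> (\<integral>\<^sup>+\<omega>. ennreal ?n * (\<Sum>s\<in>UNIV. \<Sum>a\<in>UNIV. \<Sum>s'\<in>UNIV. ?x s a s' \<omega>) \<partial>M)"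
  proof (rule nn_integral_mono)
    fix \<omega>
    have "ennreal (W \<omega>) * ennreal ((kernel_err (emp_P k \<omega>))\<^sup>2)
        \<le> ennreal (W \<omega>) * ennreal (?n * (\<Sum>s\<in>UNIV. \<Sum>a\<in>UNIV. \<Sum>s'\<in>UNIV. (emp_P k \<omega> s a s' - P s a s')\<^sup>2))"
      unfolding kernel_err_def by (intro mult_left_mono ennreal_leI square_kernel_size_le) simp
    also have "\<dots> = ennreal ?n * (\<Sum>s\<in>UNIV. \<Sum>a\<in>UNIV. \<Sum>s'\<in>UNIV. ?x s a s' \<omega>)"
      by (simp add: ennreal_mult' sum_nonneg sum_distrib_left mult.left_commute flip: sum_ennreal)
    finally show "ennreal (W \<omega>) * ennreal ((kernel_err (emp_P k \<omega>))\<^sup>2) \<le> \<dots>" .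
  qed
  also have "\<dots> = ennreal ?n * (\<Sum>s\<in>UNIV. \<Sum>a\<in>UNIV. \<Sum>s'\<in>UNIV. \<integral>\<^sup>+\<omega>. ?x s a s' \<omega> \<partial>M)"
    by (simp add: nn_integral_cmult nn_integral_sum)
  also have "\<dots> \<le> ennreal ?n * (\<Sum>s\<in>UNIV. \<Sum>a\<in>UNIV. \<Sum>s'\<in>UNIV.
      ennreal (avg_second noise_bound (p0 s a s' - P s a s') / real (m k)) * (\<integral>\<^sup>+\<omega>. ennreal (W \<omega>) \<partial>M))"
    using noisy_visits.visit_avg_second_moment[OF trans_noisy_visits WH]
    unfolding emp_P_error[symmetric] avg_second_def by (intro mult_left_mono sum_mono) auto
  also have "\<dots> = ennreal (kernel_second noise_bound / real (m k)) * (\<integral>\<^sup>+\<omega>. ennreal (W \<omega>) \<partial>M)"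
    using m0 avg_second_nonneg[OF noise_bound_ge]
    by (simp add: kernel_second_def ennreal_mult' sum_nonneg sum_distrib_right[symmetric] sum_divide_distrib[symmetric]
        mult.assoc[symmetric] times_divide_eq_right[symmetric] del: times_divide_eq_right)
  finally show ?thesis .
qed

lemma reward_err_second_moment:
  assumes W: "W \<in> borel_measurable (F k)"
  shows "(\<integral>\<^sup>+\<omega>. ennreal (W \<omega>) * ennreal ((reward_err (emp_r k \<omega>))\<^sup>2) \<partial>M)
    \<le> ennreal (reward_second noise_bound q0 / real (m k)) * (\<integral>\<^sup>+\<omega>. ennreal (W \<omega>) \<partial>M)"
proof -
  have m0: "0 < real (m k)" using batch_nonempty[of k] by simp
  have WH: "W \<in> borel_measurable (H k 0)" by (rule measurable_from_subalg[OF F_H W])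
  have [measurable]: "W \<in> borel_measurable M" by (rule measurable_from_subalg[OF F_sub W])
  note [measurable] = emp_r_meas
  let ?n = "real (CARD('s \<times> 'a))"
  let ?x = "\<lambda>s a \<omega>. ennreal (W \<omega>) * ennreal ((emp_r k \<omega> s a - r s a)\<^sup>2)"
  have "(\<integral>\<^sup>+\<omega>. ennreal (W \<omega>) * ennreal ((reward_err (emp_r k \<omega>))\<^sup>2) \<partial>M)
      \<le> (\<integral>\<^sup>+\<omega>. ennreal ?n * (\<Sum>s\<in>UNIV. \<Sum>a\<in>UNIV. ?x s a \<omega>) \<partial>M)"
  proof (rule nn_integral_mono)
    fix \<omega>
    have "ennreal (W \<omega>) * ennreal ((reward_err (emp_r k \<omega>))\<^sup>2)
        \<le> ennreal (W \<omega>) * ennreal (?n * (\<Sum>s\<in>UNIV. \<Sum>a\<in>UNIV. (emp_r k \<omega> s a - r s a)\<^sup>2))"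
      unfolding reward_err_def by (intro mult_left_mono ennreal_leI square_table_size_le) simp
    also have "\<dots> = ennreal ?n * (\<Sum>s\<in>UNIV. \<Sum>a\<in>UNIV. ?x s a \<omega>)"
      by (simp add: ennreal_mult' sum_nonneg sum_distrib_left mult.left_commute flip: sum_ennreal)
    finally show "ennreal (W \<omega>) * ennreal ((reward_err (emp_r k \<omega>))\<^sup>2) \<le> \<dots>" .
  qed
  also have "\<dots> = ennreal ?n * (\<Sum>s\<in>UNIV. \<Sum>a\<in>UNIV. \<integral>\<^sup>+\<omega>. ?x s a \<omega> \<partial>M)"
    by (simp add: nn_integral_cmult nn_integral_sum)
  also have "\<dots> \<le> ennreal ?n * (\<Sum>s\<in>UNIV. \<Sum>a\<in>UNIV.
      ennreal (avg_second noise_bound (q0 s a - r s a) / real (m k)) * (\<integral>\<^sup>+\<omega>. ennreal (W \<omega>) \<partial>M))"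
    using noisy_visits.visit_avg_second_moment[OF reward_noisy_visits WH]
    unfolding emp_r_error[symmetric] avg_second_def by (intro mult_left_mono sum_mono) auto
  also have "\<dots> = ennreal (reward_second noise_bound q0 / real (m k)) * (\<integral>\<^sup>+\<omega>. ennreal (W \<omega>) \<partial>M)"
    using m0 avg_second_nonneg[OF noise_bound_ge]
    by (simp add: reward_second_def ennreal_mult' sum_nonneg sum_distrib_right[symmetric] sum_divide_distrib[symmetric]
        mult.assoc[symmetric] times_divide_eq_right[symmetric] del: times_divide_eq_right)
  finally show ?thesis .
qed

lemma reward_err_fourth_moment:
  "(\<integral>\<^sup>+\<omega>. ennreal ((reward_err (emp_r k \<omega>)) ^ 4) \<partial>M) \<le> ennreal (reward_fourth noise_bound q0)"
proof -
  note [measurable] = emp_r_meas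
  let ?n = "real (CARD('s \<times> 'a)) ^ 3"
  let ?x = "\<lambda>s a \<omega>. ennreal ((emp_r k \<omega> s a - r s a) ^ 4)"
  have "(\<integral>\<^sup>+\<omega>. ennreal ((reward_err (emp_r k \<omega>)) ^ 4) \<partial>M)
      \<le> (\<integral>\<^sup>+\<omega>. ennreal ?n * (\<Sum>s\<in>UNIV. \<Sum>a\<in>UNIV. ?x s a \<omega>) \<partial>M)"
  proof (rule nn_integral_mono)
    fix \<omega>
    have "ennreal ((reward_err (emp_r k \<omega>)) ^ 4)
        \<le> ennreal (?n * (\<Sum>s\<in>UNIV. \<Sum>a\<in>UNIV. (emp_r k \<omega> s a - r s a) ^ 4))"
      unfolding reward_err_def by (intro ennreal_leI fourth_table_size_le)
    also have "\<dots> = ennreal ?n * (\<Sum>s\<in>UNIV. \<Sum>a\<in>UNIV. ?x s a \<omega>)"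
      by (simp add: ennreal_mult' sum_nonneg)
    finally show "ennreal ((reward_err (emp_r k \<omega>)) ^ 4) \<le> \<dots>" .
  qed
  also have "\<dots> = ennreal ?n * (\<Sum>s\<in>UNIV. \<Sum>a\<in>UNIV. \<integral>\<^sup>+\<omega>. ?x s a \<omega> \<partial>M)"
    by (simp add: nn_integral_cmult nn_integral_sum del: sum_ennreal)
  also have "\<dots> \<le> ennreal ?n * (\<Sum>s\<in>UNIV. \<Sum>a\<in>UNIV. ennreal (avg_fourth noise_bound (q0 s a - r s a)))"
    using noisy_visits.visit_avg_fourth_moment[OF reward_noisy_visits]
    unfolding emp_r_error[symmetric] avg_fourth_def by (intro mult_left_mono sum_mono) auto
  also have "\<dots> = ennreal (reward_fourth noise_bound q0)"
    using avg_fourth_nonneg[OF noise_bound_ge]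
    by (simp add: reward_fourth_def ennreal_mult' sum_nonneg)
  finally show ?thesis .
qed

end

section \<open>Moments of the iterates\<close>

lemma closed_policies: "closed (policies :: (real^'a::finite^'s::finite) set)"
  unfolding policies_def prob_vec_def
  by (intro closed_Collect_all closed_Collect_conj closed_Collect_le closed_Collect_eq continuous_intros)

text \<open>If \<open>f\<close> exceeded \<open>a\<close> at a limit of points of the sublevel set,
  the lower limit would exceed \<open>a\<close> at all nearby points of \<open>X\<close> other than
  the limit, and the limit itself exceeds \<open>a\<close> as well; some member of the sequence
  contradicts this.\<close>

lemma lsc_on_closed_sublevel:
  fixes f :: "'x::metric_space \<Rightarrow> ereal"
  assumes f: "lsc_on X f" and X: "closed X"
  shows "closed {x \<in> X. f x \<le> a}"
  unfolding closed_sequential_limits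
proof (intro allI impI)
  fix x :: "nat \<Rightarrow> 'x" and l
  assume A: "(\<forall>n. x n \<in> {x \<in> X. f x \<le> a}) \<and> x \<longlonglongrightarrow> l"
  then have l: "l \<in> X" using X closed_sequentially by blast
  have "f l \<le> a"
  proof (rule ccontr)
    assume "\<not> f l \<le> a"
    then have "a < Liminf (at l within X) f" using f l by (auto simp: lsc_on_def intro: less_le_trans)
    then have "eventually (\<lambda>y. a < f y) (at l within X)" by (rule less_LiminfD)
    then obtain T where T: "open T" "l \<in> T" "\<And>y. y \<in> T \<Longrightarrow> y \<noteq> l \<Longrightarrow> y \<in> X \<Longrightarrow> a < f y"
      by (auto simp: eventually_at_topological)
    have "eventually (\<lambda>n. x n \<in> T) sequentially" using A T topological_tendstoD by blast
    then obtain n where "x n \<in> T" by (auto simp: eventually_sequentially)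
    then show False using T(3)[of "x n"] A \<open>\<not> f l \<le> a\<close> by (metis (mono_tags, lifting) leD mem_Collect_eq)
  qed
  with l show "l \<in> {x \<in> X. f x \<le> a}" by simp
qed

text \<open>Gives measurability of the cost along the iterates: \<phi> is lower semicontinuous
  relative to the policies, and the random policy never leaves that closed set.\<close>

lemma borel_measurable_lsc_on_compose:
  fixes f :: "'x::metric_space \<Rightarrow> ereal"
  assumes f: "lsc_on X f" "closed X" and g: "g \<in> borel_measurable M" "\<And>\<omega>. \<omega> \<in> space M \<Longrightarrow> g \<omega> \<in> X"
  shows "(\<lambda>\<omega>. f (g \<omega>)) \<in> borel_measurable M"
proof (subst borel_measurable_iff_Iic_ereal, rule allI)
  fix a
  have "(\<lambda>\<omega>. f (g \<omega>)) -` {..a} \<inter> space M = g -` {x \<in> X. f x \<le> a} \<inter> space M" using g(2) by auto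
  also have "\<dots> \<in> sets M"
    by (rule measurable_sets[OF g(1)]) (use lsc_on_closed_sublevel[OF f] in auto)
  finally show "(\<lambda>\<omega>. f (g \<omega>)) -` {..a} \<inter> space M \<in> sets M" .
qed

lemma integrable_nonneg_nn_integral_le:
  assumes "f \<in> borel_measurable M" "\<And>x. 0 \<le> f x" "(\<integral>\<^sup>+x. ennreal (f x) \<partial>M) \<le> ennreal b" "0 \<le> b"
  shows "integrable M f" "(\<integral>x. f x \<partial>M) \<le> b"
proof -
  show int: "integrable M f"
    by (rule integrableI_nonneg) (use assms in \<open>auto intro: le_less_trans\<close>)
  show "(\<integral>x. f x \<partial>M) \<le> b"
    using assms by (subst (asm) nn_integral_eq_integral[OF int]) (auto simp: ennreal_le_iff)
qed

lemma integrable_abs_bound: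
  fixes f g :: "'w \<Rightarrow> real"
  assumes "integrable M g" "f \<in> borel_measurable M" "\<And>\<omega>. \<omega> \<in> space M \<Longrightarrow> \<bar>f \<omega>\<bar> \<le> g \<omega>"
  shows "integrable M f"
  by (rule Bochner_Integration.integrable_bound[OF assms(1,2)], rule AE_I2)
     (use assms(3) in \<open>auto intro: order_trans[OF _ abs_ge_self]\<close>)

lemma continuous_on_lagr:
  "continuous_on UNIV (\<lambda>x::(real^'a::finite^'s::finite) \<times> (real^'s) \<times> (real^'s). lagr c \<beta> \<gamma> p q (fst x) (fst (snd x)) (snd (snd x)))"
  unfolding lagr_def bell_res_alt trans_mat_def rew_vec_def matrix_vector_mult_def vec_lambda_beta
  by (intro continuous_intros continuous_on_vec_lambda)

section \<open>Growth of the Lagrangian and recursions for fourth powers\<close>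

context bellman_admm_setup
begin

lemma norm_res_le:
  assumes "valid p" "\<pi> \<in> policies"
  shows "norm (res p q \<pi> v) \<le> (1 + entries) * norm v + (reward_bound + reward_err q)"
proof -
  have "norm (res p q \<pi> v) \<le> norm v + norm (\<gamma> *\<^sub>R (trans_mat p \<pi> *v v)) + norm (rew_vec q \<pi>)"
    unfolding bell_res_alt by (intro order_trans[OF norm_triangle_ineq4] add_right_mono norm_triangle_ineq4)
  also have "norm (\<gamma> *\<^sub>R (trans_mat p \<pi> *v v)) \<le> norm (trans_mat p \<pi> *v v)"
    using discount by (simp add: mult_left_le_one_le)
  also have "\<dots> \<le> entries * norm v"
    using norm_trans_mat_policy[OF assms(2), of p v] valid_kernel_size[OF assms(1)] by simp
  finally show ?thesis
    using norm_rew_vec_emp[OF assms(2), of q] by (simp add: reward_err_def algebra_simps)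
qed

text \<open>For bounded policies the Lagrangian grows at most quadratically in the value, the
  multiplier and the reward error. Fourth powers are used as the majorant because those are the
  moments at hand.\<close>

lemma abs_lag_le:
  obtains C where "0 \<le> C" "\<And>p q \<pi> v l. valid p \<Longrightarrow> \<pi> \<in> policies \<Longrightarrow>
    \<bar>lag p q \<pi> v l\<bar> \<le> C * (1 + norm v ^ 4 + norm l ^ 4 + reward_err q ^ 4)"
proof
  define A where "A = 1 + entries + reward_bound"
  have A: "1 \<le> A" "1 + entries \<le> A" "reward_bound \<le> A"
    using entries_nonneg reward_bound_nonneg by (auto simp: A_def)
  define C where "C = 2 * norm c + 1 + (1 + \<beta>) * (9 * A\<^sup>2)"
  show "0 \<le> C" using \<beta>_pos by (simp add: C_def)
  fix p q and v l :: "real^'s" and \<pi> :: "real^'a^'s"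
  assume p: "valid p" and \<pi>: "\<pi> \<in> policies"
  let ?R = "norm (res p q \<pi> v)" and ?q = "reward_err q" and ?v = "norm v" and ?l = "norm l"
  define K where "K = 1 + ?v ^ 4 + ?l ^ 4 + ?q ^ 4"
  have p4: "0 \<le> ?v ^ 4" "0 \<le> ?l ^ 4" "0 \<le> ?q ^ 4" by simp_all
  have "?R \<le> (1 + entries) * ?v + (reward_bound + ?q)" by (rule norm_res_le[OF p \<pi>])
  also have "\<dots> \<le> A * ?v + (A + A * ?q)"
    using A reward_err_nonneg[of q] by (intro add_mono mult_right_mono) (auto simp: mult_le_cancel_right1)
  also have "\<dots> = A * (1 + ?v + ?q)" by (simp add: algebra_simps)
  finally have "?R\<^sup>2 \<le> (A * (1 + ?v + ?q))\<^sup>2" by (rule power_mono) simp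
  also have "\<dots> \<le> A\<^sup>2 * (3 * (1\<^sup>2 + ?v\<^sup>2 + ?q\<^sup>2))"
    unfolding power_mult_distrib[of A] by (intro mult_left_mono square_sum3) simp
  also have "\<dots> \<le> A\<^sup>2 * (9 * K)"
  proof (intro mult_left_mono)
    show "3 * (1\<^sup>2 + ?v\<^sup>2 + ?q\<^sup>2) \<le> 9 * K"
    proof -
      have "a \<le> 1 + x \<Longrightarrow> b \<le> 1 + y \<Longrightarrow> 0 \<le> x \<Longrightarrow> 0 \<le> y \<Longrightarrow> 0 \<le> z \<Longrightarrow> 3 * (1 + a + b) \<le> 9 * (1 + x + z + y)"
        for a b x y z :: real by simp
      from this[OF square_le_one_plus_fourth[of ?v] square_le_one_plus_fourth[of ?q] p4(1,3,2)]
      show ?thesis unfolding K_def power_one .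
    qed
  qed simp
  finally have R: "?R\<^sup>2 \<le> 9 * A\<^sup>2 * K" by simp
  have v1: "?v \<le> 2 * K"
  proof -
    have "w \<le> (1 + s) / 2 \<Longrightarrow> s \<le> 1 + x \<Longrightarrow> 0 \<le> x \<Longrightarrow> 0 \<le> y \<Longrightarrow> 0 \<le> z \<Longrightarrow> w \<le> 2 * (1 + x + y + z)"
      for s w x y z :: real by simp
    from this[OF _ square_le_one_plus_fourth[of ?v] p4] show ?thesis
      using mult_le_mean_square[of 1 ?v] by (simp add: K_def)
  qed
  have l2: "?l\<^sup>2 \<le> K" by (rule order_trans[OF square_le_one_plus_fourth]) (simp add: K_def)
  have "\<bar>c \<bullet> v\<bar> \<le> norm c * (2 * K)"
    by (rule order_trans[OF Cauchy_Schwarz_ineq2 mult_left_mono[OF v1]]) simp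
  moreover have "\<bar>l \<bullet> res p q \<pi> v\<bar> \<le> (K + 9 * A\<^sup>2 * K) / 2"
  proof -
    have "x \<le> n \<Longrightarrow> n \<le> (a + b) / 2 \<Longrightarrow> b \<le> B \<Longrightarrow> a \<le> K \<Longrightarrow> x \<le> (K + B) / 2" for a b n x B K :: real by simp
    from this[OF Cauchy_Schwarz_ineq2 mult_le_mean_square R l2] show ?thesis .
  qed
  moreover have "\<bar>\<beta> / 2 * ?R\<^sup>2\<bar> \<le> \<beta> / 2 * (9 * A\<^sup>2 * K)"
    using \<beta>_pos R by (auto simp: abs_mult intro!: mult_left_mono)
  moreover have "0 \<le> K" "0 \<le> 9 * A\<^sup>2 * K" "0 \<le> \<beta> * (9 * A\<^sup>2 * K)" using p4 \<beta>_pos by (auto simp: K_def)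
  moreover have "C * K = norm c * (2 * K) + K + (9 * A\<^sup>2 * K) + \<beta> * (9 * A\<^sup>2 * K)"
    by (simp add: C_def algebra_simps)
  ultimately have "\<bar>c \<bullet> v\<bar> + \<bar>l \<bullet> res p q \<pi> v\<bar> + \<bar>\<beta> / 2 * ?R\<^sup>2\<bar> \<le> C * K" by simp
  then show "\<bar>lag p q \<pi> v l\<bar> \<le> C * (1 + ?v ^ 4 + ?l ^ 4 + ?q ^ 4)"
    unfolding K_def lagr_def by linarith
qed

definition value_drift :: "real \<Rightarrow> real" where
  "value_drift e4 = 216 * (((60/59) * (\<kappa> * reward_bound + 2 * (\<kappa>\<^sup>2 * norm c / \<beta>))) ^ 4 + ((60/59) * \<kappa>) ^ 4 * e4)"

definition first_value_bound :: "real \<Rightarrow> real" where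
  "first_value_bound e4 = 216 * (((60/59) * (\<kappa> * reward_bound + \<kappa>\<^sup>2 * norm c / \<beta>)) ^ 4 + ((60/59) * \<kappa>) ^ 4 * e4)
    + 27 * (((60/59) * \<kappa> / \<beta>) ^ 4 * (\<integral>x. norm (snd x) ^ 4 \<partial>\<mu>0) + (\<integral>x. norm (fst x) ^ 4 \<partial>\<mu>0))"

text \<open>A level invariant under x \<mapsto> drift + x/4 + x/4: at least twice the drift and
  above the two starting moments. These are read off \<open>\<mu>0\<close>, so the level is
  independent of the run.\<close>

definition value_moment :: "real \<Rightarrow> real" where
  "value_moment e4 = max (\<integral>x. norm (fst x) ^ 4 \<partial>\<mu>0) (max (first_value_bound e4) (2 * value_drift e4))"

text \<open>Convexity of the fourth power costs 27, and 8 more inside the constant part, hence 216.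
  The factor 27 is far outweighed by (2/59)^4, so the weights 1/4 and 1/4 sum to less than
  1.\<close>

lemma value_fourth:
  assumes "valid p0'" "valid p" "\<pi> \<in> policies" "\<pi>' \<in> policies"
    and "dual_at p0' \<pi> v0 v l" "dual_at p \<pi>' v v1 l1" "l1 = l + \<beta> *\<^sub>R res p q \<pi>' v1"
  shows "norm v1 ^ 4 \<le> value_drift (reward_err q ^ 4) + 1/4 * norm v ^ 4 + 1/4 * norm v0 ^ 4"
proof -
  let ?a = "(60/59) * (\<kappa> * reward_bound + 2 * (\<kappa>\<^sup>2 * norm c / \<beta>))" and ?b = "(60/59) * \<kappa> * reward_err q"
  have "norm v1 \<le> (?a + ?b) + 2 / 59 * norm v + 1 / 59 * norm v0"
  proof -
    have "x \<le> (60/59) * (k * (R + e) + T) + (2 * y + z) / 59 \<Longrightarrow>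
        x \<le> ((60/59) * (k * R + T) + (60/59) * k * e) + 2 / 59 * y + 1 / 59 * z" for k R T e x y z :: real
      by (simp add: algebra_simps add_divide_distrib)
    from this[OF value_norm[OF assms]] show ?thesis unfolding reward_err_def .
  qed
  then have "norm v1 ^ 4 \<le> ((?a + ?b) + 2 / 59 * norm v + 1 / 59 * norm v0) ^ 4" by (rule power_mono) simp
  also have "\<dots> \<le> 27 * ((?a + ?b) ^ 4 + (2 / 59 * norm v) ^ 4 + (1 / 59 * norm v0) ^ 4)" by (rule fourth_sum3)
  also have "\<dots> \<le> 27 * (8 * (?a ^ 4 + ?b ^ 4) + (2 / 59) ^ 4 * norm v ^ 4 + (1 / 59) ^ 4 * norm v0 ^ 4)"
    unfolding power_mult_distrib[of _ "norm v"] power_mult_distrib[of _ "norm v0"]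
    by (intro mult_left_mono add_right_mono fourth_sum2) simp
  also have "\<dots> \<le> 216 * (?a ^ 4 + ?b ^ 4) + 1/4 * norm v ^ 4 + 1/4 * norm v0 ^ 4"
  proof -
    have "0 \<le> x \<Longrightarrow> 0 \<le> y \<Longrightarrow> 27 * (8 * z + (2 / 59) ^ 4 * x + (1 / 59) ^ 4 * y) \<le> 216 * z + 1/4 * x + 1/4 * y"
      for x y z :: real by (simp add: power_divide)
    then show ?thesis by simp
  qed
  also have "?b ^ 4 = ((60/59) * \<kappa>) ^ 4 * reward_err q ^ 4" by (rule power_mult_distrib)
  finally show ?thesis unfolding value_drift_def .
qed

text \<open>Applied only once, so the contraction factor 1/59 is generously relaxed to 1.\<close>

lemma first_value_fourth:
  assumes "valid p" "\<pi>' \<in> policies" "dual_at p \<pi>' v v1 l1" "l1 = l + \<beta> *\<^sub>R res p q \<pi>' v1"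
  shows "norm v1 ^ 4 \<le> 216 * (((60/59) * (\<kappa> * reward_bound + \<kappa>\<^sup>2 * norm c / \<beta>)) ^ 4 + ((60/59) * \<kappa>) ^ 4 * reward_err q ^ 4)
    + 27 * (((60/59) * \<kappa> / \<beta>) ^ 4 * norm l ^ 4 + norm v ^ 4)"
proof -
  let ?a = "(60/59) * (\<kappa> * reward_bound + \<kappa>\<^sup>2 * norm c / \<beta>)" and ?b = "(60/59) * \<kappa> * reward_err q"
  have "norm v1 \<le> (?a + ?b) + (60/59) * \<kappa> / \<beta> * norm l + 1 * norm v"
  proof -
    have "x \<le> (60/59) * (k * (R + e) + T + k / b * w) + y / 59 \<Longrightarrow> 0 \<le> y \<Longrightarrow>
        x \<le> ((60/59) * (k * R + T) + (60/59) * k * e) + (60/59) * k / b * w + 1 * y" for b k R T e w x y :: real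
      by (simp add: algebra_simps add_divide_distrib)
    from this[OF first_value_norm[OF assms] norm_ge_zero] show ?thesis unfolding reward_err_def .
  qed
  then have "norm v1 ^ 4 \<le> ((?a + ?b) + (60/59) * \<kappa> / \<beta> * norm l + 1 * norm v) ^ 4" by (rule power_mono) simp
  also have "\<dots> \<le> 27 * ((?a + ?b) ^ 4 + ((60/59) * \<kappa> / \<beta> * norm l) ^ 4 + (1 * norm v) ^ 4)" by (rule fourth_sum3)
  also have "\<dots> \<le> 27 * (8 * (?a ^ 4 + ?b ^ 4) + ((60/59) * \<kappa> / \<beta>) ^ 4 * norm l ^ 4 + norm v ^ 4)"
    unfolding power_mult_distrib[of _ "norm l"] mult_1
    by (intro mult_left_mono add_right_mono fourth_sum2) simp
  also have "?b ^ 4 = ((60/59) * \<kappa>) ^ 4 * reward_err q ^ 4" by (rule power_mult_distrib)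
  finally show ?thesis by (simp add: algebra_simps)
qed

lemma dual_fourth:
  assumes "valid p" "\<pi> \<in> policies" "dual_at p \<pi> v0 v l"
  shows "norm l ^ 4 \<le> 27 * ((\<kappa> * norm c) ^ 4 + (\<kappa> / \<eta>_val) ^ 4 * norm v ^ 4 + (\<kappa> / \<eta>_val) ^ 4 * norm v0 ^ 4)"
proof -
  have "\<kappa> / \<eta>_val * norm (v - v0) \<le> \<kappa> / \<eta>_val * (norm v + norm v0)"
    using \<kappa>_nonneg step_sizes by (intro mult_left_mono norm_triangle_ineq4) auto
  then have "norm l \<le> \<kappa> * norm c + \<kappa> / \<eta>_val * norm v + \<kappa> / \<eta>_val * norm v0"
    using dual_norm[OF assms] by (simp add: distrib_left)
  then have "norm l ^ 4 \<le> (\<kappa> * norm c + \<kappa> / \<eta>_val * norm v + \<kappa> / \<eta>_val * norm v0) ^ 4" by (rule power_mono) simp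
  also note fourth_sum3
  finally show ?thesis by (simp only: power_mult_distrib[of "\<kappa> / \<eta>_val"])
qed

end

section \<open>Finiteness, measurability and moments along a run\<close>

context bellman_admm_run
begin

lemma emp_P_valid:
  assumes "\<omega> \<in> space M"
  shows "valid (emp_P k \<omega>)"
  unfolding valid_def
proof (intro conjI allI ballI)
  fix s a
  let ?V = "visits (m k) (S k) (A k) (U k) \<omega> s a"
  show "prob_vec (emp_P k \<omega> s a)"
  proof (cases "?V = {}")
    case True
    then have "emp_P k \<omega> s a = p0 s a" by (simp add: emp_trans_def fun_eq_iff)
    then show ?thesis using p0_stochastic by simp
  next
    case False
    have fin: "finite ?V" by (rule finite_visits)
    have "(\<Sum>s'\<in>UNIV. real (card {t \<in> ?V. S k (Suc t) \<omega> = s'})) = real (card ?V)"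
      using sum.group[OF fin finite, of "\<lambda>t. S k (Suc t) \<omega>" UNIV "\<lambda>_. 1 :: real"] by simp
    then show ?thesis using False fin
      by (simp add: prob_vec_def emp_trans_def sum_divide_distrib[symmetric])
  qed
qed (rule emp_inverse_bound[OF assms])

lemma \<phi>_not_minus_infinity: "\<pi> \<in> policies \<Longrightarrow> \<phi> \<pi> \<noteq> - \<infinity>"
  using \<phi>_proper by (simp add: proper_on_def)

definition cost :: "nat \<Rightarrow> 'w \<Rightarrow> real" where
  "cost k \<omega> = real_of_ereal (\<phi> (pol k \<omega>))"

lemma pol_policy: "\<omega> \<in> space M \<Longrightarrow> pol k \<omega> \<in> policies"
  using pol_step[of \<omega> "k - 1"] pol_init[of \<omega>] pol0_dom by (cases k) (auto simp: is_arg_min_def)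

lemma aug_lag_ereal: "\<phi> \<pi> = ereal f \<Longrightarrow> aug_lag \<phi> c \<beta> \<gamma> p q \<pi> v l = ereal (f + lag p q \<pi> v l)"
  by (simp add: aug_lag_eq)

lemma pol0_cost: "\<phi> pol0 = ereal (real_of_ereal (\<phi> pol0))"
  using pol0_dom \<phi>_not_minus_infinity[of pol0] by (cases "\<phi> pol0") auto

text \<open>The initial policy has finite cost and competes in every policy subproblem, so the
  minimiser cannot have infinite cost.\<close>

lemma cost_eq:
  assumes \<omega>: "\<omega> \<in> space M"
  shows "\<phi> (pol k \<omega>) = ereal (cost k \<omega>)"
proof -
  have "\<phi> (pol k \<omega>) \<noteq> \<infinity>"
  proof (cases k)
    case 0
    then show ?thesis using pol_init[OF \<omega>] pol0_dom by simp
  next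
    case (Suc j)
    let ?f = "\<lambda>\<pi>. aug_lag \<phi> c \<beta> \<gamma> (emp_P j \<omega>) (emp_r j \<omega>) \<pi> (V j \<omega>) (lam j \<omega>)
        + ereal (1 / (2 * \<eta>_pol) * (norm (\<pi> - pol j \<omega>))\<^sup>2)"
    have "\<not> ?f pol0 < ?f (pol k \<omega>)"
      using pol_step[OF \<omega>, of j] pol0_dom(1) by (simp add: is_arg_min_def Suc)
    moreover have "?f pol0 < \<infinity>" by (simp add: aug_lag_ereal[OF pol0_cost])
    ultimately have "?f (pol k \<omega>) \<noteq> \<infinity>" by auto
    then show ?thesis by (auto simp: aug_lag_def)
  qed
  then show ?thesis
    using \<phi>_not_minus_infinity[OF pol_policy[OF \<omega>, of k]] by (cases "\<phi> (pol k \<omega>)") (auto simp: cost_def)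
qed

text \<open>The competitor is left open: the current policy gives the descent inequality, the
  initial policy gives the integrability of the cost.\<close>

lemma pol_step_real:
  assumes \<omega>: "\<omega> \<in> space M" and y: "y \<in> policies" "\<phi> y = ereal f"
  shows "cost (Suc k) \<omega> + lag (emp_P k \<omega>) (emp_r k \<omega>) (pol (Suc k) \<omega>) (V k \<omega>) (lam k \<omega>)
      + 1 / (2 * \<eta>_pol) * (norm (pol (Suc k) \<omega> - pol k \<omega>))\<^sup>2
    \<le> f + lag (emp_P k \<omega>) (emp_r k \<omega>) y (V k \<omega>) (lam k \<omega>) + 1 / (2 * \<eta>_pol) * (norm (y - pol k \<omega>))\<^sup>2"
  using pol_step[OF \<omega>, of k] y(1)
  by (auto simp: is_arg_min_def aug_lag_ereal[OF y(2)] aug_lag_ereal[OF cost_eq[OF \<omega>]] not_less dest!: spec[of _ y])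

lemma V_step_real:
  assumes \<omega>: "\<omega> \<in> space M"
  shows "lag (emp_P k \<omega>) (emp_r k \<omega>) (pol (Suc k) \<omega>) (V (Suc k) \<omega>) (lam k \<omega>)
      + 1 / (2 * \<eta>_val) * (norm (V (Suc k) \<omega> - V k \<omega>))\<^sup>2
    \<le> lag (emp_P k \<omega>) (emp_r k \<omega>) (pol (Suc k) \<omega>) w (lam k \<omega>) + 1 / (2 * \<eta>_val) * (norm (w - V k \<omega>))\<^sup>2"
  using V_step[OF \<omega>, of k]
  by (auto simp: is_arg_min_def aug_lag_ereal[OF cost_eq[OF \<omega>]] not_less dest!: spec[of _ w])

lemma dual_run:
  "\<omega> \<in> space M \<Longrightarrow> dual_at (emp_P k \<omega>) (pol (Suc k) \<omega>) (V k \<omega>) (V (Suc k) \<omega>) (lam (Suc k) \<omega>)"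
  using value_step(1)[OF V_step_real lam_step] by blast

lemma pol_meas_M [measurable]: "pol k \<in> borel_measurable M"
  and V_meas_M [measurable]: "V k \<in> borel_measurable M"
  and lam_meas_M [measurable]: "lam k \<in> borel_measurable M"
  by (rule measurable_from_subalg[OF F_sub pol_meas] measurable_from_subalg[OF F_sub V_meas]
      measurable_from_subalg[OF F_sub lam_meas])+

lemma cost_meas [measurable]: "cost k \<in> borel_measurable M"
  unfolding cost_def
  by (intro borel_measurable_real_of_ereal borel_measurable_lsc_on_compose[OF \<phi>_lsc closed_policies] pol_meas_M pol_policy)

lemma lag_meas [measurable]: "(\<lambda>\<omega>. lag P r (pol k \<omega>) (V k \<omega>) (lam k \<omega>)) \<in> borel_measurable M"
proof -
  have "(\<lambda>\<omega>. (pol k \<omega>, V k \<omega>, lam k \<omega>)) \<in> borel_measurable M" by (intro borel_measurable_Pair pol_meas_M V_meas_M lam_meas_M)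
  from borel_measurable_continuous_on[OF continuous_on_lagr this] show ?thesis by simp
qed

lemma reward_err_fourth_integrable:
  "integrable M (\<lambda>\<omega>. reward_err (emp_r k \<omega>) ^ 4)"
  "(\<integral>\<omega>. reward_err (emp_r k \<omega>) ^ 4 \<partial>M) \<le> reward_fourth noise_bound q0"
  using integrable_nonneg_nn_integral_le[OF _ _ reward_err_fourth_moment reward_fourth_nonneg[OF noise_bound_ge]]
  by (auto simp del: power_even_abs)

abbreviation fourth_bound :: real where
  "fourth_bound \<equiv> value_moment (reward_fourth noise_bound q0)"

lemma initial_fourth_moments:
  "integrable M (\<lambda>\<omega>. norm (V 0 \<omega>) ^ 4)" "(\<integral>\<omega>. norm (V 0 \<omega>) ^ 4 \<partial>M) = (\<integral>x. norm (fst x) ^ 4 \<partial>\<mu>0)"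
  "integrable M (\<lambda>\<omega>. norm (lam 0 \<omega>) ^ 4)" "(\<integral>\<omega>. norm (lam 0 \<omega>) ^ 4 \<partial>M) = (\<integral>x. norm (snd x) ^ 4 \<partial>\<mu>0)"
proof -
  have T: "(\<lambda>\<omega>. (V 0 \<omega>, lam 0 \<omega>)) \<in> measurable M borel" by (intro borel_measurable_Pair V_meas_M lam_meas_M)
  have f: "(\<lambda>x::(real^'s) \<times> (real^'s). norm (fst x) ^ 4) \<in> borel_measurable borel"
    "(\<lambda>x::(real^'s) \<times> (real^'s). norm (snd x) ^ 4) \<in> borel_measurable borel"
    by (intro borel_measurable_continuous_onI continuous_intros)+
  show "integrable M (\<lambda>\<omega>. norm (V 0 \<omega>) ^ 4)" "(\<integral>\<omega>. norm (V 0 \<omega>) ^ 4 \<partial>M) = (\<integral>x. norm (fst x) ^ 4 \<partial>\<mu>0)"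
    "integrable M (\<lambda>\<omega>. norm (lam 0 \<omega>) ^ 4)" "(\<integral>\<omega>. norm (lam 0 \<omega>) ^ 4 \<partial>M) = (\<integral>x. norm (snd x) ^ 4 \<partial>\<mu>0)"
    using \<mu>0_moment integrable_distr_eq[OF T f(1)] integral_distr[OF T f(1)]
      integrable_distr_eq[OF T f(2)] integral_distr[OF T f(2)]
    by (auto simp: V_lam_init)
qed

text \<open>The recursion has order two, so the induction is strong; the indices 0 and 1 are
  separate because stationarity of the multiplier is available only after the first update.\<close>

lemma value_fourth_moment:
  "integrable M (\<lambda>\<omega>. norm (V k \<omega>) ^ 4) \<and> (\<integral>\<omega>. norm (V k \<omega>) ^ 4 \<partial>M) \<le> fourth_bound"
proof (induction k rule: less_induct)
  case (less k)
  let ?e4 = "\<integral>\<omega>. reward_err (emp_r (k - 1) \<omega>) ^ 4 \<partial>M"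
  note e4 = reward_err_fourth_integrable[of "k - 1"]
  consider "k = 0" | "k = 1" | j where "k = Suc (Suc j)" by (metis One_nat_def not0_implies_Suc)
  then show ?case
  proof cases
    case 1
    then show ?thesis using initial_fourth_moments by (simp add: value_moment_def)
  next
    case 2
    let ?g = "\<lambda>\<omega>. 216 * (((60/59) * (\<kappa> * reward_bound + \<kappa>\<^sup>2 * norm c / \<beta>)) ^ 4
        + ((60/59) * \<kappa>) ^ 4 * reward_err (emp_r (k - 1) \<omega>) ^ 4)
        + 27 * (((60/59) * \<kappa> / \<beta>) ^ 4 * norm (lam 0 \<omega>) ^ 4 + norm (V 0 \<omega>) ^ 4)"
    have le: "norm (V k \<omega>) ^ 4 \<le> ?g \<omega>" if "\<omega> \<in> space M" for \<omega>
      using first_value_fourth[OF emp_P_valid[OF that] pol_policy[OF that] dual_run[OF that] lam_step[OF that]]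
      unfolding 2 by simp
    have intg: "integrable M ?g"
      using e4(1) initial_fourth_moments by (intro Bochner_Integration.integrable_add integrable_mult_right) auto
    have int: "integrable M (\<lambda>\<omega>. norm (V k \<omega>) ^ 4)"
      by (rule integrable_abs_bound[OF intg]) (use le in simp_all)
    have "(\<integral>\<omega>. norm (V k \<omega>) ^ 4 \<partial>M) \<le> (\<integral>\<omega>. ?g \<omega> \<partial>M)" by (rule integral_mono[OF int intg le])
    also have "\<dots> = 216 * (((60/59) * (\<kappa> * reward_bound + \<kappa>\<^sup>2 * norm c / \<beta>)) ^ 4 + ((60/59) * \<kappa>) ^ 4 * ?e4)
        + 27 * (((60/59) * \<kappa> / \<beta>) ^ 4 * (\<integral>x. norm (snd x) ^ 4 \<partial>\<mu>0) + (\<integral>x. norm (fst x) ^ 4 \<partial>\<mu>0))"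
      using e4(1) initial_fourth_moments by (simp add: prob_space)
    also have "\<dots> \<le> first_value_bound (reward_fourth noise_bound q0)"
      unfolding first_value_bound_def using e4(2) by (intro add_right_mono mult_left_mono add_left_mono) auto
    also have "\<dots> \<le> fourth_bound" by (simp add: value_moment_def)
    finally show ?thesis using int by simp
  next
    case (3 j)
    let ?g = "\<lambda>\<omega>. value_drift (reward_err (emp_r (k - 1) \<omega>) ^ 4) + 1/4 * norm (V (Suc j) \<omega>) ^ 4 + 1/4 * norm (V j \<omega>) ^ 4"
    have le: "norm (V k \<omega>) ^ 4 \<le> ?g \<omega>" if "\<omega> \<in> space M" for \<omega>
      using value_fourth[OF emp_P_valid[OF that] emp_P_valid[OF that] pol_policy[OF that] pol_policy[OF that]
          dual_run[OF that] dual_run[OF that] lam_step[OF that]]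
      unfolding 3 by simp
    have IH: "integrable M (\<lambda>\<omega>. norm (V (Suc j) \<omega>) ^ 4)" "(\<integral>\<omega>. norm (V (Suc j) \<omega>) ^ 4 \<partial>M) \<le> fourth_bound"
      "integrable M (\<lambda>\<omega>. norm (V j \<omega>) ^ 4)" "(\<integral>\<omega>. norm (V j \<omega>) ^ 4 \<partial>M) \<le> fourth_bound"
      using less.IH[of "Suc j"] less.IH[of j] 3 by auto
    have intd: "integrable M (\<lambda>\<omega>. value_drift (reward_err (emp_r (k - 1) \<omega>) ^ 4))"
      unfolding value_drift_def using e4(1) by simp
    have intg: "integrable M ?g"
      using intd IH by (intro Bochner_Integration.integrable_add integrable_mult_right) auto
    have int: "integrable M (\<lambda>\<omega>. norm (V k \<omega>) ^ 4)"
      by (rule integrable_abs_bound[OF intg]) (use le in simp_all)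
    have "(\<integral>\<omega>. norm (V k \<omega>) ^ 4 \<partial>M) \<le> (\<integral>\<omega>. ?g \<omega> \<partial>M)" by (rule integral_mono[OF int intg le])
    also have "\<dots> = (\<integral>\<omega>. value_drift (reward_err (emp_r (k - 1) \<omega>) ^ 4) \<partial>M)
        + 1/4 * (\<integral>\<omega>. norm (V (Suc j) \<omega>) ^ 4 \<partial>M) + 1/4 * (\<integral>\<omega>. norm (V j \<omega>) ^ 4 \<partial>M)"
      using intd IH by simp
    also have "(\<integral>\<omega>. value_drift (reward_err (emp_r (k - 1) \<omega>) ^ 4) \<partial>M) = value_drift ?e4"
      unfolding value_drift_def using e4(1) by (simp add: prob_space)
    also have "value_drift ?e4 \<le> value_drift (reward_fourth noise_bound q0)"
      unfolding value_drift_def using e4(2) by (intro mult_left_mono add_left_mono) auto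
    \<comment> \<open>The definition of \<open>value_moment\<close> makes the drift at most half of
      the level, and the two lagged terms contribute the other half.\<close>
    also have "\<dots> \<le> 1/2 * fourth_bound" by (simp add: value_moment_def)
    finally show ?thesis using int IH by simp
  qed
qed

lemma lam_fourth_integrable: "integrable M (\<lambda>\<omega>. norm (lam k \<omega>) ^ 4)"
proof (cases k)
  case 0
  then show ?thesis using initial_fourth_moments by simp
next
  case (Suc j)
  let ?g = "\<lambda>\<omega>. 27 * ((\<kappa> * norm c) ^ 4 + (\<kappa> / \<eta>_val) ^ 4 * norm (V (Suc j) \<omega>) ^ 4 + (\<kappa> / \<eta>_val) ^ 4 * norm (V j \<omega>) ^ 4)"
  have le: "norm (lam k \<omega>) ^ 4 \<le> ?g \<omega>" if "\<omega> \<in> space M" for \<omega>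
    using dual_fourth[OF emp_P_valid[OF that] pol_policy[OF that] dual_run[OF that]] unfolding Suc .
  have "integrable M ?g"
    using value_fourth_moment by (intro Bochner_Integration.integrable_add integrable_mult_right) auto
  then show ?thesis
    by (rule integrable_abs_bound) (use le in simp_all)
qed

end

section \<open>Expected descent\<close>

context bellman_admm_run
begin

definition merit_real :: "nat \<Rightarrow> 'w \<Rightarrow> real" where
  "merit_real k \<omega> = cost k \<omega> + lag P r (pol k \<omega>) (V k \<omega>) (lam k \<omega>)
    + 1 / (8 * \<eta>_val) * (norm (incr V k \<omega>))\<^sup>2"

section \<open>Integrability of the merit function and passage to expectations\<close>

lemma merit_eq:
  "\<omega> \<in> space M \<Longrightarrow> merit \<phi> c \<beta> \<gamma> P r (1 / (8 * \<eta>_val)) pol V lam k \<omega> = ereal (merit_real k \<omega>)"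
  by (simp add: merit_def aug_lag_ereal[OF cost_eq] merit_real_def)

lemma incr_Suc: "incr X (Suc k) \<omega> = X (Suc k) \<omega> - X k \<omega>"
  by (simp add: incr_def)

lemma incr_pol_square_integrable: "integrable M (\<lambda>\<omega>. (norm (incr pol (Suc k) \<omega>))\<^sup>2)"
  unfolding incr_Suc
proof (rule integrable_abs_bound)
  show "integrable M (\<lambda>\<omega>. (2 * entries)\<^sup>2)" by simp
  show "\<bar>(norm (pol (Suc k) \<omega> - pol k \<omega>))\<^sup>2\<bar> \<le> (2 * entries)\<^sup>2" if "\<omega> \<in> space M" for \<omega>
    using power_mono[OF norm_policy_diff_entries[OF pol_policy[OF that] pol_policy[OF that]] norm_ge_zero, of "Suc k" k 2]
    by simp
qed measurable

lemma incr_V_square_integrable: "integrable M (\<lambda>\<omega>. (norm (incr V (Suc k) \<omega>))\<^sup>2)"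
  unfolding incr_Suc
proof (rule integrable_abs_bound)
  show "integrable M (\<lambda>\<omega>. 2 * ((1 + norm (V (Suc k) \<omega>) ^ 4) + (1 + norm (V k \<omega>) ^ 4)))"
    using value_fourth_moment by (intro integrable_mult_right Bochner_Integration.integrable_add) auto
  fix \<omega>
  have "(norm (V (Suc k) \<omega> - V k \<omega>))\<^sup>2 \<le> (norm (V (Suc k) \<omega>) + norm (V k \<omega>))\<^sup>2"
    by (intro power_mono norm_triangle_ineq4) simp
  also have "\<dots> \<le> 2 * ((norm (V (Suc k) \<omega>))\<^sup>2 + (norm (V k \<omega>))\<^sup>2)" by (rule square_sum2)
  also have "\<dots> \<le> 2 * ((1 + norm (V (Suc k) \<omega>) ^ 4) + (1 + norm (V k \<omega>) ^ 4))"
    by (intro mult_left_mono add_mono square_le_one_plus_fourth) simp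
  finally show "\<bar>(norm (V (Suc k) \<omega> - V k \<omega>))\<^sup>2\<bar> \<le> 2 * ((1 + norm (V (Suc k) \<omega>) ^ 4) + (1 + norm (V k \<omega>) ^ 4))"
    by simp
qed measurable

lemma lag_integrable: "integrable M (\<lambda>\<omega>. lag P r (pol k \<omega>) (V k \<omega>) (lam k \<omega>))"
proof -
  obtain C where C: "\<And>p q \<pi> v l. valid p \<Longrightarrow> \<pi> \<in> policies \<Longrightarrow>
    \<bar>lag p q \<pi> v l\<bar> \<le> C * (1 + norm v ^ 4 + norm l ^ 4 + reward_err q ^ 4)"
    by (rule abs_lag_le) blast
  show ?thesis
  proof (rule integrable_abs_bound[OF _ lag_meas C[OF valid_P pol_policy]])
    show "integrable M (\<lambda>\<omega>. C * (1 + norm (V k \<omega>) ^ 4 + norm (lam k \<omega>) ^ 4 + reward_err r ^ 4))"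
      using value_fourth_moment lam_fourth_integrable
      by (intro integrable_mult_right Bochner_Integration.integrable_add) auto
  qed
qed

text \<open>Nothing bounds \<phi> from above on the policies. The upper bound comes from comparing
  the minimiser with \<open>pol0\<close>, at the price of two Lagrangian values and a bounded
  proximal term; the lower bound is that of \<phi>.\<close>

lemma cost_integrable: "integrable M (cost (Suc k))"
proof -
  obtain C where C: "\<And>p q \<pi> v l. valid p \<Longrightarrow> \<pi> \<in> policies \<Longrightarrow>
    \<bar>lag p q \<pi> v l\<bar> \<le> C * (1 + norm v ^ 4 + norm l ^ 4 + reward_err q ^ 4)"
    by (rule abs_lag_le) blast
  obtain b where b: "\<And>\<pi>. \<pi> \<in> policies \<Longrightarrow> ereal b \<le> \<phi> \<pi>"
    using \<phi>_bdd_below by (auto simp: bdd_below_on_def)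
  define f0 where "f0 = real_of_ereal (\<phi> pol0)"
  define D where "D = 1 / (2 * \<eta>_pol) * (2 * entries)\<^sup>2"
  let ?B = "\<lambda>\<omega>. C * (1 + norm (V k \<omega>) ^ 4 + norm (lam k \<omega>) ^ 4 + reward_err (emp_r k \<omega>) ^ 4)"
  show ?thesis
  proof (rule integrable_abs_bound)
    show "integrable M (\<lambda>\<omega>. \<bar>b\<bar> + (\<bar>f0\<bar> + D) + 2 * ?B \<omega>)"
      using value_fourth_moment lam_fourth_integrable reward_err_fourth_integrable
      by (intro integrable_mult_right Bochner_Integration.integrable_add) auto
    fix \<omega> assume \<omega>: "\<omega> \<in> space M"
    have "b \<le> cost (Suc k) \<omega>" using b[OF pol_policy[OF \<omega>, of "Suc k"]] by (simp add: cost_eq[OF \<omega>])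
    moreover have "cost (Suc k) \<omega> \<le> f0 + 2 * ?B \<omega> + D"
    proof -
      have "1 / (2 * \<eta>_pol) * (norm (pol0 - pol k \<omega>))\<^sup>2 \<le> D"
        unfolding D_def using step_sizes norm_policy_diff_entries[OF pol_policy[OF \<omega>] pol0_dom(1)]
        by (intro mult_left_mono power_mono) auto
      moreover have "0 \<le> 1 / (2 * \<eta>_pol) * (norm (pol (Suc k) \<omega> - pol k \<omega>))\<^sup>2" using step_sizes by simp
      ultimately show ?thesis
        using pol_step_real[OF \<omega> pol0_dom(1) pol0_cost, of k, folded f0_def]
          C[OF emp_P_valid[OF \<omega>] pol_policy[OF \<omega>], of k "emp_r k \<omega>" "Suc k" "V k \<omega>" "lam k \<omega>"]
          C[OF emp_P_valid[OF \<omega>] pol0_dom(1), of k "emp_r k \<omega>" "V k \<omega>" "lam k \<omega>"]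
        by linarith
    qed
    moreover have "0 \<le> ?B \<omega>"
      using C[OF emp_P_valid[OF \<omega>] pol0_dom(1), of k "emp_r k \<omega>" "V k \<omega>" "lam k \<omega>"] by linarith
    moreover have "0 \<le> D" using step_sizes by (simp add: D_def)
    ultimately show "\<bar>cost (Suc k) \<omega>\<bar> \<le> \<bar>b\<bar> + (\<bar>f0\<bar> + D) + 2 * ?B \<omega>" by linarith
  qed measurable
qed

lemma merit_real_integrable: "integrable M (merit_real (Suc k))"
  unfolding merit_real_def
  by (intro Bochner_Integration.integrable_add integrable_mult_right cost_integrable lag_integrable incr_V_square_integrable)

lemma F_Suc: "subalgebra (F (Suc k)) (F k)"
proof -
  have "subalgebra (H k (m k)) (H k 0)" by (rule visit_process.H_mono[OF visit_process]) auto
  then show ?thesis by (meson F_H H_F subalgebra_trans)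
qed

lemma kernel_err_square:
  "integrable M (\<lambda>\<omega>. (kernel_err (emp_P k \<omega>))\<^sup>2)"
  "(\<integral>\<omega>. (kernel_err (emp_P k \<omega>))\<^sup>2 \<partial>M) \<le> kernel_second noise_bound / real (m k)"
proof -
  have "(\<integral>\<^sup>+\<omega>. ennreal ((kernel_err (emp_P k \<omega>))\<^sup>2) \<partial>M) \<le> ennreal (kernel_second noise_bound / real (m k))"
    using kernel_err_second_moment[of "\<lambda>_. 1" k] by (simp add: emeasure_space_1)
  from integrable_nonneg_nn_integral_le[OF _ _ this]
  show "integrable M (\<lambda>\<omega>. (kernel_err (emp_P k \<omega>))\<^sup>2)"
    "(\<integral>\<omega>. (kernel_err (emp_P k \<omega>))\<^sup>2 \<partial>M) \<le> kernel_second noise_bound / real (m k)"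
    using kernel_second_nonneg[OF noise_bound_ge] by auto
qed

abbreviation moment_weight :: "nat \<Rightarrow> 'w \<Rightarrow> real" where
  "moment_weight k \<omega> \<equiv> 1 + norm (V (Suc k) \<omega>) ^ 4 + norm (V k \<omega>) ^ 4"

text \<open>The weight involves the values of indices \<open>k\<close> and \<open>Suc k\<close>,
  both measurable before batch \<open>Suc k\<close>, so the weighted second moments apply.
  Nonnegative integrals give the bound first, and integrability follows from it.\<close>

lemma model_err_weighted:
  "integrable M (\<lambda>\<omega>. model_err (emp_P (Suc k) \<omega>) (emp_r (Suc k) \<omega>) * moment_weight k \<omega>)"
  "(\<integral>\<omega>. model_err (emp_P (Suc k) \<omega>) (emp_r (Suc k) \<omega>) * moment_weight k \<omega> \<partial>M)
    \<le> (kernel_second noise_bound + reward_second noise_bound q0) * (1 + 2 * fourth_bound) / real (m (Suc k))"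
proof -
  let ?k2 = "kernel_second noise_bound" and ?r2 = "reward_second noise_bound q0" and ?m = "real (m (Suc k))"
  let ?e = "\<lambda>\<omega>. (kernel_err (emp_P (Suc k) \<omega>))\<^sup>2" and ?q = "\<lambda>\<omega>. (reward_err (emp_r (Suc k) \<omega>))\<^sup>2"
  have W0: "0 \<le> moment_weight k \<omega>" for \<omega> by simp
  have VF [measurable]: "V (Suc k) \<in> borel_measurable (F (Suc k))" "V k \<in> borel_measurable (F (Suc k))"
    using V_meas measurable_from_subalg[OF F_Suc V_meas] by auto
  have W: "moment_weight k \<in> borel_measurable (F (Suc k))" by measurable
  have intW: "integrable M (moment_weight k)"
    using value_fourth_moment by (intro Bochner_Integration.integrable_add) auto
  have EW: "(\<integral>\<omega>. moment_weight k \<omega> \<partial>M) \<le> 1 + 2 * fourth_bound"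
    using value_fourth_moment[of k] value_fourth_moment[of "Suc k"] by (simp add: prob_space)
  have EW0: "0 \<le> (\<integral>\<omega>. moment_weight k \<omega> \<partial>M)" by (rule Bochner_Integration.integral_nonneg) (rule W0)
  have k2: "0 \<le> ?k2" "0 \<le> ?r2" using kernel_second_nonneg reward_second_nonneg noise_bound_ge by auto
  have nn: "(\<integral>\<^sup>+\<omega>. ennreal (model_err (emp_P (Suc k) \<omega>) (emp_r (Suc k) \<omega>) * moment_weight k \<omega>) \<partial>M)
      \<le> ennreal ((?k2 + ?r2) * (1 + 2 * fourth_bound) / ?m)"
  proof -
    have "(\<integral>\<^sup>+\<omega>. ennreal (model_err (emp_P (Suc k) \<omega>) (emp_r (Suc k) \<omega>) * moment_weight k \<omega>) \<partial>M)
        = (\<integral>\<^sup>+\<omega>. ennreal (moment_weight k \<omega>) * ennreal (?e \<omega>) + ennreal (moment_weight k \<omega>) * ennreal (?q \<omega>) \<partial>M)"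
    proof (rule nn_integral_cong)
      fix \<omega>
      have "model_err (emp_P (Suc k) \<omega>) (emp_r (Suc k) \<omega>) * moment_weight k \<omega> = moment_weight k \<omega> * ?e \<omega> + moment_weight k \<omega> * ?q \<omega>"
        by (simp add: model_err_def algebra_simps)
      then show "ennreal (model_err (emp_P (Suc k) \<omega>) (emp_r (Suc k) \<omega>) * moment_weight k \<omega>)
          = ennreal (moment_weight k \<omega>) * ennreal (?e \<omega>) + ennreal (moment_weight k \<omega>) * ennreal (?q \<omega>)"
        using W0[of \<omega>] by (simp only: ennreal_mult'[symmetric] ennreal_plus[symmetric] mult_nonneg_nonneg zero_le_power2)
    qed
    also have "\<dots> = (\<integral>\<^sup>+\<omega>. ennreal (moment_weight k \<omega>) * ennreal (?e \<omega>) \<partial>M) + (\<integral>\<^sup>+\<omega>. ennreal (moment_weight k \<omega>) * ennreal (?q \<omega>) \<partial>M)"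
      by (rule nn_integral_add) measurable
    also have "\<dots> \<le> ennreal (?k2 / ?m) * (\<integral>\<^sup>+\<omega>. ennreal (moment_weight k \<omega>) \<partial>M) + ennreal (?r2 / ?m) * (\<integral>\<^sup>+\<omega>. ennreal (moment_weight k \<omega>) \<partial>M)"
      by (intro add_mono kernel_err_second_moment reward_err_second_moment W)
    also have "(\<integral>\<^sup>+\<omega>. ennreal (moment_weight k \<omega>) \<partial>M) = ennreal (\<integral>\<omega>. moment_weight k \<omega> \<partial>M)"
      by (rule nn_integral_eq_integral[OF intW]) (simp add: W0)
    also have "ennreal (?k2 / ?m) * ennreal (\<integral>\<omega>. moment_weight k \<omega> \<partial>M) + ennreal (?r2 / ?m) * ennreal (\<integral>\<omega>. moment_weight k \<omega> \<partial>M)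
        = ennreal (((?k2 + ?r2) / ?m) * (\<integral>\<omega>. moment_weight k \<omega> \<partial>M))"
      using k2 EW0 by (simp only: ennreal_mult'[symmetric] ennreal_plus[symmetric] mult_nonneg_nonneg divide_nonneg_nonneg of_nat_0_le_iff
          add_divide_distrib distrib_right)
    also have "\<dots> \<le> ennreal (((?k2 + ?r2) / ?m) * (1 + 2 * fourth_bound))"
      using k2 EW by (intro ennreal_leI mult_left_mono) auto
    finally show ?thesis by simp
  qed
  have b0: "0 \<le> (?k2 + ?r2) * (1 + 2 * fourth_bound) / ?m"
    using k2 order_trans[OF EW0 EW] by (intro divide_nonneg_nonneg mult_nonneg_nonneg add_nonneg_nonneg[OF k2]) simp_all
  have m: "(\<lambda>\<omega>. model_err (emp_P (Suc k) \<omega>) (emp_r (Suc k) \<omega>) * moment_weight k \<omega>) \<in> borel_measurable M"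
    unfolding model_err_def by measurable
  have nonneg: "0 \<le> model_err (emp_P (Suc k) \<omega>) (emp_r (Suc k) \<omega>) * moment_weight k \<omega>" for \<omega>
    using W0 by (intro mult_nonneg_nonneg) (auto simp: model_err_def)
  show "integrable M (\<lambda>\<omega>. model_err (emp_P (Suc k) \<omega>) (emp_r (Suc k) \<omega>) * moment_weight k \<omega>)"
    "(\<integral>\<omega>. model_err (emp_P (Suc k) \<omega>) (emp_r (Suc k) \<omega>) * moment_weight k \<omega> \<partial>M)
    \<le> (?k2 + ?r2) * (1 + 2 * fourth_bound) / ?m"
    using integrable_nonneg_nn_integral_le[OF m nonneg nn b0] by auto
qed

text \<open>The step from \<open>Suc k\<close> uses batch \<open>Suc k\<close>, while the multiplier
  there is stationary for batch \<open>k\<close>. The weight accompanies only the error of the new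
  batch; the old kernel error enters unweighted.\<close>

lemma expected_descent:
  assumes C: "descent_const C"
  shows "(\<integral>\<omega>. merit_real (Suc (Suc k)) \<omega> \<partial>M) + rate_pol * (\<integral>\<omega>. (norm (incr pol (Suc (Suc k)) \<omega>))\<^sup>2 \<partial>M)
      + rate_val * (\<integral>\<omega>. (norm (incr V (Suc (Suc k)) \<omega>))\<^sup>2 \<partial>M) + rate_prev * (\<integral>\<omega>. (norm (incr V (Suc k) \<omega>))\<^sup>2 \<partial>M)
    \<le> (\<integral>\<omega>. merit_real (Suc k) \<omega> \<partial>M)
      + C * ((kernel_second noise_bound + reward_second noise_bound q0) * (1 + 2 * fourth_bound) / real (m (Suc k))
        + kernel_second noise_bound / real (m k))"
proof -
  have C0: "0 \<le> C" using C by (simp add: descent_const_def)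
  let ?L = "\<lambda>\<omega>. merit_real (Suc (Suc k)) \<omega> + rate_pol * (norm (incr pol (Suc (Suc k)) \<omega>))\<^sup>2
      + rate_val * (norm (incr V (Suc (Suc k)) \<omega>))\<^sup>2 + rate_prev * (norm (incr V (Suc k) \<omega>))\<^sup>2"
  let ?e = "\<lambda>\<omega>. model_err (emp_P (Suc k) \<omega>) (emp_r (Suc k) \<omega>) * moment_weight k \<omega>"
  let ?g = "\<lambda>\<omega>. (kernel_err (emp_P k \<omega>))\<^sup>2"
  let ?R = "\<lambda>\<omega>. merit_real (Suc k) \<omega> + C * (?e \<omega> + ?g \<omega>)"
  have le: "?L \<omega> \<le> ?R \<omega>" if \<omega>: "\<omega> \<in> space M" for \<omega>
  proof -
    have p: "cost (Suc (Suc k)) \<omega> + lag (emp_P (Suc k) \<omega>) (emp_r (Suc k) \<omega>) (pol (Suc (Suc k)) \<omega>) (V (Suc k) \<omega>) (lam (Suc k) \<omega>)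
        + 1 / (2 * \<eta>_pol) * (norm (pol (Suc (Suc k)) \<omega> - pol (Suc k) \<omega>))\<^sup>2
      \<le> cost (Suc k) \<omega> + lag (emp_P (Suc k) \<omega>) (emp_r (Suc k) \<omega>) (pol (Suc k) \<omega>) (V (Suc k) \<omega>) (lam (Suc k) \<omega>)"
      using pol_step_real[OF \<omega> pol_policy[OF \<omega>] cost_eq[OF \<omega>], of "Suc k" "Suc k"] by simp
    show ?thesis
      using C emp_P_valid[OF \<omega>] pol_policy[OF \<omega>] dual_run[OF \<omega>, of k] p V_step_real[OF \<omega>, of "Suc k"]
        lam_step[OF \<omega>, of "Suc k"]
      unfolding descent_const_def merit_real_def incr_Suc by blast
  qed
  note int = merit_real_integrable incr_pol_square_integrable incr_V_square_integrable
    model_err_weighted(1)[of k] kernel_err_square(1)[of k]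
  have intL: "integrable M ?L" "integrable M ?R"
    by (intro Bochner_Integration.integrable_add integrable_mult_right int)+
  have "(\<integral>\<omega>. ?L \<omega> \<partial>M) \<le> (\<integral>\<omega>. ?R \<omega> \<partial>M)" by (rule integral_mono[OF intL le])
  also have "(\<integral>\<omega>. ?R \<omega> \<partial>M) = (\<integral>\<omega>. merit_real (Suc k) \<omega> \<partial>M) + C * ((\<integral>\<omega>. ?e \<omega> \<partial>M) + (\<integral>\<omega>. ?g \<omega> \<partial>M))"
    using int by simp
  also have "\<dots> \<le> (\<integral>\<omega>. merit_real (Suc k) \<omega> \<partial>M)
      + C * ((kernel_second noise_bound + reward_second noise_bound q0) * (1 + 2 * fourth_bound) / real (m (Suc k))
        + kernel_second noise_bound / real (m k))"
    by (intro add_left_mono mult_left_mono[OF _ C0] add_mono model_err_weighted(2) kernel_err_square(2))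
  finally show ?thesis using int by simp
qed

lemma expected_lower_bound:
  assumes b: "\<And>\<pi>. \<pi> \<in> policies \<Longrightarrow> ereal b \<le> \<phi> \<pi> + ereal (c \<bullet> (matrix_inv (bell_mat \<gamma> P \<pi>) *v rew_vec r \<pi>))"
  shows "b - \<kappa> ^ 4 * (norm c)\<^sup>2 / \<beta> * (kernel_second noise_bound / real (m k)) \<le> (\<integral>\<omega>. merit_real (Suc k) \<omega> \<partial>M)"
proof -
  let ?K = "\<kappa> ^ 4 * (norm c)\<^sup>2 / \<beta>"
  let ?g = "\<lambda>\<omega>. (kernel_err (emp_P k \<omega>))\<^sup>2"
  have K: "0 \<le> ?K" using \<beta>_pos by simp
  have le: "b - ?K * ?g \<omega> \<le> merit_real (Suc k) \<omega>" if \<omega>: "\<omega> \<in> space M" for \<omega>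
  proof -
    have "b \<le> cost (Suc k) \<omega> + c \<bullet> (matrix_inv (bell_mat \<gamma> P (pol (Suc k) \<omega>)) *v rew_vec r (pol (Suc k) \<omega>))"
      using b[OF pol_policy[OF \<omega>, of "Suc k"]] by (simp add: cost_eq[OF \<omega>])
    then show ?thesis
      using lag_lower_bound[OF emp_P_valid[OF \<omega>, of k] pol_policy[OF \<omega>, of "Suc k"] dual_run[OF \<omega>, of k]]
      unfolding merit_real_def incr_Suc kernel_err_def by linarith
  qed
  have int: "integrable M (\<lambda>\<omega>. b - ?K * ?g \<omega>)" using kernel_err_square(1) by simp
  have "b - ?K * (kernel_second noise_bound / real (m k)) \<le> b - ?K * (\<integral>\<omega>. ?g \<omega> \<partial>M)"
    by (intro diff_left_mono mult_left_mono[OF _ K] kernel_err_square(2))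
  also have "\<dots> = (\<integral>\<omega>. b - ?K * ?g \<omega> \<partial>M)" using kernel_err_square(1)[of k] by (simp add: prob_space)
  also have "\<dots> \<le> (\<integral>\<omega>. merit_real (Suc k) \<omega> \<partial>M)" by (rule integral_mono[OF int merit_real_integrable le])
  finally show ?thesis .
qed

end

text \<open>Independence of the schedule is expressed by the order of the quantifiers: the constants
  precede the probability space and the batch sizes. Finiteness and integrability belong to the
  conclusion because \<open>real_of_ereal\<close> and the Bochner integral return default values
  otherwise.\<close>

theorem lemma4p6:
  fixes \<gamma> \<rho>_min \<alpha> R_max M4 \<kappa> L_M \<beta> \<eta>_pol \<eta>_val :: real
    and P p0 :: "'s::finite \<Rightarrow> 'a::finite \<Rightarrow> 's \<Rightarrow> real"
    and r q0 :: "'s \<Rightarrow> 'a \<Rightarrow> real"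
    and \<rho> :: "'s \<Rightarrow> real"
    and \<phi> :: "real^'a^'s \<Rightarrow> ereal"
    and c :: "real^'s"
    and pol0 :: "real^'a^'s"
    and \<mu>0 :: "((real^'s) \<times> (real^'s)) measure"
  assumes "bellman_admm_setup \<gamma> P r \<rho> \<phi> c \<rho>_min \<alpha> R_max p0 \<kappa> L_M \<beta> \<eta>_pol \<eta>_val pol0 \<mu>0"
  shows "\<exists>c_pol c_V c_V' C_E \<Phi>_low C_L :: real.
    0 < c_pol \<and> 0 < c_V \<and> 0 < c_V' \<and> 0 < C_E \<and> 0 < C_L \<and>
    (\<forall>(M :: 'w measure) m F H G S A U Y bpol pol V lam.
      bellman_admm_run \<gamma> P r \<rho> \<phi> c \<rho>_min \<alpha> R_max p0 \<kappa> L_M \<beta> \<eta>_pol \<eta>_val pol0 \<mu>0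
        M M4 q0 m F H G S A U Y bpol pol V lam \<longrightarrow>
      (let \<Phi> = merit \<phi> c \<beta> \<gamma> P r (1 / (8 * \<eta>_val)) pol V lam;
           E\<Phi> = (\<lambda>k. \<integral>\<omega>. real_of_ereal (\<Phi> k \<omega>) \<partial>M)
       in
        (\<forall>k\<ge>1.
          (\<forall>\<omega>\<in>space M. \<bar>\<Phi> k \<omega>\<bar> \<noteq> \<infinity>) \<and>
          integrable M (\<lambda>\<omega>. real_of_ereal (\<Phi> k \<omega>)) \<and>
          integrable M (\<lambda>\<omega>. (norm (incr pol k \<omega>))\<^sup>2) \<and>
          integrable M (\<lambda>\<omega>. (norm (incr V k \<omega>))\<^sup>2)) \<and>
        (\<forall>k\<ge>1. E\<Phi> k - E\<Phi> (k + 1) \<ge>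
            c_pol * (\<integral>\<omega>. (norm (incr pol (k + 1) \<omega>))\<^sup>2 \<partial>M)
          + c_V * (\<integral>\<omega>. (norm (incr V (k + 1) \<omega>))\<^sup>2 \<partial>M)
          + c_V' * (\<integral>\<omega>. (norm (incr V k \<omega>))\<^sup>2 \<partial>M)
          - C_E * (1 / real (m k) + 1 / real (m (k - 1)))) \<and>
        (\<forall>k\<ge>1. E\<Phi> k \<ge> \<Phi>_low - C_L / real (m (k - 1)))))"
proof -
  interpret bellman_admm_setup \<gamma> P r \<rho> \<phi> c \<rho>_min \<alpha> R_max p0 \<kappa> L_M \<beta> \<eta>_pol \<eta>_val pol0 \<mu>0 by fact
  \<comment> \<open>Repeats \<open>noise_bound\<close>, which exists only inside a run, so that the
    constants can be formed beforehand.\<close>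
  define B where "B = max 1 M4"
  define k2 where "k2 = kernel_second B"
  define r2 where "r2 = reward_second B q0"
  define W where "W = 1 + 2 * value_moment (reward_fourth B q0)"
  obtain C where C: "descent_const C" using descent_const_exists by blast
  then have C0: "0 \<le> C" by (simp add: descent_const_def)
  obtain b where b: "\<And>\<pi>. \<pi> \<in> policies \<Longrightarrow> ereal b \<le> \<phi> \<pi> + ereal (c \<bullet> (matrix_inv (bell_mat \<gamma> P \<pi>) *v rew_vec r \<pi>))"
    using reduced_bdd_below by (auto simp: bdd_below_on_def)
  have k2: "0 \<le> k2" and r2: "0 \<le> r2"
    by (auto simp: k2_def r2_def B_def intro: kernel_second_nonneg reward_second_nonneg)
  have "0 \<le> (\<integral>x. norm (fst x) ^ 4 \<partial>\<mu>0)" by (rule Bochner_Integration.integral_nonneg) simp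
  then have "0 \<le> value_moment (reward_fourth B q0)" unfolding value_moment_def by (rule max.coboundedI1)
  then have W: "0 \<le> W" by (simp add: W_def)
  \<comment> \<open>The summand 1 here and in \<open>C_L\<close> makes the constants strictly
    positive even if the error coefficients vanish.\<close>
  define C_E where "C_E = C * ((k2 + r2) * W + k2) + 1"
  define C_L where "C_L = \<kappa> ^ 4 * (norm c)\<^sup>2 / \<beta> * k2 + 1"
  have pos: "0 < rate_pol" "0 < rate_val" "0 < rate_prev" "0 < C_E" "0 < C_L"
    using step_sizes C0 k2 r2 W \<beta>_pos
    by (auto simp: rate_pol_def rate_val_def rate_prev_def C_E_def C_L_def intro!: add_nonneg_pos mult_nonneg_nonneg)
  show ?thesis
  proof (rule exI[of _ rate_pol], rule exI[of _ rate_val], rule exI[of _ rate_prev], rule exI[of _ C_E],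
      rule exI[of _ b], rule exI[of _ C_L], intro conjI pos allI impI)
    fix M :: "'w measure" and m F H G S A U Y bpol pol V lam
    assume "bellman_admm_run \<gamma> P r \<rho> \<phi> c \<rho>_min \<alpha> R_max p0 \<kappa> L_M \<beta> \<eta>_pol \<eta>_val pol0 \<mu>0
        M M4 q0 m F H G S A U Y bpol pol V lam"
    then interpret run: bellman_admm_run \<gamma> P r \<rho> \<phi> c \<rho>_min \<alpha> R_max p0 \<kappa> L_M \<beta> \<eta>_pol \<eta>_val pol0 \<mu>0
        M M4 q0 m F H G S A U Y bpol pol V lam .
    have B: "run.noise_bound = B" by (simp add: run.noise_bound_def B_def)
    let ?\<Phi> = "merit \<phi> c \<beta> \<gamma> P r (1 / (8 * \<eta>_val)) pol V lam"
    have E: "(\<integral>\<omega>. real_of_ereal (?\<Phi> k \<omega>) \<partial>M) = (\<integral>\<omega>. run.merit_real k \<omega> \<partial>M)" for k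
      by (intro Bochner_Integration.integral_cong refl) (simp add: run.merit_eq)
    have I: "integrable M (\<lambda>\<omega>. real_of_ereal (?\<Phi> (Suc j) \<omega>))" for j
      by (rule iffD2[OF Bochner_Integration.integrable_cong[OF refl] run.merit_real_integrable]) (simp add: run.merit_eq)
    have 1: "(\<forall>\<omega>\<in>space M. \<bar>?\<Phi> (Suc j) \<omega>\<bar> \<noteq> \<infinity>) \<and> integrable M (\<lambda>\<omega>. real_of_ereal (?\<Phi> (Suc j) \<omega>)) \<and>
        integrable M (\<lambda>\<omega>. (norm (incr pol (Suc j) \<omega>))\<^sup>2) \<and> integrable M (\<lambda>\<omega>. (norm (incr V (Suc j) \<omega>))\<^sup>2)" for j
      using I run.incr_pol_square_integrable run.incr_V_square_integrable by (simp add: run.merit_eq)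
    have 2: "(\<integral>\<omega>. run.merit_real (Suc j) \<omega> \<partial>M) - (\<integral>\<omega>. run.merit_real (Suc (Suc j)) \<omega> \<partial>M)
        \<ge> rate_pol * (\<integral>\<omega>. (norm (incr pol (Suc (Suc j)) \<omega>))\<^sup>2 \<partial>M)
          + rate_val * (\<integral>\<omega>. (norm (incr V (Suc (Suc j)) \<omega>))\<^sup>2 \<partial>M)
          + rate_prev * (\<integral>\<omega>. (norm (incr V (Suc j) \<omega>))\<^sup>2 \<partial>M)
          - C_E * (1 / real (m (Suc j)) + 1 / real (m j))" for j
    proof -
      have "C * ((k2 + r2) * W / real (m (Suc j)) + k2 / real (m j)) \<le> C_E * (1 / real (m (Suc j)) + 1 / real (m j))"
      proof -
        define x where "x = 1 / real (m (Suc j))"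
        define y where "y = 1 / real (m j)"
        have xy: "0 \<le> x" "0 \<le> y" by (auto simp: x_def y_def)
        have "(k2 + r2) * W * x + k2 * y \<le> ((k2 + r2) * W + k2) * (x + y)"
          using xy k2 r2 W by (simp add: algebra_simps)
        then have "C * ((k2 + r2) * W * x + k2 * y) \<le> C * (((k2 + r2) * W + k2) * (x + y))"
          by (rule mult_left_mono[OF _ C0])
        also have "\<dots> \<le> C_E * (x + y)" using xy by (simp add: C_E_def algebra_simps)
        finally show ?thesis by (simp add: x_def y_def)
      qed
      then show ?thesis
        using run.expected_descent[OF C, of j, unfolded B, folded k2_def r2_def W_def] by linarith
    qed
    have 3: "(\<integral>\<omega>. run.merit_real (Suc j) \<omega> \<partial>M) \<ge> b - C_L / real (m j)" for j
    proof -
      have "\<kappa> ^ 4 * (norm c)\<^sup>2 / \<beta> * (k2 / real (m j)) \<le> C_L / real (m j)"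
        by (simp add: C_L_def add_divide_distrib)
      then show ?thesis
        using run.expected_lower_bound[OF b, of j, unfolded B, folded k2_def] by linarith
    qed
    have ge1: "(\<forall>k\<ge>1. Q k) \<longleftrightarrow> (\<forall>j. Q (Suc j))" for Q :: "nat \<Rightarrow> bool"
      by (metis One_nat_def Suc_le_D Suc_le_mono le0)
    show "let \<Phi> = ?\<Phi>; E\<Phi> = (\<lambda>k. \<integral>\<omega>. real_of_ereal (\<Phi> k \<omega>) \<partial>M)
       in
        (\<forall>k\<ge>1.
          (\<forall>\<omega>\<in>space M. \<bar>\<Phi> k \<omega>\<bar> \<noteq> \<infinity>) \<and>
          integrable M (\<lambda>\<omega>. real_of_ereal (\<Phi> k \<omega>)) \<and>
          integrable M (\<lambda>\<omega>. (norm (incr pol k \<omega>))\<^sup>2) \<and>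
          integrable M (\<lambda>\<omega>. (norm (incr V k \<omega>))\<^sup>2)) \<and>
        (\<forall>k\<ge>1. E\<Phi> k - E\<Phi> (k + 1) \<ge>
            rate_pol * (\<integral>\<omega>. (norm (incr pol (k + 1) \<omega>))\<^sup>2 \<partial>M)
          + rate_val * (\<integral>\<omega>. (norm (incr V (k + 1) \<omega>))\<^sup>2 \<partial>M)
          + rate_prev * (\<integral>\<omega>. (norm (incr V k \<omega>))\<^sup>2 \<partial>M)
          - C_E * (1 / real (m k) + 1 / real (m (k - 1)))) \<and>
        (\<forall>k\<ge>1. E\<Phi> k \<ge> b - C_L / real (m (k - 1)))"
      unfolding Let_def E ge1 using 1 2 3 by simp
  qed
qed

end
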